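(* Let $0<\alpha<\beta<1$ be fixed. For any underlying distribution function $H_F$, when $\sigma_g^2>0$, as $n\to\infty$, $$\frac{\sqrt n}{m}\,(L_{\alpha\beta}-\theta)\ \stackrel{d}{\longrightarrow}\ \tau_g-\Delta\xi_\alpha\, I(\tau_\alpha>0)\,\tau_\alpha-\Delta\xi_\beta\, I(\tau_\beta<0)\,\tau_\beta ,$$ where $(\tau_\alpha,\tau_g,\tau_\beta)$ is a trivariate Gaussian random vector with mean vector zero and covariance matrix $$\begin{pmatrix}\sigma_{g_\alpha}^2 & c_{gg_\alpha} & c_{g_\alpha g_\beta}\\ c_{gg_\alpha} & \sigma_g^2 & c_{gg_\beta}\\ c_{g_\alpha g_\beta} & c_{gg_\beta} & \sigma_{g_\beta}^2\end{pmatrix}.$$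
   Context: Let $X,X_1,X_2,\ldots$ be i.i.d. random variables with values in a measurable space $(\mathsf X,\mathcal B(\mathsf X))$ with common distribution $F$. Let $m\ge 1$ be a fixed integer, let $h:\mathsf X^m\to\mathbb R$ be a symmetric (measurable) function, and let $H_F$ be the (right-continuous) distribution function of $h(X_1,\ldots,X_m)$. For $n\ge m$ let $N=\binom{n}{m}$, let $h_1,\ldots,h_N$ be an enumeration of the values $h(X_{i_1},\ldots,X_{i_m})$ over all $1\le i_1<\cdots<i_m\le n$, and let $h_{n1}\le\cdots\le h_{nN}$ be the ordered values of $h_1,\ldots,h_N$. $[a]$ denotes the largest integer $\le a$; $I\{A\}$ (or $I(A)$) denotes the indicator of $A$; $H(x-)$ denotes the left limit at $x$. Let $H_n(y)=N^{-1}\sum_{i=1}^N I\{h_i\le y\}$, $y\in\mathbb R$. For $0<\gamma<1$ put $\bar N_\gamma=-[-\gamma N]$, and put $h_\alpha=h_{n\bar N_\alpha}$, $h_\beta=h_{n\bar N_\beta}$. The trimmed statistic is $$L_{\alpha\beta}=\int_{[h_\alpha,h_\beta)}x\,\mathrm dH_n(x)$$ (the lower limit is included and the upper limit excluded). For $\gamma\in\{\alpha,\beta\}$ let $$\xi_\gamma^-=\inf\{x\in\mathbb R: H_F(x)\ge\gamma\},\qquad \xi_\gamma^+=\sup\{x\in\mathbb R: H_F(x)\le\gamma\},\qquad \Delta\xi_\gamma=\xi_\gamma^+-\xi_\gamma^- .$$ Let $$\theta=\int_{\mathbb R}\Bigl[\bigl((x-\xi^-_\beta)I\{x\le\xi^-_\beta\}+\beta\xi^-_\beta\bigr)-\bigl((x-\xi^+_\alpha)I\{x<\xi^+_\alpha\}+\alpha\xi^+_\alpha\bigr)\Bigr]\,\mathrm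 dH_F(x),$$ and for $x\in\mathsf X$, writing $h(x,\cdot)=h(x,X_2,\ldots,X_m)$, $$g(x)=\bigl[E\,I\{h(x,\cdot)\le\xi^-_\beta\}(h(x,\cdot)-\xi^-_\beta)+\beta\xi^-_\beta\bigr]-\bigl[E\,I\{h(x,\cdot)<\xi^+_\alpha\}(h(x,\cdot)-\xi^+_\alpha)+\alpha\xi^+_\alpha\bigr]-\theta,$$ $$g_\alpha(x)=E\,I\{h(x,\cdot)<\xi^+_\alpha\}-H_F(\xi^+_\alpha-),\qquad g_\beta(x)=E\,I\{h(x,\cdot)\le\xi^-_\beta\}-H_F(\xi^-_\beta).$$ Finally $\sigma_g^2=Eg^2(X)$, $\sigma_{g_\alpha}^2=Eg_\alpha^2(X)$, $\sigma_{g_\beta}^2=Eg_\beta^2(X)$, $c_{gg_\alpha}=Eg(X)g_\alpha(X)$, $c_{gg_\beta}=Eg(X)g_\beta(X)$, $c_{g_\alpha g_\beta}=Eg_\alpha(X)g_\beta(X)$.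
   Formalization: L_{αβ} is N^{-1} times the sum of h_{nk} over ranks N̄_α ≤ k < N̄_β; under ties at h_α or h_β it differs from the integral, for which the claim fails (m=1, h=id, fair 0/1 data, α=1/4, β=3/4). The two brackets of g share one expectation. *)

theory Defs
  imports "HOL-Probability.Probability" "HOL-Combinatorics.Permutations"
begin

section \<open>The kernel and its distribution\<close>

text \<open>
  A point of the \<open>m\<close>-fold product is an extensional function on \<open>{1..m}\<close>, i.e. an element
  of \<open>space (Pi\<^sub>M {1..m} (\<lambda>_. S))\<close>.
\<close>

definition symmetric_kernel :: "'x measure \<Rightarrow> nat \<Rightarrow> ((nat \<Rightarrow> 'x) \<Rightarrow> real) \<Rightarrow> bool" where
  "symmetric_kernel S m h \<longleftrightarrow>
     (\<forall>p x. p permutes {1..m} \<longrightarrow> x \<in> space (Pi\<^sub>M {1..m} (\<lambda>_. S)) \<longrightarrow> h (x \<circ> p) = h x)"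

definition kernel_df ::
    "'w measure \<Rightarrow> (nat \<Rightarrow> 'w \<Rightarrow> 'x) \<Rightarrow> nat \<Rightarrow> ((nat \<Rightarrow> 'x) \<Rightarrow> real) \<Rightarrow> real \<Rightarrow> real" where
  "kernel_df M X m h = cdf (distr M borel (\<lambda>\<omega>. h (\<lambda>j\<in>{1..m}. X j \<omega>)))"

section \<open>The trimmed U-statistic\<close>

definition index_tuples :: "nat \<Rightarrow> nat \<Rightarrow> (nat \<Rightarrow> nat) set" where
  "index_tuples m n = {i \<in> {1..m} \<rightarrow>\<^sub>E {1..n}. strict_mono_on {1..m} i}"

definition kernel_values ::
    "(nat \<Rightarrow> 'w \<Rightarrow> 'x) \<Rightarrow> nat \<Rightarrow> ((nat \<Rightarrow> 'x) \<Rightarrow> real) \<Rightarrow> nat \<Rightarrow> 'w \<Rightarrow> real list" where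
  "kernel_values X m h n \<omega> =
     sorted_list_of_multiset
       (image_mset (\<lambda>i. h (\<lambda>j\<in>{1..m}. X (i j) \<omega>)) (mset_set (index_tuples m n)))"

text \<open>The rank \<open>k\<close> counts from 1.\<close>

definition order_stat ::
    "(nat \<Rightarrow> 'w \<Rightarrow> 'x) \<Rightarrow> nat \<Rightarrow> ((nat \<Rightarrow> 'x) \<Rightarrow> real) \<Rightarrow> nat \<Rightarrow> 'w \<Rightarrow> nat \<Rightarrow> real" where
  "order_stat X m h n \<omega> k = kernel_values X m h n \<omega> ! (k - 1)"

definition cut_rank :: "nat \<Rightarrow> nat \<Rightarrow> real \<Rightarrow> nat" where
  "cut_rank m n \<gamma> = nat (- \<lfloor>- \<gamma> * real (n choose m)\<rfloor>)"

definition empirical_df ::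
    "(nat \<Rightarrow> 'w \<Rightarrow> 'x) \<Rightarrow> nat \<Rightarrow> ((nat \<Rightarrow> 'x) \<Rightarrow> real) \<Rightarrow> nat \<Rightarrow> 'w \<Rightarrow> real \<Rightarrow> real" where
  "empirical_df X m h n \<omega> y =
     (\<Sum>i\<in>index_tuples m n. indicator {..y} (h (\<lambda>j\<in>{1..m}. X (i j) \<omega>))) / real (n choose m)"

text \<open>
  The trimmed statistic is the integral of \<open>x\<close> with respect to the empirical distribution
  function from the order statistic of rank \<open>cut_rank m n \<alpha>\<close> (included) to the one of rank
  \<open>cut_rank m n \<beta>\<close> (excluded). The two limits are positions in the ordered sample, not just
  real numbers: values tied with a limit are kept or trimmed according to their rank. If no
  value of lower rank is tied with a limit, this is the Stieltjes integral over the real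
  interval, see \<open>trimmed_stat_eq_integral\<close> below. With such ties the two differ:
  for \<open>m = 1\<close>, \<open>h\<close> the identity, fair 0/1-valued observations, \<open>\<alpha> = 1/4\<close> and \<open>\<beta> = 3/4\<close>, the integral over the real
  interval \<open>[0, 1)\<close> vanishes with probability tending to 1, whereas the centring constant
  \<open>\<theta>\<close> equals \<open>1/4\<close>, so that no limit theorem centred at \<open>\<theta>\<close> can hold for it.
\<close>

definition trimmed_stat ::
    "(nat \<Rightarrow> 'w \<Rightarrow> 'x) \<Rightarrow> nat \<Rightarrow> ((nat \<Rightarrow> 'x) \<Rightarrow> real) \<Rightarrow> real \<Rightarrow> real \<Rightarrow> nat \<Rightarrow> 'w \<Rightarrow> real" where
  "trimmed_stat X m h \<alpha> \<beta> n \<omega> =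
     (\<Sum>k\<in>{cut_rank m n \<alpha>..<cut_rank m n \<beta>}. order_stat X m h n \<omega> k) / real (n choose m)"

section \<open>Quantiles, centring and projections\<close>

definition lower_quantile :: "(real \<Rightarrow> real) \<Rightarrow> real \<Rightarrow> real" where
  "lower_quantile H \<gamma> = Inf {x. H x \<ge> \<gamma>}"

definition upper_quantile :: "(real \<Rightarrow> real) \<Rightarrow> real \<Rightarrow> real" where
  "upper_quantile H \<gamma> = Sup {x. H x \<le> \<gamma>}"

definition quantile_gap :: "(real \<Rightarrow> real) \<Rightarrow> real \<Rightarrow> real" where
  "quantile_gap H \<gamma> = upper_quantile H \<gamma> - lower_quantile H \<gamma>"

definition trim_fun :: "(real \<Rightarrow> real) \<Rightarrow> real \<Rightarrow> real \<Rightarrow> real \<Rightarrow> real" where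
  "trim_fun H \<alpha> \<beta> x =
     ((x - lower_quantile H \<beta>) * indicator {..lower_quantile H \<beta>} x + \<beta> * lower_quantile H \<beta>)
   - ((x - upper_quantile H \<alpha>) * indicator {..<upper_quantile H \<alpha>} x + \<alpha> * upper_quantile H \<alpha>)"

definition trim_center :: "(real \<Rightarrow> real) \<Rightarrow> real \<Rightarrow> real \<Rightarrow> real" where
  "trim_center H \<alpha> \<beta> = (LINT x|interval_measure H. trim_fun H \<alpha> \<beta> x)"

text \<open>The random variable \<open>h(x, X\<^sub>2, \<dots>, X\<^sub>m)\<close>.\<close>

definition kernel_at ::
    "(nat \<Rightarrow> 'w \<Rightarrow> 'x) \<Rightarrow> nat \<Rightarrow> ((nat \<Rightarrow> 'x) \<Rightarrow> real) \<Rightarrow> 'x \<Rightarrow> 'w \<Rightarrow> real" where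
  "kernel_at X m h x \<omega> = h ((\<lambda>j\<in>{1..m}. X j \<omega>)(1 := x))"

text \<open>
  The two brackets of \<open>g\<close> are put under one expectation: their difference \<open>trim_fun\<close> is
  bounded, while each bracket alone need not be integrable because no moment
  assumption is made on the kernel.
\<close>

definition proj_g ::
    "'w measure \<Rightarrow> (nat \<Rightarrow> 'w \<Rightarrow> 'x) \<Rightarrow> nat \<Rightarrow> ((nat \<Rightarrow> 'x) \<Rightarrow> real) \<Rightarrow> real \<Rightarrow> real \<Rightarrow> 'x \<Rightarrow> real" where
  "proj_g M X m h \<alpha> \<beta> x =
     (LINT \<omega>|M. trim_fun (kernel_df M X m h) \<alpha> \<beta> (kernel_at X m h x \<omega>))
     - trim_center (kernel_df M X m h) \<alpha> \<beta>"

definition proj_lower ::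
    "'w measure \<Rightarrow> (nat \<Rightarrow> 'w \<Rightarrow> 'x) \<Rightarrow> nat \<Rightarrow> ((nat \<Rightarrow> 'x) \<Rightarrow> real) \<Rightarrow> real \<Rightarrow> 'x \<Rightarrow> real" where
  "proj_lower M X m h \<alpha> x =
     (LINT \<omega>|M. indicator {..<upper_quantile (kernel_df M X m h) \<alpha>} (kernel_at X m h x \<omega>))
     - Lim (at_left (upper_quantile (kernel_df M X m h) \<alpha>)) (kernel_df M X m h)"

definition proj_upper ::
    "'w measure \<Rightarrow> (nat \<Rightarrow> 'w \<Rightarrow> 'x) \<Rightarrow> nat \<Rightarrow> ((nat \<Rightarrow> 'x) \<Rightarrow> real) \<Rightarrow> real \<Rightarrow> 'x \<Rightarrow> real" where
  "proj_upper M X m h \<beta> x =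
     (LINT \<omega>|M. indicator {..lower_quantile (kernel_df M X m h) \<beta>} (kernel_at X m h x \<omega>))
     - kernel_df M X m h (lower_quantile (kernel_df M X m h) \<beta>)"

section \<open>Gaussian random vectors\<close>

definition normal_law :: "real \<Rightarrow> real \<Rightarrow> real measure" where
  "normal_law \<mu> \<sigma> = (if \<sigma> = 0 then return borel \<mu> else density lborel (normal_density \<mu> \<sigma>))"

text \<open>Degenerate vectors are allowed, since the limiting covariance matrix may be singular.\<close>

definition gaussian_vector :: "'b measure \<Rightarrow> ('b \<Rightarrow> real ^ 'n) \<Rightarrow> bool" where
  "gaussian_vector P T \<longleftrightarrow> T \<in> borel_measurable P \<and>
     (\<forall>a. \<exists>\<mu> \<sigma>. \<sigma> \<ge> 0 \<and> distr P borel (\<lambda>\<omega>. a \<bullet> T \<omega>) = normal_law \<mu> \<sigma>)"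

definition mean_vector :: "'b measure \<Rightarrow> ('b \<Rightarrow> real ^ 'n) \<Rightarrow> real ^ 'n" where
  "mean_vector P T = (\<chi> i. LINT \<omega>|P. T \<omega> $ i)"

definition covariance_matrix :: "'b measure \<Rightarrow> ('b \<Rightarrow> real ^ 'n) \<Rightarrow> real ^ 'n ^ 'n" where
  "covariance_matrix P T =
     (\<chi> i j. LINT \<omega>|P. (T \<omega> $ i - mean_vector P T $ i) * (T \<omega> $ j - mean_vector P T $ j))"

section \<open>The trimmed statistic as a Stieltjes integral\<close>

lemma finite_index_tuples: "finite (index_tuples m n)"
  unfolding index_tuples_def by (rule finite_subset[OF _ finite_PiE[of "{1..m}" "\<lambda>_. {1..n}"]]) auto

lemma card_index_tuples: "card (index_tuples m n) = n choose m"
proof -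
  have inj: "inj_on (\<lambda>i. i ` {1..m}) (index_tuples m n)"
  proof (rule inj_onI)
    fix i i' assume i: "i \<in> index_tuples m n" and i': "i' \<in> index_tuples m n"
      and eq: "i ` {1..m} = i' ` {1..m}"
    have srt: "sorted_wrt (<) (map f [1..<Suc m])" if "f \<in> index_tuples m n" for f
    proof -
      have sm: "strict_mono_on {1..m} f" using that by (simp add: index_tuples_def)
      show ?thesis
        unfolding sorted_wrt_map
        by (rule sorted_wrt_mono_rel[OF _ sorted_wrt_upt])
           (use sm in \<open>auto simp: strict_mono_on_def\<close>)
    qed
    have "map i [1..<Suc m] = map i' [1..<Suc m]"
    proof (rule sorted_distinct_set_unique)
      show "set (map i [1..<Suc m]) = set (map i' [1..<Suc m])"
        using eq by (simp only: set_map set_upt atLeastLessThanSuc_atLeastAtMost)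
    qed (use srt[OF i] srt[OF i'] in \<open>simp_all add: strict_sorted_iff del: upt_Suc\<close>)
    hence "\<forall>j\<in>{1..m}. i j = i' j" by (auto simp del: upt_Suc)
    thus "i = i'" using i i' unfolding index_tuples_def
      by (intro PiE_ext[of i "{1..m}" "\<lambda>_. {1..n}" i']) auto
  qed
  have "(\<lambda>i. i ` {1..m}) ` index_tuples m n = {A. A \<subseteq> {1..n} \<and> card A = m}"
  proof (intro equalityI subsetI)
    fix A assume "A \<in> (\<lambda>i. i ` {1..m}) ` index_tuples m n"
    then obtain i where i: "i \<in> index_tuples m n" "A = i ` {1..m}" by auto
    have "inj_on i {1..m}" using i(1) by (auto simp: index_tuples_def intro: strict_mono_on_imp_inj_on)
    thus "A \<in> {A. A \<subseteq> {1..n} \<and> card A = m}"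
      using i by (auto simp: card_image index_tuples_def)
  next
    fix A assume A: "A \<in> {A. A \<subseteq> {1..n} \<and> card A = m}"
    hence fA: "finite A" by (auto intro: finite_subset)
    define xs where "xs = sorted_list_of_set A"
    have xs: "length xs = m" "set xs = A" "sorted_wrt (<) xs"
      using A fA by (auto simp: xs_def)
    define i where "i = (\<lambda>j\<in>{1..m}. xs ! (j - 1))"
    have im: "i ` {1..m} = A"
    proof -
      have "i ` {1..m} = (\<lambda>j. xs ! (j - 1)) ` {1..m}" by (auto simp: i_def)
      also have "\<dots> = (\<lambda>j. xs ! (j - 1)) ` Suc ` {..<m}" by (simp only: image_Suc_lessThan)
      also have "\<dots> = set xs"
        using xs(1) by (auto simp: image_image set_conv_nth)
      finally show ?thesis by (simp only: xs(2))
    qed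
    have "strict_mono_on {1..m} i"
      using xs by (auto simp: strict_mono_on_def i_def intro!: sorted_wrt_nth_less[of "(<)" xs])
    moreover have "i \<in> {1..m} \<rightarrow>\<^sub>E {1..n}"
    proof -
      have "i \<in> extensional {1..m}" by (simp add: i_def)
      moreover have "i j \<in> {1..n}" if "j \<in> {1..m}" for j
        using im A that by blast
      ultimately show ?thesis by (auto simp: PiE_def)
    qed
    ultimately have "i \<in> index_tuples m n" by (simp add: index_tuples_def)
    thus "A \<in> (\<lambda>i. i ` {1..m}) ` index_tuples m n" using im by blast
  qed
  hence "card (index_tuples m n) = card {A. A \<subseteq> {1..n} \<and> card A = m}"
    using card_image[OF inj] by simp
  thus ?thesis using n_subsets[of "{1..n}" m] by simp
qed

lemma length_kernel_values: "length (kernel_values X m h n \<omega>) = n choose m"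
  unfolding kernel_values_def
  by (metis card_index_tuples mset_sorted_list_of_multiset size_image_mset size_mset size_mset_set)

lemma sum_index_tuples_eq_sum_nth:
  "(\<Sum>i\<in>index_tuples m n. f (h (\<lambda>j\<in>{1..m}. X (i j) \<omega>)))
     = (\<Sum>k<(n choose m). f (kernel_values X m h n \<omega> ! k) :: real)"
proof -
  have "(\<Sum>i\<in>index_tuples m n. f (h (\<lambda>j\<in>{1..m}. X (i j) \<omega>)))
      = sum_mset (image_mset f (mset (kernel_values X m h n \<omega>)))"
    unfolding kernel_values_def
    by (simp add: sum_unfold_sum_mset multiset.map_comp comp_def)
  also have "\<dots> = sum_list (map f (kernel_values X m h n \<omega>))"
    by (metis mset_map sum_mset_sum_list)
  also have "\<dots> = (\<Sum>k<(n choose m). f (kernel_values X m h n \<omega> ! k))"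
    by (simp add: sum_list_sum_nth length_kernel_values atLeast0LessThan)
  finally show ?thesis .
qed

lemma integral_empirical_df:
  fixes f :: "real \<Rightarrow> real"
  assumes "m \<le> n" and [measurable]: "f \<in> borel_measurable borel"
  shows "(LINT x|interval_measure (empirical_df X m h n \<omega>). f x)
           = (\<Sum>k<(n choose m). f (kernel_values X m h n \<omega> ! k)) / real (n choose m)"
proof -
  define N where "N = n choose m"
  have N: "N > 0" using assms by (simp add: N_def)
  define v where "v = (\<lambda>k. kernel_values X m h n \<omega> ! k)"
  define U where "U = uniform_count_measure {..<N}"
  interpret U: prob_space U
    unfolding U_def using N by (intro prob_space_uniform_count_measure) auto
  have v[measurable]: "v \<in> borel_measurable U"
    by (simp add: U_def measurable_def)
  interpret D: real_distribution "distr U borel v"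
    by (intro U.real_distribution_distr) simp
  have "cdf (distr U borel v) y = empirical_df X m h n \<omega> y" for y
  proof -
    have "cdf (distr U borel v) y = measure U (v -` {..y} \<inter> {..<N})"
      by (simp add: cdf_def measure_distr) (simp add: U_def space_uniform_count_measure)
    also have "\<dots> = (\<Sum>k<N. indicator {..y} (v k)) / N"
      by (simp add: U_def measure_uniform_count_measure)
         (simp add: indicator_def sum.If_cases Int_def conj_commute)
    also have "\<dots> = empirical_df X m h n \<omega> y"
      unfolding empirical_df_def N_def v_def
      by (simp only: sum_index_tuples_eq_sum_nth[where f="indicator {..y}"])
    finally show ?thesis .
  qed
  hence emp: "empirical_df X m h n \<omega> = cdf (distr U borel v)" by auto
  have "interval_measure (cdf (distr U borel v)) = distr U borel v"
  proof (rule cdf_unique)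
    show R: "real_distribution (interval_measure (cdf (distr U borel v)))"
      by (intro real_distribution_interval_measure D.cdf_nondecreasing D.cdf_is_right_cont
          D.cdf_lim_at_bot D.cdf_lim_at_top_prob)
    show "real_distribution (distr U borel v)" by (fact D.real_distribution_axioms)
    show "cdf (interval_measure (cdf (distr U borel v))) = cdf (distr U borel v)"
      by (intro cdf_interval_measure D.cdf_nondecreasing D.cdf_is_right_cont
          D.cdf_lim_at_bot D.cdf_lim_at_top_prob)
  qed
  hence "(LINT x|interval_measure (empirical_df X m h n \<omega>). f x) = (LINT k|U. f (v k))"
    unfolding emp by (simp add: integral_distr)
  also have "\<dots> = (\<Sum>k<N. f (v k)) / N"
    by (simp add: U_def integral_uniform_count_measure)
  finally show ?thesis by (simp add: N_def v_def)
qed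

lemma trimmed_stat_eq_integral:
  assumes mn: "m \<le> n" and ab: "0 < \<alpha>" "\<alpha> < \<beta>" "\<beta> < 1"
    and no_tie: "\<And>\<gamma> k. \<gamma> \<in> {\<alpha>, \<beta>} \<Longrightarrow> 1 \<le> k \<Longrightarrow> k < cut_rank m n \<gamma> \<Longrightarrow>
                   order_stat X m h n \<omega> k < order_stat X m h n \<omega> (cut_rank m n \<gamma>)"
  shows "trimmed_stat X m h \<alpha> \<beta> n \<omega> =
     (LINT x:{order_stat X m h n \<omega> (cut_rank m n \<alpha>)..<order_stat X m h n \<omega> (cut_rank m n \<beta>)}
        |interval_measure (empirical_df X m h n \<omega>). x)"
proof -
  define N where "N = n choose m"
  have N: "real N > 0" using mn by (simp add: N_def)
  have rank: "1 \<le> cut_rank m n \<gamma> \<and> cut_rank m n \<gamma> \<le> N" if "0 < \<gamma>" "\<gamma> < 1" for \<gamma>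
  proof -
    have "- \<gamma> * real N < 0" "- \<gamma> * real N \<ge> - real N" using that N by auto
    hence "\<lfloor>- \<gamma> * real N\<rfloor> < 0" "\<lfloor>- \<gamma> * real N\<rfloor> \<ge> - int N"
      by (linarith, simp add: le_floor_iff)
    thus ?thesis unfolding cut_rank_def N_def[symmetric] by linarith
  qed
  define a b where "a = cut_rank m n \<alpha>" and "b = cut_rank m n \<beta>"
  have a: "1 \<le> a" "a \<le> N" and b: "1 \<le> b" "b \<le> N"
    using rank[of \<alpha>] rank[of \<beta>] ab by (auto simp: a_def b_def)
  define u where "u = order_stat X m h n \<omega>"
  have sorted: "sorted (kernel_values X m h n \<omega>)" by (simp add: kernel_values_def)
  have mono: "u k \<le> u l" if "1 \<le> k" "k \<le> l" "l \<le> N" for k l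
    using that sorted unfolding u_def order_stat_def
    by (intro sorted_nth_mono) (auto simp: length_kernel_values N_def)
  have mem: "u k \<in> {u a..<u b} \<longleftrightarrow> k \<in> {a..<b}" if k: "k \<in> {1..N}" for k
  proof -
    have "u a \<le> u k \<longleftrightarrow> a \<le> k"
      using mono[of a k] no_tie[of \<alpha> k] k a by (fastforce simp: u_def a_def not_le)
    moreover have "u k < u b \<longleftrightarrow> k < b"
      using mono[of b k] no_tie[of \<beta> k] k b by (fastforce simp: u_def b_def not_le)
    ultimately show ?thesis by simp
  qed
  let ?f = "\<lambda>x. indicator {u a..<u b} x * x :: real"
  have "(LINT x:{u a..<u b}|interval_measure (empirical_df X m h n \<omega>). x)
      = (\<Sum>k<N. ?f (kernel_values X m h n \<omega> ! k)) / N"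
    unfolding set_lebesgue_integral_def N_def using integral_empirical_df[OF mn, of ?f] by simp
  also have "(\<Sum>k<N. ?f (kernel_values X m h n \<omega> ! k)) = (\<Sum>k\<in>{1..N}. ?f (u k))"
    by (rule sum.reindex_bij_witness[of _ "\<lambda>k. k - 1" Suc]) (auto simp: u_def order_stat_def)
  also have "\<dots> = (\<Sum>k\<in>{a..<b}. u k)"
    using a b by (intro sum.mono_neutral_cong_right) (use mem in \<open>auto simp: indicator_def\<close>)
  finally show ?thesis
    by (simp add: trimmed_stat_def u_def a_def b_def N_def)
qed

end

theory Submission
  imports Defs "HOL-Real_Asymp.Real_Asymp"
begin

text \<open>
  Let \<open>v\<^sub>0 \<le> \<dots> \<le> v\<^bsub>N-1\<^esub>\<close> be the ordered kernel values, and let \<open>c\<close> lie between the two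
  \<open>\<gamma>\<close>-quantiles \<open>\<xi>\<^sup>-\<close> and \<open>\<xi>\<^sup>+\<close> of the kernel distribution. The sum of the \<open>r\<close> smallest values, where
  \<open>r\<close> is about \<open>\<gamma> N\<close>, is \<open>r c + \<Sum> min (v\<^sub>k - c) 0\<close> plus a nonnegative excess, which measures how far
  the rank cut is from the cut at level \<open>c\<close> (\<open>sum_below_rank\<close>). As the trimmed statistic
  is a difference of two such sums, divided by \<open>N\<close>, it is up to the excesses and \<open>O(1/N)\<close> a U-statistic: its
  kernel is the bounded function \<open>trim_fun\<close> of \<open>h\<close>.

  The excess collects the values that lie between the two cuts. Relative to \<open>N\<close>, their number is at most
  about \<open>(\<gamma> - H\<^sub>n(c))\<^sup>+\<close> or \<open>(H\<^sub>n(c-) - \<gamma>)\<^sup>+\<close>, where \<open>H\<^sub>n\<close> is the empirical distribution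
  function; both are of order \<open>1 / \<surd>n\<close>. With probability tending to one these values lie close
  to \<open>\<xi>\<^sup>-\<close> or to \<open>\<xi>\<^sup>+\<close>, because the gap between the quantiles has probability zero and the empirical
  quantile cannot leave a neighbourhood of the gap. Hence each of them contributes the distance from \<open>c\<close> to the respective end of the gap, up to
  an arbitrarily small error (\<open>trim_excess_approx\<close>, \<open>trim_excess_limit\<close>). With \<open>c = \<xi>\<^sup>+\<close> for \<open>\<alpha>\<close> and
  \<open>c = \<xi>\<^sup>-\<close> for \<open>\<beta>\<close> only one side counts, and this is the origin of the one-sided terms
  \<open>\<Delta>\<xi>\<^sub>\<alpha> I(\<tau>\<^sub>\<alpha> > 0) \<tau>\<^sub>\<alpha>\<close> and \<open>\<Delta>\<xi>\<^sub>\<beta> I(\<tau>\<^sub>\<beta> < 0) \<tau>\<^sub>\<beta>\<close>.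

  Thus the normalised statistic is, up to a term that vanishes in probability, a fixed continuous
  function of three U-statistics with bounded kernels. Each of them is replaced by its
  projection, a sum of independent terms: after subtraction of the projections, the summands belonging to
  two index tuples are uncorrelated unless the tuples share at least two indices, and such pairs are
  rare (\<open>residuals_uncorrelated\<close>, \<open>hajek_projection\<close>). It remains to apply the
  multivariate central limit theorem and the continuous mapping theorem. Both come from the
  univariate central limit theorem by the Cramer-Wold device, which is proved with
  trigonometric polynomials (\<open>cramer_wold\<close>, \<open>iid_vector_clt\<close>).
\<close>

section \<open>Convergence to zero in probability\<close>

definition vanishes_in_prob :: "'w measure \<Rightarrow> (nat \<Rightarrow> 'w \<Rightarrow> real) \<Rightarrow> bool" where
  "vanishes_in_prob M R \<longleftrightarrow>
     (\<forall>\<epsilon>>0. (\<lambda>n. measure M {w\<in>space M. \<epsilon> < \<bar>R n w\<bar>}) \<longlonglongrightarrow> 0)"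

lemma power2_diff_le: "(x - y)\<^sup>2 \<le> 2 * x\<^sup>2 + 2 * (y :: real)\<^sup>2"
  using zero_le_power2[of "x + y"] by (simp add: power2_sum power2_diff)

lemma (in prob_space) chebyshev_bound:
  assumes [measurable]: "R \<in> borel_measurable M" and int: "integrable M (\<lambda>w. (R w)\<^sup>2)" and e: "\<epsilon> > 0"
  shows "prob {w\<in>space M. \<epsilon> < \<bar>R w :: real\<bar>} \<le> expectation (\<lambda>w. (R w)\<^sup>2) / \<epsilon>\<^sup>2"
proof -
  have "prob {w\<in>space M. \<epsilon> < \<bar>R w\<bar>} \<le> prob {w\<in>space M. \<epsilon>\<^sup>2 \<le> (R w)\<^sup>2}"
  proof (rule finite_measure_mono)
    show "{w\<in>space M. \<epsilon> < \<bar>R w\<bar>} \<subseteq> {w\<in>space M. \<epsilon>\<^sup>2 \<le> (R w)\<^sup>2}"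
      using e by (auto simp: abs_le_square_iff[symmetric])
  qed measurable
  also have "\<dots> \<le> expectation (\<lambda>w. (R w)\<^sup>2) / \<epsilon>\<^sup>2"
    using e by (intro integral_Markov_inequality_measure[OF int, of "space M"]) auto
  finally show ?thesis .
qed

lemma (in prob_space) vanishes_in_prob_of_second_moment:
  assumes [measurable]: "\<And>n. R n \<in> borel_measurable M"
    and int: "\<And>n. integrable M (\<lambda>w. (R n w)\<^sup>2)"
    and lim: "(\<lambda>n. expectation (\<lambda>w. (R n w)\<^sup>2)) \<longlonglongrightarrow> 0"
  shows "vanishes_in_prob M R"
  unfolding vanishes_in_prob_def
proof (intro allI impI)
  fix \<epsilon> :: real assume e: "\<epsilon> > 0"
  show "(\<lambda>n. prob {w\<in>space M. \<epsilon> < \<bar>R n w\<bar>}) \<longlonglongrightarrow> 0"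
  proof (rule tendsto_sandwich[OF _ _ tendsto_const])
    show "(\<lambda>n. expectation (\<lambda>w. (R n w)\<^sup>2) / \<epsilon>\<^sup>2) \<longlonglongrightarrow> 0"
      using tendsto_divide[OF lim tendsto_const[of "\<epsilon>\<^sup>2"]] e by simp
    show "eventually (\<lambda>n. prob {w\<in>space M. \<epsilon> < \<bar>R n w\<bar>} \<le> expectation (\<lambda>w. (R n w)\<^sup>2) / \<epsilon>\<^sup>2) sequentially"
      using chebyshev_bound[OF _ int e] by simp
  qed simp
qed

lemma (in prob_space) vanishes_in_prob_add:
  assumes [measurable]: "\<And>n. R n \<in> borel_measurable M" "\<And>n. R' n \<in> borel_measurable M"
    and van: "vanishes_in_prob M R" "vanishes_in_prob M R'"
  shows "vanishes_in_prob M (\<lambda>n w. R n w + R' n w)"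
  unfolding vanishes_in_prob_def
proof (intro allI impI)
  fix \<epsilon> :: real assume e: "\<epsilon> > 0"
  let ?A = "\<lambda>R n. {w\<in>space M. \<epsilon> / 2 < \<bar>R n w\<bar>}"
  show "(\<lambda>n. prob {w\<in>space M. \<epsilon> < \<bar>R n w + R' n w\<bar>}) \<longlonglongrightarrow> 0"
  proof (rule tendsto_sandwich[OF _ _ tendsto_const])
    have "(\<lambda>n. prob (?A R n) + prob (?A R' n)) \<longlonglongrightarrow> 0 + 0"
      using van e unfolding vanishes_in_prob_def by (intro tendsto_add) (meson half_gt_zero)+
    thus "(\<lambda>n. prob (?A R n) + prob (?A R' n)) \<longlonglongrightarrow> 0" by simp
    show "\<forall>\<^sub>F n in sequentially. prob {w\<in>space M. \<epsilon> < \<bar>R n w + R' n w\<bar>} \<le> prob (?A R n) + prob (?A R' n)"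
    proof (rule always_eventually, rule allI)
      fix n
      have "prob {w\<in>space M. \<epsilon> < \<bar>R n w + R' n w\<bar>} \<le> prob (?A R n \<union> ?A R' n)"
      proof (rule finite_measure_mono)
        show "{w\<in>space M. \<epsilon> < \<bar>R n w + R' n w\<bar>} \<subseteq> ?A R n \<union> ?A R' n"
          by (auto simp: abs_real_def split: if_splits)
      qed measurable
      also have "\<dots> \<le> prob (?A R n) + prob (?A R' n)"
        by (rule measure_Un_le) measurable
      finally show "prob {w\<in>space M. \<epsilon> < \<bar>R n w + R' n w\<bar>} \<le> prob (?A R n) + prob (?A R' n)" .
    qed
  qed simp
qed

lemma (in prob_space) vanishes_in_prob_mono:
  assumes [measurable]: "\<And>n. R n \<in> borel_measurable M"
    and van: "vanishes_in_prob M R"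
    and le: "\<forall>\<^sub>F n in sequentially. \<forall>w\<in>space M. \<bar>R' n w\<bar> \<le> \<bar>R n w\<bar>"
  shows "vanishes_in_prob M R'"
  unfolding vanishes_in_prob_def
proof (intro allI impI)
  fix \<epsilon> :: real assume e: "\<epsilon> > 0"
  show "(\<lambda>n. prob {w\<in>space M. \<epsilon> < \<bar>R' n w\<bar>}) \<longlonglongrightarrow> 0"
  proof (rule tendsto_sandwich[OF _ _ tendsto_const])
    show "(\<lambda>n. prob {w\<in>space M. \<epsilon> < \<bar>R n w\<bar>}) \<longlonglongrightarrow> 0"
      using van e unfolding vanishes_in_prob_def by blast
    show "\<forall>\<^sub>F n in sequentially. prob {w\<in>space M. \<epsilon> < \<bar>R' n w\<bar>} \<le> prob {w\<in>space M. \<epsilon> < \<bar>R n w\<bar>}"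
      using le
    proof eventually_elim
      case (elim n)
      show ?case
      proof (rule finite_measure_mono)
        show "{w\<in>space M. \<epsilon> < \<bar>R' n w\<bar>} \<subseteq> {w\<in>space M. \<epsilon> < \<bar>R n w\<bar>}"
          using elim by (auto intro: less_le_trans)
      qed measurable
    qed
  qed simp
qed

lemma vanishes_in_prob_scale:
  assumes van: "vanishes_in_prob M R"
  shows "vanishes_in_prob M (\<lambda>n w. c * R n w)"
proof (cases "c = 0")
  case False
  have eq: "\<epsilon> < \<bar>c * r\<bar> \<longleftrightarrow> \<epsilon> / \<bar>c\<bar> < \<bar>r\<bar>" for \<epsilon> r
    using False by (simp add: abs_mult pos_divide_less_eq mult.commute)
  show ?thesis using van False unfolding vanishes_in_prob_def eq by simp
qed (auto simp: vanishes_in_prob_def)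

lemma vanishes_in_prob_abs: "vanishes_in_prob M R \<Longrightarrow> vanishes_in_prob M (\<lambda>n w. \<bar>R n w\<bar>)"
  by (simp add: vanishes_in_prob_def)

lemma vanishes_in_prob_deterministic:
  assumes "x \<longlonglongrightarrow> 0"
  shows "vanishes_in_prob M (\<lambda>n w. x n)"
  unfolding vanishes_in_prob_def
proof (intro allI impI)
  fix \<epsilon> :: real assume "\<epsilon> > 0"
  hence "\<forall>\<^sub>F n in sequentially. \<bar>x n\<bar> < \<epsilon>" using tendstoD[OF assms] by (simp add: dist_real_def)
  hence "\<forall>\<^sub>F n in sequentially. measure M {w\<in>space M. \<epsilon> < \<bar>x n\<bar>} = 0"
    by eventually_elim simp
  thus "(\<lambda>n. measure M {w\<in>space M. \<epsilon> < \<bar>x n\<bar>}) \<longlonglongrightarrow> 0" by (rule tendsto_eventually)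
qed

text \<open>
  A remainder is negligible if, off an event of vanishing probability, it is at most an
  arbitrarily small multiple of a quantity with bounded second moments. The bad event may depend
  on the multiple.
\<close>

lemma (in prob_space) vanishes_in_prob_dominated:
  fixes R W :: "nat \<Rightarrow> 'a \<Rightarrow> real" and bad :: "real \<Rightarrow> nat \<Rightarrow> 'a set"
  assumes R[measurable]: "\<And>n. R n \<in> borel_measurable M" and W[measurable]: "\<And>n. W n \<in> borel_measurable M"
    and Wint: "\<And>n. integrable M (\<lambda>w. (W n w)\<^sup>2)"
    and WC: "\<forall>\<^sub>F n in sequentially. expectation (\<lambda>w. (W n w)\<^sup>2) \<le> C"
    and bad: "\<And>\<epsilon> n. \<epsilon> > 0 \<Longrightarrow> bad \<epsilon> n \<in> events" "\<And>\<epsilon>. \<epsilon> > 0 \<Longrightarrow> (\<lambda>n. prob (bad \<epsilon> n)) \<longlonglongrightarrow> 0"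
    and d: "\<And>\<epsilon>. \<epsilon> > 0 \<Longrightarrow> d \<epsilon> \<longlonglongrightarrow> 0"
    and dom: "\<And>\<epsilon>. \<epsilon> > 0 \<Longrightarrow> \<forall>\<^sub>F n in sequentially.
       \<forall>w\<in>space M - bad \<epsilon> n. \<bar>R n w\<bar> \<le> \<epsilon> * \<bar>W n w\<bar> + d \<epsilon> n"
  shows "vanishes_in_prob M R"
  unfolding vanishes_in_prob_def
proof (intro allI impI)
  fix \<eta> :: real assume \<eta>: "\<eta> > 0"
  show "(\<lambda>n. prob {w\<in>space M. \<eta> < \<bar>R n w\<bar>}) \<longlonglongrightarrow> 0"
  proof (rule LIMSEQ_I)
    fix e :: real assume e: "0 < e"
    define C' where "C' = max C 1"
    \<comment> \<open>chosen so that Chebyshev's inequality bounds the tail of \<open>\<epsilon> * W n\<close> at \<open>\<eta> / 2\<close> by \<open>e / 4\<close>\<close>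
    define \<epsilon> where "\<epsilon> = \<eta> / 4 * sqrt (e / C')"
    have C': "C' > 0" "C \<le> C'" by (simp_all add: C'_def)
    have \<epsilon>: "\<epsilon> > 0" using \<eta> e C' by (simp add: \<epsilon>_def)
    have \<epsilon>2: "C' / (\<eta> / (2 * \<epsilon>))\<^sup>2 = e / 4"
    proof -
      have "\<epsilon>\<^sup>2 = \<eta>\<^sup>2 / 16 * (e / C')"
        using e C' by (simp add: \<epsilon>_def power_mult_distrib power_divide)
      hence "C' * (4 * \<epsilon>\<^sup>2) / \<eta>\<^sup>2 = e / 4" using \<eta> C' by (simp add: field_simps)
      thus ?thesis by (simp add: power_divide power_mult_distrib)
    qed
    have "\<forall>\<^sub>F n in sequentially. d \<epsilon> n < \<eta> / 2" "\<forall>\<^sub>F n in sequentially. prob (bad \<epsilon> n) < e / 2"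
      using order_tendstoD(2)[OF d[OF \<epsilon>], of "\<eta> / 2"] order_tendstoD(2)[OF bad(2)[OF \<epsilon>], of "e / 2"] \<eta> e by auto
    with WC dom[OF \<epsilon>] have "\<forall>\<^sub>F n in sequentially. norm (prob {w\<in>space M. \<eta> < \<bar>R n w\<bar>} - 0) < e"
    proof eventually_elim
      case (elim n)
      let ?B = "{w\<in>space M. \<eta> / (2 * \<epsilon>) < \<bar>W n w\<bar>}"
      have "prob {w\<in>space M. \<eta> < \<bar>R n w\<bar>} \<le> prob (bad \<epsilon> n \<union> ?B)"
      proof (rule finite_measure_mono)
        show "{w\<in>space M. \<eta> < \<bar>R n w\<bar>} \<subseteq> bad \<epsilon> n \<union> ?B"
        proof (intro subsetI UnCI)
          fix w assume w: "w \<in> {w\<in>space M. \<eta> < \<bar>R n w\<bar>}" "w \<notin> ?B"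
          show "w \<in> bad \<epsilon> n"
          proof (rule ccontr)
            assume "w \<notin> bad \<epsilon> n"
            hence "\<bar>R n w\<bar> \<le> \<epsilon> * \<bar>W n w\<bar> + d \<epsilon> n" using elim(2) w(1) by blast
            moreover have "\<bar>W n w\<bar> \<le> \<eta> / (2 * \<epsilon>)" using w by auto
            hence "\<epsilon> * \<bar>W n w\<bar> \<le> \<epsilon> * (\<eta> / (2 * \<epsilon>))" using \<epsilon> by (intro mult_left_mono) auto
            hence "\<epsilon> * \<bar>W n w\<bar> \<le> \<eta> / 2" using \<epsilon> by simp
            ultimately show False using w(1) elim(3) by auto
          qed
        qed
        show "bad \<epsilon> n \<union> ?B \<in> events" using bad(1)[OF \<epsilon>, of n] by measurable
      qed
      also have "\<dots> \<le> prob (bad \<epsilon> n) + prob ?B"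
        by (rule measure_Un_le) (use bad(1)[OF \<epsilon>, of n] in measurable)
      also have "prob ?B \<le> expectation (\<lambda>w. (W n w)\<^sup>2) / (\<eta> / (2 * \<epsilon>))\<^sup>2"
        by (rule chebyshev_bound[OF W Wint]) (use \<eta> \<epsilon> in simp)
      also have "\<dots> \<le> C' / (\<eta> / (2 * \<epsilon>))\<^sup>2" using elim(1) C' by (intro divide_right_mono) auto
      also have "\<dots> = e / 4" by (rule \<epsilon>2)
      finally show ?case using elim(4) e by simp
    qed
    thus "\<exists>no. \<forall>n\<ge>no. norm (prob {w\<in>space M. \<eta> < \<bar>R n w\<bar>} - 0) < e"
      by (simp add: eventually_sequentially)
  qed
qed

lemma (in prob_space) expectation_diff_vanishes:
  fixes f :: "real \<Rightarrow> real"
  assumes [measurable]: "\<And>n. Y n \<in> borel_measurable M" "\<And>n. Z n \<in> borel_measurable M"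
    and van: "vanishes_in_prob M (\<lambda>n w. Z n w - Y n w)"
    and uc: "uniformly_continuous_on UNIV f" and bd: "\<And>x. \<bar>f x\<bar> \<le> B"
  shows "(\<lambda>n. expectation (\<lambda>w. f (Z n w)) - expectation (\<lambda>w. f (Y n w))) \<longlonglongrightarrow> 0"
proof (rule LIMSEQ_I)
  fix e :: real assume "0 < e"
  obtain d where d: "d > 0" "\<And>x y. \<bar>x - y\<bar> < d \<Longrightarrow> \<bar>f x - f y\<bar> < e / 2"
    using uc \<open>0 < e\<close> unfolding uniformly_continuous_on_def dist_real_def
    by (metis UNIV_I half_gt_zero)
  have [measurable]: "f \<in> borel_measurable borel"
    by (intro borel_measurable_continuous_onI uniformly_continuous_imp_continuous uc)
  have B: "B \<ge> 0" using bd[of 0] by linarith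
  let ?A = "\<lambda>n. {w\<in>space M. d/2 < \<bar>Z n w - Y n w\<bar>}"
  have int: "integrable M (\<lambda>w. f (W w))" if [measurable]: "W \<in> borel_measurable M" for W
    by (rule integrable_const_bound[of _ B]) (use bd in auto)
  have bound: "\<bar>expectation (\<lambda>w. f (Z n w)) - expectation (\<lambda>w. f (Y n w))\<bar> \<le> e/2 + 2 * B * prob (?A n)"
    for n
  proof -
    have "\<bar>expectation (\<lambda>w. f (Z n w)) - expectation (\<lambda>w. f (Y n w))\<bar>
        = \<bar>expectation (\<lambda>w. f (Z n w) - f (Y n w))\<bar>"
      by (simp add: int)
    also have "\<dots> \<le> expectation (\<lambda>w. \<bar>f (Z n w) - f (Y n w)\<bar>)"
      by (rule integral_abs_bound)
    also have "\<dots> \<le> expectation (\<lambda>w. e/2 + 2 * B * indicator (?A n) w)"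
    proof (rule integral_mono)
      fix w assume w: "w \<in> space M"
      show "\<bar>f (Z n w) - f (Y n w)\<bar> \<le> e/2 + 2 * B * indicator (?A n) w"
      proof (cases "w \<in> ?A n")
        case True thus ?thesis using bd[of "Z n w"] bd[of "Y n w"] \<open>0 < e\<close> by simp
      next
        case False
        hence "\<bar>Z n w - Y n w\<bar> < d" using w d(1) by simp
        from d(2)[OF this] False show ?thesis by simp
      qed
    qed (auto intro!: integrable_abs Bochner_Integration.integrable_diff Bochner_Integration.integrable_add
           integrable_mult_right int integrable_real_indicator simp: emeasure_eq_measure)
    also have "\<dots> = e/2 + 2 * B * prob (?A n)"
      by (subst Bochner_Integration.integral_add) (auto simp: prob_space emeasure_eq_measure)
    finally show ?thesis .
  qed
  have "(\<lambda>n. prob (?A n)) \<longlonglongrightarrow> 0"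
    using van d(1) unfolding vanishes_in_prob_def by (meson half_gt_zero)
  hence "(\<lambda>n. e/2 + 2 * B * prob (?A n)) \<longlonglongrightarrow> e/2 + 2 * B * 0"
    by (intro tendsto_intros)
  hence "eventually (\<lambda>n. e/2 + 2 * B * prob (?A n) < e) sequentially"
    by (rule order_tendstoD) (use \<open>0 < e\<close> in simp)
  hence "eventually (\<lambda>n. norm (expectation (\<lambda>w. f (Z n w)) - expectation (\<lambda>w. f (Y n w)) - 0) < e) sequentially"
  proof eventually_elim
    case (elim n)
    thus ?case using bound[of n] by simp
  qed
  thus "\<exists>no. \<forall>n\<ge>no. norm (expectation (\<lambda>w. f (Z n w)) - expectation (\<lambda>w. f (Y n w)) - 0) < e"
    by (simp add: eventually_sequentially)
qed

text \<open>
  This is Slutsky's lemma. Weak convergence need only be tested on piecewise linear steps; these are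
  uniformly continuous, so that closeness in probability carries over to expectations.
\<close>

lemma (in prob_space) weak_conv_m_if_close_to_convergent:
  assumes [measurable]: "\<And>n. Y n \<in> borel_measurable M" "\<And>n. Z n \<in> borel_measurable M"
    and van: "vanishes_in_prob M (\<lambda>n w. Z n w - Y n w)"
    and "prob_space P" and [measurable]: "W \<in> borel_measurable P"
    and conv: "\<And>f B. continuous_on UNIV f \<Longrightarrow> (\<And>x. \<bar>f x\<bar> \<le> B) \<Longrightarrow>
       (\<lambda>n. expectation (\<lambda>w. f (Y n w))) \<longlonglongrightarrow> (LINT w|P. f (W w) :: real)"
  shows "weak_conv_m (\<lambda>n. distr M borel (Z n)) (distr P borel W)"
proof -
  interpret P: prob_space P by fact
  have rd: "real_distribution (distr M borel (Z n))" for n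
    by (intro real_distribution_distr) auto
  have rP: "real_distribution (distr P borel W)"
    by (intro P.real_distribution_distr) auto
  show ?thesis
  proof (rule integral_cts_step_conv_imp_weak_conv[OF rd rP])
    fix x y :: real assume xy: "x < y"
    note uc = cts_step_uniformly_continuous[OF xy]
    have bd: "\<bar>cts_step x y z\<bar> \<le> 1" for z
      using xy by (auto simp: cts_step_def divide_simps)
    have ct: "continuous_on UNIV (cts_step x y)"
      by (rule uniformly_continuous_imp_continuous[OF uc])
    hence [measurable]: "cts_step x y \<in> borel_measurable borel"
      by (rule borel_measurable_continuous_onI)
    have "(\<lambda>n. (expectation (\<lambda>w. cts_step x y (Z n w)) - expectation (\<lambda>w. cts_step x y (Y n w)))
        + expectation (\<lambda>w. cts_step x y (Y n w))) \<longlonglongrightarrow> 0 + (LINT w|P. cts_step x y (W w))"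
      by (intro tendsto_add expectation_diff_vanishes[OF _ _ van uc bd] conv[OF ct bd]) auto
    thus "(\<lambda>n. integral\<^sup>L (distr M borel (Z n)) (cts_step x y))
      \<longlonglongrightarrow> integral\<^sup>L (distr P borel W) (cts_step x y)"
      by (simp add: integral_distr)
  qed
qed

section \<open>The Cramer-Wold device\<close>

text \<open>
  The phase \<open>b\<close> in the generators makes sines and constants trigonometric polynomials as well.
\<close>

inductive trig_poly :: "('a::euclidean_space \<Rightarrow> real) \<Rightarrow> bool" where
  wave: "trig_poly (\<lambda>x. cos (a \<bullet> x + b))"
| scale: "trig_poly f \<Longrightarrow> trig_poly (\<lambda>x. c * f x)"
| add: "trig_poly f \<Longrightarrow> trig_poly g \<Longrightarrow> trig_poly (\<lambda>x. f x + g x)"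

lemma trig_poly_const: "trig_poly (\<lambda>x. c)"
  using trig_poly.scale[OF trig_poly.wave[of 0 0], of c] by simp

lemma trig_poly_mult_wave:
  "trig_poly f \<Longrightarrow> trig_poly (\<lambda>x. f x * cos (a \<bullet> x + b))"
proof (induction rule: trig_poly.induct)
  case (wave a' b')
  have prod: "cos u * cos v = 1/2 * cos (u - v) + 1/2 * cos (u + v)" for u v :: real
    by (simp add: cos_times_cos)
  have eq: "cos (a' \<bullet> x + b') * cos (a \<bullet> x + b) =
     1/2 * cos ((a' - a) \<bullet> x + (b' - b)) + 1/2 * cos ((a' + a) \<bullet> x + (b' + b))" for x
  proof -
    have "(a' - a) \<bullet> x + (b' - b) = (a' \<bullet> x + b') - (a \<bullet> x + b)"
      "(a' + a) \<bullet> x + (b' + b) = (a' \<bullet> x + b') + (a \<bullet> x + b)"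
      by (simp_all add: inner_diff_left inner_add_left)
    thus ?thesis by (simp only: prod)
  qed
  show ?case unfolding eq by (intro trig_poly.intros)
next
  case (scale f c)
  thus ?case using trig_poly.scale[OF scale.IH, of c] by (simp add: mult.assoc)
next
  case (add f g)
  thus ?case using trig_poly.add[OF add.IH] by (simp add: algebra_simps)
qed

lemma trig_poly_mult:
  assumes "trig_poly f" "trig_poly g"
  shows "trig_poly (\<lambda>x. f x * g x)"
  using assms(2,1)
proof (induction rule: trig_poly.induct)
  case (wave a b)
  thus ?case by (rule trig_poly_mult_wave)
next
  case (scale g c)
  thus ?case using trig_poly.scale[OF scale.IH[OF scale.prems], of c] by (simp add: mult.left_commute)
next
  case (add g g')
  thus ?case using trig_poly.add[OF add.IH(1,2)] by (simp add: algebra_simps)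
qed

lemma trig_poly_continuous: "trig_poly f \<Longrightarrow> continuous_on S f"
  by (induction rule: trig_poly.induct) (auto intro!: continuous_intros)

lemma trig_poly_bounded: "trig_poly f \<Longrightarrow> \<exists>B. \<forall>x. \<bar>f x\<bar> \<le> B"
proof (induction rule: trig_poly.induct)
  case (wave a b) thus ?case by (intro exI[of _ 1]) simp
next
  case (scale f c)
  then obtain B where "\<forall>x. \<bar>f x\<bar> \<le> B" by blast
  thus ?case by (intro exI[of _ "\<bar>c\<bar> * B"]) (simp add: abs_mult mult_left_mono)
next
  case (add f g)
  then obtain A B where "\<forall>x. \<bar>f x\<bar> \<le> A" "\<forall>x. \<bar>g x\<bar> \<le> B" by blast
  thus ?case by (intro exI[of _ "A + B"]) (meson abs_triangle_ineq add_mono order_trans)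
qed

lemma trig_poly_separates:
  fixes x y :: "'a::euclidean_space"
  assumes "x \<noteq> y"
  shows "\<exists>f. trig_poly f \<and> f x \<noteq> f y"
proof -
  \<comment> \<open>the wave has opposite phases at \<open>x\<close> and \<open>y\<close>\<close>
  define a where "a = (pi / ((x - y) \<bullet> (x - y))) *\<^sub>R (x - y)"
  have "a \<bullet> x + - (a \<bullet> y) = pi"
    using assms inner_diff_right[of a x y, symmetric] by (simp add: a_def)
  hence "cos (a \<bullet> x + - (a \<bullet> y)) \<noteq> cos (a \<bullet> y + - (a \<bullet> y))" by simp
  thus ?thesis using trig_poly.wave[of a "- (a \<bullet> y)"] by blast
qed

lemma trig_poly_polynomial_compose:
  fixes q :: "real \<Rightarrow> real"
  assumes "real_polynomial_function q" "trig_poly p"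
  shows "trig_poly (\<lambda>x. q (p x))"
  using assms
proof (induction rule: real_polynomial_function.induct)
  case (linear f)
  then obtain c where "f = (\<lambda>x. x * c)" using real_bounded_linear by auto
  thus ?case using trig_poly.scale[OF linear.prems, of c] by (simp add: mult.commute)
next
  case (const c)
  show ?case by (rule trig_poly_const)
next
  case (add f g)
  thus ?case by (intro trig_poly.add) auto
next
  case (mult f g)
  thus ?case by (intro trig_poly_mult) auto
qed

text \<open>
  The Stone-Weierstrass theorem gives a trigonometric polynomial that is close to \<open>f\<close> on \<open>K\<close>, but may be large
  elsewhere. Composing it with an ordinary polynomial that approximates the truncation at \<open>\<plusminus> B\<close> bounds
  it everywhere and keeps it a trigonometric polynomial.
\<close>

lemma trig_poly_approx:
  fixes f :: "'a::euclidean_space \<Rightarrow> real"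
  assumes K: "compact K" and f: "continuous_on K f" and B: "\<And>x. \<bar>f x\<bar> \<le> B" and e: "0 < e"
  obtains p where "trig_poly p" "\<And>x. x \<in> K \<Longrightarrow> \<bar>f x - p x\<bar> < e" "\<And>x. \<bar>p x\<bar> < B + e"
proof -
  obtain p where p: "trig_poly p" "\<And>x. x \<in> K \<Longrightarrow> \<bar>f x - p x\<bar> < e/2"
    using Stone_Weierstrass_HOL[of K trig_poly f "e/2"] K f e
    by (auto intro: trig_poly_const trig_poly_continuous trig_poly.add trig_poly_mult trig_poly_separates)
  obtain C where C: "\<And>x. \<bar>p x\<bar> \<le> C" using trig_poly_bounded[OF p(1)] by blast
  define cl where "cl y = max (- B) (min B y)" for y :: real
  have "continuous_on {-C..C} cl" unfolding cl_def by (intro continuous_intros)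
  then obtain q where q: "real_polynomial_function q" "\<And>y. y \<in> {-C..C} \<Longrightarrow> \<bar>cl y - q y\<bar> < e/2"
    using Stone_Weierstrass_real_polynomial_function[of "{-C..C}" cl "e/2"] e by auto
  have B0: "B \<ge> 0" using B[of 0] by linarith
  have pC: "p x \<in> {-C..C}" for x using C[of x] by auto
  show ?thesis
  proof
    show "trig_poly (\<lambda>x. q (p x))" by (rule trig_poly_polynomial_compose[OF q(1) p(1)])
    show "\<bar>q (p x)\<bar> < B + e" for x
    proof -
      have "\<bar>cl (p x)\<bar> \<le> B" using B0 by (auto simp: cl_def)
      thus ?thesis using q(2)[OF pC, of x] e by linarith
    qed
    fix x assume "x \<in> K"
    from p(2)[OF this] B[of x] have "\<bar>f x - cl (p x)\<bar> < e/2" unfolding cl_def by arith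
    thus "\<bar>f x - q (p x)\<bar> < e" using q(2)[OF pC, of x] by linarith
  qed
qed

lemma tail_cutoff_expectation:
  fixes Y :: "'b \<Rightarrow> real"
  assumes "prob_space P" and [measurable]: "Y \<in> borel_measurable P"
  shows "((\<lambda>R. LINT w|P. min 1 (max 0 (\<bar>Y w\<bar> - real R))) \<longlongrightarrow> 0) sequentially"
proof -
  interpret prob_space P by fact
  have "(\<lambda>R. LINT w|P. min 1 (max 0 (\<bar>Y w\<bar> - real R))) \<longlonglongrightarrow> (LINT w|P. 0)"
  proof (rule integral_dominated_convergence[where w="\<lambda>_. 1"])
    show "AE w in P. (\<lambda>R. min 1 (max 0 (\<bar>Y w\<bar> - real R))) \<longlonglongrightarrow> 0"
    proof (rule AE_I2)
      fix w
      obtain N :: nat where "\<bar>Y w\<bar> \<le> real N" using real_arch_simple by blast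
      thus "(\<lambda>R. min 1 (max 0 (\<bar>Y w\<bar> - real R))) \<longlonglongrightarrow> 0"
        by (intro tendsto_eventually eventually_sequentiallyI[of N]) auto
    qed
  qed auto
  thus ?thesis by simp
qed

text \<open>
  The expectation of a trigonometric polynomial is a linear combination of expectations
  that involve one linear functional each, so it converges. A bounded continuous function is uniformly close to a
  bounded trigonometric polynomial on a large ball; outside the ball only the tail probabilities
  matter, and they are controlled by the coordinates.
\<close>

lemma (in prob_space) cramer_wold:
  fixes V :: "nat \<Rightarrow> 'a \<Rightarrow> 'v::euclidean_space" and T :: "'b \<Rightarrow> 'v"
  assumes V[measurable]: "\<And>n. V n \<in> borel_measurable M"
    and P: "prob_space P" and T[measurable]: "T \<in> borel_measurable P"
    and marg: "\<And>a. weak_conv_m (\<lambda>n. distr M borel (\<lambda>w. a \<bullet> V n w)) (distr P borel (\<lambda>w. a \<bullet> T w))"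
    and f: "continuous_on UNIV f" and B: "\<And>x. \<bar>f x\<bar> \<le> B"
  shows "(\<lambda>n. expectation (\<lambda>w. f (V n w))) \<longlonglongrightarrow> (LINT w|P. f (T w) :: real)"
proof -
  interpret P: prob_space P by fact
  have marg_conv: "(\<lambda>n. expectation (\<lambda>w. \<phi> (a \<bullet> V n w))) \<longlonglongrightarrow> (LINT w|P. \<phi> (a \<bullet> T w))"
    if ct: "continuous_on UNIV \<phi>" and bd: "\<And>x. \<bar>\<phi> x\<bar> \<le> C" for \<phi> :: "real \<Rightarrow> real" and C a
  proof -
    have [measurable]: "\<phi> \<in> borel_measurable borel" by (intro borel_measurable_continuous_onI ct)
    have "(\<lambda>n. integral\<^sup>L (distr M borel (\<lambda>w. a \<bullet> V n w)) \<phi>) \<longlonglongrightarrow> integral\<^sup>L (distr P borel (\<lambda>w. a \<bullet> T w)) \<phi>"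
    proof (rule weak_conv_imp_integral_bdd_continuous_conv[OF _ _ marg, where B=C])
      show "real_distribution (distr M borel (\<lambda>w. a \<bullet> V n w))" for n
        by (intro real_distribution_distr) auto
      show "real_distribution (distr P borel (\<lambda>w. a \<bullet> T w))"
        by (intro P.real_distribution_distr) auto
      show "isCont \<phi> x" for x using ct by (simp add: continuous_on_eq_continuous_at)
      show "norm (\<phi> x) \<le> C" for x using bd by simp
    qed
    thus ?thesis by (simp add: integral_distr)
  qed
  have trig_conv: "(\<lambda>n. expectation (\<lambda>w. p (V n w))) \<longlonglongrightarrow> (LINT w|P. p (T w))
     \<and> (\<forall>n. integrable M (\<lambda>w. p (V n w))) \<and> integrable P (\<lambda>w. p (T w))"
    if "trig_poly p" for p :: "'v \<Rightarrow> real"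
    using that
  proof (induction rule: trig_poly.induct)
    case (wave a b)
    have "integrable M (\<lambda>w. cos (a \<bullet> V n w + b))" for n
      by (rule integrable_const_bound[of _ 1]) auto
    moreover have "integrable P (\<lambda>w. cos (a \<bullet> T w + b))"
      by (rule P.integrable_const_bound[of _ 1]) auto
    moreover have "(\<lambda>n. expectation (\<lambda>w. cos (a \<bullet> V n w + b))) \<longlonglongrightarrow> (LINT w|P. cos (a \<bullet> T w + b))"
      by (rule marg_conv[of "\<lambda>x. cos (x + b)" 1]) (auto intro!: continuous_intros)
    ultimately show ?case by blast
  next
    case (scale p c)
    thus ?case by (auto intro!: tendsto_intros)
  next
    case (add p q)
    thus ?case by (auto intro!: tendsto_intros)
  qed
  have [measurable]: "f \<in> borel_measurable borel" by (intro borel_measurable_continuous_onI f)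
  have B0: "B \<ge> 0" using B[of 0] by linarith
  have fint: "integrable M (\<lambda>w. f (V n w))" "integrable P (\<lambda>w. f (T w))" for n
    using B by (auto intro!: integrable_const_bound[of _ B] P.integrable_const_bound[of _ B])
  show ?thesis
  proof (rule LIMSEQ_I)
    fix e :: real assume e: "0 < e"
    \<comment> \<open>makes the total approximation error \<open>\<delta> + (2 * B + 1) * \<delta>\<close> at most \<open>e / 8\<close>\<close>
    define \<delta> where "\<delta> = min 1 (e / (8 * (2 * B + 2)))"
    have \<delta>: "\<delta> > 0" "\<delta> \<le> 1" "\<delta> * (2 * B + 2) \<le> e / 8"
      using e B0 by (auto simp: \<delta>_def min_def divide_simps)
    \<comment> \<open>a continuous substitute for the indicator of \<open>\<bar>x\<bar> > R\<close>, to which convergence of the marginals applies\<close>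
    define \<kappa> where "\<kappa> R x = min 1 (max 0 (\<bar>x\<bar> - real R))" for R and x :: real
    define \<Phi> where "\<Phi> R x = (\<Sum>b\<in>Basis. \<kappa> R (b \<bullet> x))" for R and x :: 'v
    have \<kappa>: "continuous_on UNIV (\<kappa> R)" "\<bar>\<kappa> R x\<bar> \<le> 1" "0 \<le> \<kappa> R x" for R x
      unfolding \<kappa>_def by (auto intro!: continuous_intros)
    have [measurable]: "\<kappa> R \<in> borel_measurable borel" for R
      by (intro borel_measurable_continuous_onI \<kappa>)
    have \<kappa>int: "integrable M (\<lambda>w. \<kappa> R (b \<bullet> V n w))" "integrable P (\<lambda>w. \<kappa> R (b \<bullet> T w))" for R b n
      using \<kappa>(2) by (auto intro!: integrable_const_bound[of _ 1] P.integrable_const_bound[of _ 1])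
    have \<Phi>int: "integrable M (\<lambda>w. \<Phi> R (V n w))" "integrable P (\<lambda>w. \<Phi> R (T w))" for R n
      unfolding \<Phi>_def by (auto intro!: \<kappa>int)
    have "(\<lambda>R. LINT w|P. \<Phi> R (T w)) \<longlonglongrightarrow> (\<Sum>b\<in>(Basis :: 'v set). 0)"
      unfolding \<Phi>_def using \<kappa>int
      by (simp, intro tendsto_null_sum) (use tail_cutoff_expectation[OF P] in \<open>simp add: \<kappa>_def\<close>)
    hence "eventually (\<lambda>R. (LINT w|P. \<Phi> R (T w)) < \<delta>) sequentially"
      using \<delta>(1) by (auto dest: order_tendstoD)
    then obtain R where R: "(LINT w|P. \<Phi> R (T w)) < \<delta>" by (auto simp: eventually_sequentially)
    have "(\<lambda>n. expectation (\<lambda>w. \<Phi> R (V n w))) \<longlonglongrightarrow> (LINT w|P. \<Phi> R (T w))"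
      unfolding \<Phi>_def using \<kappa>int
      by simp (intro tendsto_sum marg_conv[OF \<kappa>(1,2)])
    hence ev1: "eventually (\<lambda>n. expectation (\<lambda>w. \<Phi> R (V n w)) < \<delta>) sequentially"
      using R by (rule order_tendstoD)
    define K where "K = cball (0::'v) (real DIM('v) * (real R + 1))"
    obtain p where p: "trig_poly p" "\<And>x. x \<in> K \<Longrightarrow> \<bar>f x - p x\<bar> < \<delta>" "\<And>x. \<bar>p x\<bar> < B + \<delta>"
      by (rule trig_poly_approx[of K f B \<delta>]) (use \<delta> B f in \<open>auto simp: K_def intro: continuous_on_subset\<close>)
    have diff: "\<bar>f x - p x\<bar> \<le> \<delta> + (2 * B + 1) * \<Phi> R x" for x
    proof (cases "x \<in> K")
      case True
      have "0 \<le> \<Phi> R x" unfolding \<Phi>_def by (intro sum_nonneg \<kappa>)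
      thus ?thesis using p(2)[OF True] B0 by (smt (verit) mult_nonneg_nonneg)
    next
      case False
      have "\<exists>b\<in>Basis. \<bar>b \<bullet> x\<bar> > real R + 1"
      proof (rule ccontr)
        assume "\<not> ?thesis"
        hence "\<bar>x \<bullet> b\<bar> \<le> real R + 1" if "b \<in> Basis" for b
          using that by (metis inner_commute linorder_not_less)
        hence "(\<Sum>b\<in>Basis. \<bar>x \<bullet> b\<bar>) \<le> real DIM('v) * (real R + 1)"
          by (intro sum_bounded_above) auto
        hence "norm x \<le> real DIM('v) * (real R + 1)" using norm_le_l1[of x] by linarith
        thus False using False by (simp add: K_def)
      qed
      then obtain b where b: "b \<in> Basis" "\<bar>b \<bullet> x\<bar> > real R + 1" by blast
      have "1 \<le> \<kappa> R (b \<bullet> x)" using b(2) by (auto simp: \<kappa>_def)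
      also have "\<dots> \<le> \<Phi> R x" unfolding \<Phi>_def by (rule member_le_sum) (use b \<kappa> in auto)
      finally have "(2 * B + 1) * 1 \<le> (2 * B + 1) * \<Phi> R x" using B0 by (intro mult_left_mono) auto
      moreover have "\<bar>f x - p x\<bar> \<le> \<delta> + y" if "(2 * B + 1) * 1 \<le> y" for y
        using that p(3)[of x] B[of x] \<delta>(1) by simp
      ultimately show ?thesis by blast
    qed
    have trig: "(\<lambda>n. expectation (\<lambda>w. p (V n w))) \<longlonglongrightarrow> (LINT w|P. p (T w))"
      "integrable M (\<lambda>w. p (V n w))" "integrable P (\<lambda>w. p (T w))" for n
      using trig_conv[OF p(1)] by auto
    have close: "\<bar>integral\<^sup>L Q (\<lambda>w. f (W w)) - integral\<^sup>L Q (\<lambda>w. p (W w))\<bar> \<le> e / 8"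
      if "prob_space Q" and i: "integrable Q (\<lambda>w. f (W w))" "integrable Q (\<lambda>w. p (W w))"
        "integrable Q (\<lambda>w. \<Phi> R (W w))" and small: "integral\<^sup>L Q (\<lambda>w. \<Phi> R (W w)) < \<delta>"
      for Q :: "'c measure" and W
    proof -
      interpret Q: prob_space Q by fact
      have "\<bar>integral\<^sup>L Q (\<lambda>w. f (W w)) - integral\<^sup>L Q (\<lambda>w. p (W w))\<bar>
          = \<bar>integral\<^sup>L Q (\<lambda>w. f (W w) - p (W w))\<bar>" using i by simp
      also have "\<dots> \<le> integral\<^sup>L Q (\<lambda>w. \<bar>f (W w) - p (W w)\<bar>)" by (rule integral_abs_bound)
      also have "\<dots> \<le> integral\<^sup>L Q (\<lambda>w. \<delta> + (2 * B + 1) * \<Phi> R (W w))"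
        using i diff by (intro integral_mono) auto
      also have "\<dots> = \<delta> + (2 * B + 1) * integral\<^sup>L Q (\<lambda>w. \<Phi> R (W w))"
        using i by (simp add: Q.prob_space)
      also have "\<dots> \<le> \<delta> + (2 * B + 1) * \<delta>" using small B0 by (intro add_left_mono mult_left_mono) auto
      also have "\<dots> \<le> e / 8" using \<delta>(3) by (simp add: algebra_simps)
      finally show ?thesis .
    qed
    have ev2: "eventually (\<lambda>n. \<bar>expectation (\<lambda>w. p (V n w)) - (LINT w|P. p (T w))\<bar> < e/2) sequentially"
      using tendstoD[OF trig(1), of "e/2"] e by (simp add: dist_real_def)
    have "eventually (\<lambda>n. norm (expectation (\<lambda>w. f (V n w)) - (LINT w|P. f (T w))) < e) sequentially"
      using ev1 ev2
    proof eventually_elim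
      case (elim n)
      have "\<bar>expectation (\<lambda>w. f (V n w)) - expectation (\<lambda>w. p (V n w))\<bar> \<le> e / 8"
        by (rule close[OF prob_space_axioms]) (use elim fint trig \<Phi>int in auto)
      moreover have "\<bar>(LINT w|P. f (T w)) - (LINT w|P. p (T w))\<bar> \<le> e / 8"
        by (rule close[OF P]) (use R fint trig \<Phi>int in auto)
      moreover have "norm (x - u) < e"
        if "\<bar>x - y\<bar> \<le> e / 8" "\<bar>u - v\<bar> \<le> e / 8" "\<bar>y - v\<bar> < e / 2" for x y u v :: real
        using that e unfolding real_norm_def abs_le_iff abs_less_iff by linarith
      ultimately show ?case using elim(2) by blast
    qed
    thus "\<exists>no. \<forall>n\<ge>no. norm (expectation (\<lambda>w. f (V n w)) - (LINT w|P. f (T w))) < e"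
      by (simp add: eventually_sequentially)
  qed
qed

section \<open>Gaussian vectors and the central limit theorem\<close>

lemma normal_law_moments:
  fixes W :: "'b \<Rightarrow> real"
  assumes "prob_space P" and [measurable]: "W \<in> borel_measurable P" and \<sigma>: "\<sigma> \<ge> 0"
    and D: "distr P borel W = normal_law \<mu> \<sigma>"
  shows "integrable P W" "integral\<^sup>L P W = \<mu>"
    "integrable P (\<lambda>w. (W w)\<^sup>2)" "(LINT w|P. (W w - \<mu>)\<^sup>2) = \<sigma>\<^sup>2"
proof -
  interpret prob_space P by fact
  have "integrable P W \<and> integral\<^sup>L P W = \<mu> \<and> integrable P (\<lambda>w. (W w - \<mu>)\<^sup>2) \<and> (LINT w|P. (W w - \<mu>)\<^sup>2) = \<sigma>\<^sup>2"
  proof (cases "\<sigma> = 0")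
    case True
    hence "distr P borel W = return borel \<mu>" unfolding D by (simp add: normal_law_def)
    moreover have "AE x in return borel \<mu>. x = \<mu>" by (subst AE_return) auto
    ultimately have "AE x in distr P borel W. x = \<mu>" by (simp only:)
    hence ae: "AE w in P. W w = \<mu>" by (simp add: AE_distr_iff)
    have ae2: "AE w in P. (W w - \<mu>)\<^sup>2 = 0" using ae by eventually_elim simp
    have i1: "integrable P W \<longleftrightarrow> integrable P (\<lambda>w. \<mu>)"
      by (rule integrable_cong_AE) (use ae in auto)
    have i2: "integrable P (\<lambda>w. (W w - \<mu>)\<^sup>2) \<longleftrightarrow> integrable P (\<lambda>w. 0 :: real)"
      by (rule integrable_cong_AE) (use ae2 in auto)
    have e1: "integral\<^sup>L P W = (LINT w|P. \<mu>)"
      by (rule integral_cong_AE) (use ae in auto)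
    have e2: "(LINT w|P. (W w - \<mu>)\<^sup>2) = (LINT w|P. 0)"
      by (rule integral_cong_AE) (use ae2 in auto)
    show ?thesis using i1 e1 i2 e2 True by (simp add: prob_space)
  next
    case False
    hence \<sigma>: "0 < \<sigma>" using \<sigma> by simp
    have "distr P lborel W = distr P borel W" by (rule distr_cong) auto
    hence W: "distributed P lborel W (normal_density \<mu> \<sigma>)"
      using D \<sigma> by (simp add: distributed_def normal_law_def)
    have i1: "integrable P W"
      by (rule distributed_integrable_var[OF W]) (auto simp: integrable_normal_moment_nz_1[OF \<sigma>])
    have i2: "integrable P (\<lambda>w. (W w - \<mu>)\<^sup>2)"
      using distributed_integrable[OF W, of "\<lambda>x. (x - \<mu>)\<^sup>2"] integrable_normal_moment[OF \<sigma>, of \<mu> 2] by simp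
    show ?thesis
      using i1 i2 normal_distributed_expectation[OF \<sigma> W] normal_distributed_variance[OF \<sigma> W] by simp
  qed
  thus i: "integrable P W" "integral\<^sup>L P W = \<mu>" "(LINT w|P. (W w - \<mu>)\<^sup>2) = \<sigma>\<^sup>2" by auto
  have "integrable P (\<lambda>w. (W w - \<mu>)\<^sup>2 + 2 * \<mu> * W w - \<mu>\<^sup>2)"
    using \<open>integrable P W \<and> _\<close> by auto
  thus "integrable P (\<lambda>w. (W w)\<^sup>2)"
    by (rule back_subst[of "integrable P"]) (auto simp: power2_eq_square algebra_simps)
qed

lemma borel_measurable_component[measurable (raw)]:
  fixes f :: "'b \<Rightarrow> real ^ 'n"
  shows "f \<in> borel_measurable P \<Longrightarrow> (\<lambda>w. f w $ i) \<in> borel_measurable P"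
  by (rule measurable_compose[OF _ borel_measurable_nth])

lemma integrable_mult_of_squares:
  fixes f g :: "'b \<Rightarrow> real"
  assumes [measurable]: "f \<in> borel_measurable P" "g \<in> borel_measurable P"
    and sq: "integrable P (\<lambda>w. (f w)\<^sup>2)" "integrable P (\<lambda>w. (g w)\<^sup>2)"
  shows "integrable P (\<lambda>w. f w * g w)"
proof (rule Bochner_Integration.integrable_bound)
  show "integrable P (\<lambda>w. (f w)\<^sup>2 + (g w)\<^sup>2)" using sq by auto
  show "AE w in P. norm (f w * g w) \<le> norm ((f w)\<^sup>2 + (g w)\<^sup>2)"
  proof (intro AE_I2)
    fix w
    have "2 * \<bar>f w\<bar> * \<bar>g w\<bar> \<le> (f w)\<^sup>2 + (g w)\<^sup>2"
      using sum_squares_bound[of "\<bar>f w\<bar>" "\<bar>g w\<bar>"] by simp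
    moreover have "\<bar>f w\<bar> * \<bar>g w\<bar> \<le> 2 * \<bar>f w\<bar> * \<bar>g w\<bar>" by (simp add: mult_right_mono)
    ultimately have "\<bar>f w\<bar> * \<bar>g w\<bar> \<le> (f w)\<^sup>2 + (g w)\<^sup>2" by (rule order_trans[rotated])
    thus "norm (f w * g w) \<le> norm ((f w)\<^sup>2 + (g w)\<^sup>2)"
      by (simp add: abs_mult)
  qed
qed auto

text \<open>
  The marginals of a Gaussian vector are normal by definition, so their first two moments
  determine them.
\<close>

lemma gaussian_vector_marginal:
  fixes T :: "'b \<Rightarrow> real ^ 'n"
  assumes "prob_space P" and G: "gaussian_vector P T" and m0: "mean_vector P T = 0"
  shows "distr P borel (\<lambda>w. a \<bullet> T w) = normal_law 0 (sqrt (a \<bullet> (covariance_matrix P T *v a)))"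
proof -
  interpret prob_space P by fact
  have T[measurable]: "T \<in> borel_measurable P" using G by (simp add: gaussian_vector_def)
  have comp: "integrable P (\<lambda>w. T w $ i) \<and> integrable P (\<lambda>w. (T w $ i)\<^sup>2)" for i
  proof -
    obtain \<mu> \<sigma> where "\<sigma> \<ge> 0" "distr P borel (\<lambda>w. axis i 1 \<bullet> T w) = normal_law \<mu> \<sigma>"
      using G unfolding gaussian_vector_def by metis
    moreover have "axis i 1 \<bullet> T w = T w $ i" for w by (simp add: inner_axis')
    ultimately show ?thesis
      using normal_law_moments(1,3)[OF \<open>prob_space P\<close>, of "\<lambda>w. T w $ i" \<sigma> \<mu>] by simp
  qed
  have mean: "(LINT w|P. T w $ i) = 0" for i
    using arg_cong[OF m0, of "\<lambda>v. v $ i"] by (simp add: mean_vector_def)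
  have prod: "integrable P (\<lambda>w. T w $ i * T w $ j)" for i j
    using comp by (intro integrable_mult_of_squares) auto
  obtain \<mu> \<sigma> where \<sigma>: "\<sigma> \<ge> 0" and D: "distr P borel (\<lambda>w. a \<bullet> T w) = normal_law \<mu> \<sigma>"
    using G unfolding gaussian_vector_def by metis
  have inner: "a \<bullet> T w = (\<Sum>i\<in>UNIV. a $ i * T w $ i)" for w
    by (simp add: inner_vec_def)
  note mom = normal_law_moments[OF \<open>prob_space P\<close> _ \<sigma> D]
  have "\<mu> = (LINT w|P. a \<bullet> T w)" using mom(2) by simp
  also have "\<dots> = 0" unfolding inner using comp mean by simp
  finally have \<mu>: "\<mu> = 0" .
  have "\<sigma>\<^sup>2 = (LINT w|P. (a \<bullet> T w)\<^sup>2)" using mom(4) \<mu> by simp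
  also have "\<dots> = (LINT w|P. (\<Sum>i\<in>UNIV. \<Sum>j\<in>UNIV. (a $ i * a $ j) * (T w $ i * T w $ j)))"
    unfolding inner by (simp add: power2_eq_square sum_product mult_ac)
  also have "\<dots> = (\<Sum>i\<in>UNIV. \<Sum>j\<in>UNIV. (a $ i * a $ j) * (LINT w|P. T w $ i * T w $ j))"
    using prod by simp
  also have "\<dots> = a \<bullet> (covariance_matrix P T *v a)"
    by (simp add: inner_vec_def matrix_vector_mult_def covariance_matrix_def m0 sum_distrib_left mult_ac)
  finally have "\<sigma> = sqrt (a \<bullet> (covariance_matrix P T *v a))"
    using \<sigma> by (metis real_sqrt_unique)
  thus ?thesis using D \<mu> by simp
qed

text \<open>
  The variance may vanish: then all summands are almost surely zero, and so is the limit.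
\<close>

lemma (in prob_space) iid_clt:
  fixes Y :: "nat \<Rightarrow> 'a \<Rightarrow> real"
  assumes ind: "indep_vars (\<lambda>_. borel) Y UNIV"
    and id: "\<And>i. distr M borel (Y i) = distr M borel (Y 0)"
    and sq: "integrable M (\<lambda>w. (Y 0 w)\<^sup>2)" and mean: "expectation (Y 0) = 0"
  shows "weak_conv_m (\<lambda>n. distr M borel (\<lambda>w. (\<Sum>i<n. Y i w) / sqrt (real n)))
           (normal_law 0 (sqrt (expectation (\<lambda>w. (Y 0 w)\<^sup>2))))"
proof -
  have Y[measurable]: "Y i \<in> borel_measurable M" for i
    using ind by (auto simp: indep_vars_def)
  have transfer: "expectation (\<lambda>w. f (Y i w)) = expectation (\<lambda>w. f (Y 0 w))"
    "integrable M (\<lambda>w. f (Y i w)) \<longleftrightarrow> integrable M (\<lambda>w. f (Y 0 w))"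
    if [measurable]: "f \<in> borel_measurable borel" for f :: "real \<Rightarrow> real" and i
    using id[of i] integral_distr[of "Y i" M borel f] integral_distr[of "Y 0" M borel f]
      integrable_distr_eq[of "Y i" M borel f] integrable_distr_eq[of "Y 0" M borel f] by auto
  have mean_i: "expectation (Y i) = 0" and sq_i: "integrable M (\<lambda>w. (Y i w)\<^sup>2)"
    and sec_i: "expectation (\<lambda>w. (Y i w)\<^sup>2) = expectation (\<lambda>w. (Y 0 w)\<^sup>2)" for i
    using transfer[of "\<lambda>x. x" i] transfer[of "\<lambda>x. x\<^sup>2" i] mean sq by auto
  define \<sigma> where "\<sigma> = sqrt (expectation (\<lambda>w. (Y 0 w)\<^sup>2))"
  have \<sigma>: "\<sigma> \<ge> 0" "\<sigma>\<^sup>2 = expectation (\<lambda>w. (Y 0 w)\<^sup>2)" by (simp_all add: \<sigma>_def)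
  show ?thesis
  proof (cases "\<sigma> = 0")
    case True
    have "AE w in M. Y i w = 0" for i
    proof -
      have "expectation (\<lambda>w. (Y i w)\<^sup>2) = 0" using True \<sigma>(2) sec_i by simp
      hence "AE w in M. (Y i w)\<^sup>2 = 0"
        using integral_nonneg_eq_0_iff_AE[OF sq_i[of i]] by simp
      thus ?thesis by simp
    qed
    hence "AE w in M. \<forall>i. Y i w = 0" by (simp add: AE_all_countable)
    hence ae: "AE w in M. (\<Sum>i<n. Y i w) / sqrt (real n) = 0" for n by eventually_elim simp
    have "distr M borel (\<lambda>w. (\<Sum>i<n. Y i w) / sqrt (real n)) = return borel 0" for n
    proof -
      have "distr M borel (\<lambda>w. (\<Sum>i<n. Y i w) / sqrt (real n)) = distr M borel (\<lambda>w. 0)"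
        by (rule distr_cong_AE) (use ae in auto)
      thus ?thesis by (simp add: distr_const)
    qed
    thus ?thesis using True by (simp add: \<sigma>_def normal_law_def weak_conv_m_def weak_conv_def)
  next
    case False
    hence \<sigma>p: "\<sigma> > 0" using \<sigma> by simp
    define W where "W n w = (\<Sum>i<n. Y i w) / sqrt (real n * \<sigma>\<^sup>2)" for n w
    have [measurable]: "W n \<in> borel_measurable M" for n unfolding W_def by simp
    have clt: "weak_conv_m (\<lambda>n. distr M borel (W n)) std_normal_distribution"
      unfolding W_def
      by (rule central_limit_theorem_zero_mean[where \<mu>="distr M borel (Y 0)"])
         (use ind mean_i \<sigma>p sq_i sec_i \<sigma>(2) id in auto)
    interpret N: real_distribution std_normal_distribution by (rule real_dist_normal_dist)
    have eq: "(\<Sum>i<n. Y i w) / sqrt (real n) = \<sigma> * W n w" for n w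
      using \<sigma>p by (simp add: W_def real_sqrt_mult)
    have "weak_conv_m (\<lambda>n. distr M borel (\<lambda>w. \<sigma> * W n w)) (distr std_normal_distribution borel (\<lambda>x. \<sigma> * x))"
    proof (rule weak_conv_m_if_close_to_convergent[where Y="\<lambda>n w. \<sigma> * W n w"])
      show "vanishes_in_prob M (\<lambda>n w. \<sigma> * W n w - \<sigma> * W n w)"
        by (auto simp: vanishes_in_prob_def)
      fix f :: "real \<Rightarrow> real" and B assume f: "continuous_on UNIV f" and B: "\<And>x. \<bar>f x\<bar> \<le> B"
      have [measurable]: "f \<in> borel_measurable borel" by (rule borel_measurable_continuous_onI[OF f])
      have cont: "isCont (\<lambda>x. f (\<sigma> * x)) x" for x
      proof -
        have "continuous_on UNIV (\<lambda>x. f (\<sigma> * x))"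
          by (rule continuous_on_compose2[OF f]) (auto intro: continuous_on_mult_left continuous_on_id)
        thus ?thesis by (simp add: continuous_on_eq_continuous_at)
      qed
      have "(\<lambda>n. LINT x|distr M borel (W n). f (\<sigma> * x)) \<longlonglongrightarrow> (LINT x|std_normal_distribution. f (\<sigma> * x))"
        by (rule weak_conv_imp_integral_bdd_continuous_conv[OF _ _ clt cont, where B=B])
           (use B in \<open>auto intro: real_distribution_distr real_dist_normal_dist\<close>)
      thus "(\<lambda>n. expectation (\<lambda>w. f (\<sigma> * W n w))) \<longlonglongrightarrow> (LINT x|std_normal_distribution. f (\<sigma> * x))"
        by (simp add: integral_distr)
    qed (auto intro: N.prob_space_axioms)
    moreover have "distr std_normal_distribution borel (\<lambda>x. \<sigma> * x) = normal_law 0 \<sigma>"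
    proof -
      have "distributed std_normal_distribution lborel (\<lambda>x. x) (normal_density 0 1)"
        by (simp add: distributed_def distr_id2)
      from N.normal_density_affine[OF this, of \<sigma> 0] \<sigma>p
      have "distr std_normal_distribution lborel (\<lambda>x. \<sigma> * x) = density lborel (normal_density 0 \<sigma>)"
        by (simp add: distributed_def)
      moreover have "distr std_normal_distribution lborel (\<lambda>x. \<sigma> * x) = distr std_normal_distribution borel (\<lambda>x. \<sigma> * x)"
        by (rule distr_cong) auto
      ultimately show ?thesis using \<sigma>p by (simp add: normal_law_def)
    qed
    ultimately show ?thesis by (simp add: eq \<sigma>_def[symmetric])
  qed
qed

lemma (in prob_space) iid_vector_clt:
  fixes Z :: "nat \<Rightarrow> 'a \<Rightarrow> real ^ 'n" and T :: "'b \<Rightarrow> real ^ 'n"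
  assumes ind: "indep_vars (\<lambda>_. borel) Z UNIV"
    and id: "\<And>i. distr M borel (Z i) = distr M borel (Z 0)"
    and sq: "\<And>j. integrable M (\<lambda>w. (Z 0 w $ j)\<^sup>2)" and mean: "\<And>j. expectation (\<lambda>w. Z 0 w $ j) = 0"
    and P: "prob_space P" and G: "gaussian_vector P T" and m0: "mean_vector P T = 0"
    and cov: "\<And>j k. covariance_matrix P T $ j $ k = expectation (\<lambda>w. Z 0 w $ j * Z 0 w $ k)"
    and f: "continuous_on UNIV f" and B: "\<And>x. \<bar>f x\<bar> \<le> B"
  shows "(\<lambda>n. expectation (\<lambda>w. f ((1 / sqrt (real n)) *\<^sub>R (\<Sum>i<n. Z i w)))) \<longlonglongrightarrow> (LINT w|P. f (T w) :: real)"
proof (rule cramer_wold[OF _ P _ _ f B])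
  have Z[measurable]: "Z i \<in> borel_measurable M" for i
    using ind by (auto simp: indep_vars_def)
  show "(\<lambda>w. (1 / sqrt (real n)) *\<^sub>R (\<Sum>i<n. Z i w)) \<in> borel_measurable M" for n by simp
  show "T \<in> borel_measurable P" using G by (simp add: gaussian_vector_def)
  fix a :: "real ^ 'n"
  have int1: "integrable M (\<lambda>w. Z 0 w $ j)" for j
    using sq[of j] by (rule square_integrable_imp_integrable[rotated]) simp
  have int2: "integrable M (\<lambda>w. Z 0 w $ j * Z 0 w $ k)" for j k
    using sq[of j] sq[of k] by (intro integrable_mult_of_squares) auto
  have inner: "a \<bullet> Z i w = (\<Sum>j\<in>UNIV. a $ j * Z i w $ j)" for i w
    by (simp add: inner_vec_def)
  have square: "(a \<bullet> Z 0 w)\<^sup>2 = (\<Sum>i\<in>UNIV. \<Sum>j\<in>UNIV. (a $ i * a $ j) * (Z 0 w $ i * Z 0 w $ j))" for w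
    unfolding inner by (simp add: power2_eq_square sum_product mult_ac)
  have "expectation (\<lambda>w. (a \<bullet> Z 0 w)\<^sup>2) = a \<bullet> (covariance_matrix P T *v a)"
    unfolding square using int2
    by (simp add: inner_vec_def matrix_vector_mult_def cov sum_distrib_left mult_ac)
  moreover have "weak_conv_m (\<lambda>n. distr M borel (\<lambda>w. (\<Sum>i<n. a \<bullet> Z i w) / sqrt (real n)))
           (normal_law 0 (sqrt (expectation (\<lambda>w. (a \<bullet> Z 0 w)\<^sup>2))))"
  proof (rule iid_clt)
    show "indep_vars (\<lambda>_. borel) (\<lambda>i w. a \<bullet> Z i w) UNIV"
      by (rule indep_vars_compose2[OF ind]) simp
    show "distr M borel (\<lambda>w. a \<bullet> Z i w) = distr M borel (\<lambda>w. a \<bullet> Z 0 w)" for i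
      using arg_cong[OF id[of i], of "\<lambda>D. distr D borel (\<lambda>z. a \<bullet> z)"]
      by (simp add: distr_distr comp_def)
    show "integrable M (\<lambda>w. (a \<bullet> Z 0 w)\<^sup>2)" unfolding square using int2 by simp
    show "expectation (\<lambda>w. a \<bullet> Z 0 w) = 0" unfolding inner using int1 mean by simp
  qed
  ultimately show "weak_conv_m (\<lambda>n. distr M borel (\<lambda>w. a \<bullet> ((1 / sqrt (real n)) *\<^sub>R (\<Sum>i<n. Z i w))))
      (distr P borel (\<lambda>w. a \<bullet> T w))"
    unfolding gaussian_vector_marginal[OF P G m0] by (simp add: inner_sum_right divide_inverse mult.commute)
qed

section \<open>Counting index tuples\<close>

(* The index sets are of the form {1..m}, and rewriting 1 to Suc 0 in them only gets in the way. *)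
declare One_nat_def [simp del]

abbreviation share_two :: "nat \<Rightarrow> (nat \<Rightarrow> nat) \<Rightarrow> (nat \<Rightarrow> nat) \<Rightarrow> bool" where
  "share_two m i i' \<equiv> \<exists>p q. p \<noteq> q \<and> {p, q} \<subseteq> i ` {1..m} \<inter> i' ` {1..m}"

lemma inj_on_image_index_tuples: "inj_on (\<lambda>i. i ` {1..m}) (index_tuples m n)"
proof (rule inj_onI)
  fix i i' assume i: "i \<in> index_tuples m n" and i': "i' \<in> index_tuples m n"
    and eq: "i ` {1..m} = i' ` {1..m}"
  have srt: "map f [1..<Suc m] = sorted_list_of_set (f ` {1..m})" if "f \<in> index_tuples m n" for f
  proof -
    have sm: "strict_mono_on {1..m} f" using that by (simp add: index_tuples_def)
    have "sorted_wrt (<) (map f [1..<Suc m])"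
      unfolding sorted_wrt_map
      by (rule sorted_wrt_mono_rel[OF _ sorted_wrt_upt]) (use sm in \<open>auto simp: strict_mono_on_def\<close>)
    hence "sorted_list_of_set (set (map f [1..<Suc m])) = map f [1..<Suc m]"
      by (intro sorted_list_of_set.idem_if_sorted_distinct) (simp_all add: strict_sorted_iff)
    thus ?thesis by (simp only: set_map set_upt atLeastLessThanSuc_atLeastAtMost)
  qed
  have "map i [1..<Suc m] = map i' [1..<Suc m]" using srt[OF i] srt[OF i'] eq by simp
  hence "\<forall>j\<in>{1..m}. i j = i' j" by (auto simp del: upt_Suc)
  thus "i = i'" using i i' unfolding index_tuples_def
    by (intro PiE_ext[of i "{1..m}" "\<lambda>_. {1..n}" i']) auto
qed

lemma index_tuples_inj: "i \<in> index_tuples m n \<Longrightarrow> inj_on i {1..m}"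
  by (auto simp: index_tuples_def intro: strict_mono_on_imp_inj_on)

lemma index_tuples_range: "i \<in> index_tuples m n \<Longrightarrow> j \<in> {1..m} \<Longrightarrow> i j \<in> {1..n}"
  unfolding index_tuples_def by (drule CollectD, elim conjE) (erule (1) PiE_mem)

text \<open>
  Counting tuples is counting \<open>m\<close>-element subsets of \<open>{1..n}\<close>.
\<close>

lemma bij_betw_index_tuples:
  "bij_betw (\<lambda>i. i ` {1..m}) (index_tuples m n) {A. A \<subseteq> {1..n} \<and> card A = m}"
proof -
  have sub: "(\<lambda>i. i ` {1..m}) ` index_tuples m n \<subseteq> {A. A \<subseteq> {1..n} \<and> card A = m}"
  proof clarify
    fix i assume i: "i \<in> index_tuples m n"
    show "i ` {1..m} \<subseteq> {1..n} \<and> card (i ` {1..m}) = m"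
      using index_tuples_range[OF i] card_image[OF index_tuples_inj[OF i]] by auto
  qed
  have fin: "finite {A. A \<subseteq> {1..n} \<and> card A = m}" by simp
  have "card ((\<lambda>i. i ` {1..m}) ` index_tuples m n) = card {A. A \<subseteq> {1..n} \<and> card A = m}"
    using card_image[OF inj_on_image_index_tuples] n_subsets[of "{1..n}" m] by (simp add: card_index_tuples)
  with card_subset_eq[OF fin sub] show ?thesis
    by (simp add: bij_betw_def inj_on_image_index_tuples)
qed

lemma card_index_tuples_containing:
  assumes Q: "Q \<subseteq> {1..n}" "card Q \<le> m"
  shows "card {i\<in>index_tuples m n. Q \<subseteq> i ` {1..m}} = (n - card Q) choose (m - card Q)"
proof -
  have fQ: "finite Q" using Q(1) finite_subset by blast
  have bij1: "bij_betw (\<lambda>i. i ` {1..m}) {i\<in>index_tuples m n. Q \<subseteq> i ` {1..m}} {A. A \<subseteq> {1..n} \<and> card A = m \<and> Q \<subseteq> A}"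
    (is "bij_betw ?f ?I ?A")
  proof -
    have "?f ` ?I = {A \<in> ?f ` index_tuples m n. Q \<subseteq> A}" by (auto simp: image_iff)
    also have "\<dots> = ?A" using bij_betw_imp_surj_on[OF bij_betw_index_tuples[of m n]] by auto
    finally show ?thesis
      using inj_on_subset[OF inj_on_image_index_tuples[of m n], of ?I] by (auto simp: bij_betw_def)
  qed
  have bij2: "bij_betw (\<lambda>A. A - Q) {A. A \<subseteq> {1..n} \<and> card A = m \<and> Q \<subseteq> A}
      {A. A \<subseteq> {1..n} - Q \<and> card A = m - card Q}"
  proof (rule bij_betw_byWitness[where f'="\<lambda>A. A \<union> Q"])
    show "(\<lambda>A. A - Q) ` {A. A \<subseteq> {1..n} \<and> card A = m \<and> Q \<subseteq> A} \<subseteq> {A. A \<subseteq> {1..n} - Q \<and> card A = m - card Q}"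
      using fQ by (auto simp: card_Diff_subset)
    show "(\<lambda>A. A \<union> Q) ` {A. A \<subseteq> {1..n} - Q \<and> card A = m - card Q} \<subseteq> {A. A \<subseteq> {1..n} \<and> card A = m \<and> Q \<subseteq> A}"
    proof clarify
      fix A assume A: "A \<subseteq> {1..n} - Q" "card A = m - card Q"
      have "finite A" using A(1) by (rule finite_subset) simp
      hence "card (A \<union> Q) = card A + card Q" using A(1) fQ by (intro card_Un_disjoint) auto
      thus "A \<union> Q \<subseteq> {1..n} \<and> card (A \<union> Q) = m \<and> Q \<subseteq> A \<union> Q" using A Q by auto
    qed
  qed auto
  have "card {i\<in>index_tuples m n. Q \<subseteq> i ` {1..m}} = card {A. A \<subseteq> {1..n} - Q \<and> card A = m - card Q}"
    using bij_betw_same_card[OF bij1] bij_betw_same_card[OF bij2] by (rule trans)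
  also have "\<dots> = card ({1..n} - Q) choose (m - card Q)" by (rule n_subsets) simp
  finally show ?thesis using Q(1) fQ by (simp add: card_Diff_subset)
qed

lemma card_index_tuples_containing_point:
  assumes "1 \<le> m" "p \<in> {1..n}"
  shows "real n * real (card {i\<in>index_tuples m n. p \<in> i ` {1..m}}) = real m * real (n choose m)"
proof -
  have "card {i\<in>index_tuples m n. p \<in> i ` {1..m}} = (n - 1) choose (m - 1)"
    using card_index_tuples_containing[of "{p}" n m] assms by (simp add: One_nat_def)
  moreover have "n * ((n - 1) choose (m - 1)) = m * (n choose m)"
    using binomial_absorption[of "m - 1" n] assms by simp
  ultimately show ?thesis by (metis of_nat_mult)
qed

text \<open>
  For \<open>m \<ge> 2\<close> the left-hand side is \<open>m (m - 1) (n choose m)\<close>; for \<open>m < 2\<close> it is zero.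
\<close>

lemma card_index_tuples_containing_pair:
  assumes "p \<in> {1..n}" "q \<in> {1..n}" "p \<noteq> q"
  shows "real n * (real n - 1) * real (card {i\<in>index_tuples m n. p \<in> i ` {1..m} \<and> q \<in> i ` {1..m}})
      \<le> (real m)\<^sup>2 * real (n choose m)"
proof (cases "2 \<le> m")
  case True
  have n: "2 \<le> n" using assms by auto
  have "card {i\<in>index_tuples m n. p \<in> i ` {1..m} \<and> q \<in> i ` {1..m}} = (n - 2) choose (m - 2)"
  proof -
    have "card {p, q} = 2" using assms(3) by (simp add: numeral_2_eq_2)
    thus ?thesis using card_index_tuples_containing[of "{p, q}" n m] assms(1,2) True by simp
  qed
  moreover have "n * ((n - 1) choose (m - 1)) = m * (n choose m)"
    using binomial_absorption[of "m - 1" n] True by simp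
  moreover have "(n - 1) * ((n - 2) choose (m - 2)) = (m - 1) * ((n - 1) choose (m - 1))"
    using binomial_absorption[of "m - 2" "n - 1"] True by (simp add: numeral_2_eq_2 One_nat_def Suc_diff_Suc)
  ultimately have "n * (n - 1) * card {i\<in>index_tuples m n. p \<in> i ` {1..m} \<and> q \<in> i ` {1..m}} = m * (m - 1) * (n choose m)"
    (is "_ * ?c = _")
    by (simp add: mult_ac)
  hence "real (n * (n - 1) * ?c) = real (m * (m - 1) * (n choose m))" by (rule arg_cong)
  hence "real n * (real n - 1) * real (card {i\<in>index_tuples m n. p \<in> i ` {1..m} \<and> q \<in> i ` {1..m}})
      = real m * (real m - 1) * real (n choose m)"
    using n True by (simp add: of_nat_diff)
  also have "\<dots> \<le> (real m)\<^sup>2 * real (n choose m)"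
    by (intro mult_right_mono) (auto simp: power2_eq_square algebra_simps)
  finally show ?thesis .
next
  case False
  have empty: "{i\<in>index_tuples m n. p \<in> i ` {1..m} \<and> q \<in> i ` {1..m}} = {}"
  proof -
    have "\<not> (p \<in> i ` {1..m} \<and> q \<in> i ` {1..m})" for i :: "nat \<Rightarrow> nat"
    proof -
      have "{1..m} \<subseteq> {1}" using False by auto
      hence sub: "i ` {1..m} \<subseteq> {i 1}" by (auto dest: subsetD)
      show ?thesis
      proof
        assume "p \<in> i ` {1..m} \<and> q \<in> i ` {1..m}"
        hence "p = i 1" "q = i 1" using subsetD[OF sub, of p] subsetD[OF sub, of q] by simp_all
        thus False using assms(3) by simp
      qed
    qed
    thus ?thesis by simp
  qed
  show ?thesis unfolding empty by simp
qed

section \<open>Projection of U-statistics\<close>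

lemma integrable_bounded_comp:
  assumes "finite_measure N" and "f \<in> borel_measurable N" "\<And>x. \<bar>f x\<bar> \<le> C"
  shows "integrable N (f :: _ \<Rightarrow> real)"
  by (rule finite_measure.integrable_const_bound[OF assms(1), of _ C]) (use assms in auto)

lemma abs_expectation_bound:
  assumes "prob_space N" "\<And>x. \<bar>f x\<bar> \<le> C"
  shows "\<bar>LINT x|N. f x :: real\<bar> \<le> C"
proof -
  interpret N: prob_space N by fact
  have C: "C \<ge> 0" using assms(2)[of undefined] by linarith
  show ?thesis
  proof (cases "integrable N f")
    case True
    have "\<bar>LINT x|N. f x\<bar> \<le> (LINT x|N. \<bar>f x\<bar>)" by (rule integral_abs_bound)
    also have "\<dots> \<le> (LINT x|N. C)" using True assms(2) by (intro integral_mono) auto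
    finally show ?thesis by (simp add: N.prob_space)
  qed (use C in \<open>simp add: not_integrable_integral_eq\<close>)
qed

lemma integral_double_sum:
  fixes f :: "'i \<Rightarrow> 'j \<Rightarrow> 'a \<Rightarrow> real"
  assumes "\<And>i j. i \<in> I \<Longrightarrow> j \<in> J \<Longrightarrow> integrable N (f i j)"
  shows "(LINT x|N. (\<Sum>i\<in>I. \<Sum>j\<in>J. f i j x)) = (\<Sum>i\<in>I. \<Sum>j\<in>J. LINT x|N. f i j x)"
proof -
  have "(LINT x|N. (\<Sum>i\<in>I. \<Sum>j\<in>J. f i j x)) = (\<Sum>i\<in>I. LINT x|N. (\<Sum>j\<in>J. f i j x))"
    by (rule Bochner_Integration.integral_sum) (intro Bochner_Integration.integrable_sum assms)
  also have "\<dots> = (\<Sum>i\<in>I. \<Sum>j\<in>J. LINT x|N. f i j x)"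
    by (intro sum.cong refl Bochner_Integration.integral_sum assms)
  finally show ?thesis .
qed

definition u_stat :: "(nat \<Rightarrow> 'w \<Rightarrow> 'x) \<Rightarrow> nat \<Rightarrow> ((nat \<Rightarrow> 'x) \<Rightarrow> real) \<Rightarrow> nat \<Rightarrow> 'w \<Rightarrow> real" where
  "u_stat X m k n w = (\<Sum>i\<in>index_tuples m n. k (\<lambda>j\<in>{1..m}. X (i j) w)) / real (n choose m)"

definition kernel_mean :: "'w measure \<Rightarrow> (nat \<Rightarrow> 'w \<Rightarrow> 'x) \<Rightarrow> nat \<Rightarrow> ((nat \<Rightarrow> 'x) \<Rightarrow> real) \<Rightarrow> real" where
  "kernel_mean M X m k = (LINT w|M. k (\<lambda>j\<in>{1..m}. X j w))"

text \<open>
  The centred conditional expectation of the kernel given one of its arguments: the first-order term of the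
  Hoeffding decomposition.
\<close>

definition hajek_term ::
    "'w measure \<Rightarrow> (nat \<Rightarrow> 'w \<Rightarrow> 'x) \<Rightarrow> nat \<Rightarrow> ((nat \<Rightarrow> 'x) \<Rightarrow> real) \<Rightarrow> 'x \<Rightarrow> real" where
  "hajek_term M X m k x = (LINT w|M. k ((\<lambda>j\<in>{1..m}. X j w)(1 := x))) - kernel_mean M X m k"

locale iid_sample = prob_space M for M :: "'w measure" +
  fixes S F :: "'x measure" and X :: "nat \<Rightarrow> 'w \<Rightarrow> 'x" and m :: nat
  assumes indep: "indep_vars (\<lambda>_. S) X {1..}"
    and ident: "\<And>i. i \<ge> 1 \<Longrightarrow> distr M S (X i) = F"
    and m_pos: "m \<ge> 1"
begin

lemma X_measurable: "i \<ge> 1 \<Longrightarrow> X i \<in> measurable M S"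
  using indep by (auto simp: indep_vars_def)

lemma sets_F[measurable_cong]: "sets F = sets S" and space_F: "space F = space S"
  using ident[of 1] by auto

lemma prob_space_F: "prob_space F"
  using prob_space_distr[OF X_measurable[of 1]] ident[of 1] by simp

sublocale F: prob_space F by (rule prob_space_F)

sublocale PF: product_prob_space "\<lambda>_ :: nat. F" UNIV
  by unfold_locales

lemma sets_PiM_F: "sets (Pi\<^sub>M I (\<lambda>_. F)) = sets (Pi\<^sub>M I (\<lambda>_. S))"
  by (intro sets_PiM_cong refl sets_F)

lemma measurable_PiM_F: "measurable (Pi\<^sub>M I (\<lambda>_. F)) N = measurable (Pi\<^sub>M I (\<lambda>_. S)) N"
  by (intro measurable_cong_sets sets_PiM_F refl)

lemma sample_measurable:
  "J \<subseteq> {1..} \<Longrightarrow> (\<lambda>w. \<lambda>j\<in>J. X j w) \<in> measurable M (Pi\<^sub>M J (\<lambda>_. S))"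
  using X_measurable by (intro measurable_restrict) auto

lemma distr_sample:
  assumes "J \<subseteq> {1..}" "J \<noteq> {}"
  shows "distr M (Pi\<^sub>M J (\<lambda>_. S)) (\<lambda>w. \<lambda>j\<in>J. X j w) = Pi\<^sub>M J (\<lambda>_. F)"
proof -
  have "indep_vars (\<lambda>_. S) X J" using indep assms(1) by (rule indep_vars_subset)
  hence "distr M (Pi\<^sub>M J (\<lambda>_. S)) (\<lambda>w. \<lambda>j\<in>J. X j w) = Pi\<^sub>M J (\<lambda>j. distr M S (X j))"
    using indep_vars_iff_distr_eq_PiM'[of J X "\<lambda>_. S"] assms X_measurable by auto
  also have "\<dots> = Pi\<^sub>M J (\<lambda>_. F)"
    using assms ident by (intro PiM_cong) auto
  finally show ?thesis .
qed

lemma expectation_sample: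
  assumes "J \<subseteq> {1..}" "J \<noteq> {}" and [measurable]: "f \<in> borel_measurable (Pi\<^sub>M J (\<lambda>_. S))"
  shows "expectation (\<lambda>w. f (\<lambda>j\<in>J. X j w)) = (LINT z|Pi\<^sub>M J (\<lambda>_. F). f z :: real)"
  unfolding distr_sample[OF assms(1,2), symmetric]
  by (rule integral_distr[symmetric, OF sample_measurable[OF assms(1)] assms(3)])

lemma expectation_single:
  assumes "i \<ge> 1" and [measurable]: "f \<in> borel_measurable S"
  shows "expectation (\<lambda>w. f (X i w)) = (LINT x|F. f x :: real)"
  unfolding ident[OF assms(1), symmetric]
  by (rule integral_distr[symmetric, OF X_measurable[OF assms(1)] assms(2)])

lemma indep_shifted: "indep_vars (\<lambda>_. S) (\<lambda>i. X (Suc i)) UNIV"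
proof -
  have sh: "(\<lambda>z. \<lambda>i\<in>UNIV. z (Suc i)) \<in> measurable (Pi\<^sub>M {1..} (\<lambda>_. S)) (Pi\<^sub>M UNIV (\<lambda>_. S))"
    by (intro measurable_restrict measurable_component_singleton) auto
  have "distr M (Pi\<^sub>M UNIV (\<lambda>_. S)) (\<lambda>w. \<lambda>i\<in>UNIV. X (Suc i) w)
      = distr (distr M (Pi\<^sub>M {1..} (\<lambda>_. S)) (\<lambda>w. \<lambda>j\<in>{1..}. X j w)) (Pi\<^sub>M UNIV (\<lambda>_. S)) (\<lambda>z. \<lambda>i\<in>UNIV. z (Suc i))"
    by (subst distr_distr[OF sh sample_measurable]) (auto simp: comp_def)
  also have "\<dots> = distr (Pi\<^sub>M {1..} (\<lambda>_. F)) (Pi\<^sub>M UNIV (\<lambda>_. F)) (\<lambda>z. \<lambda>i\<in>UNIV. z (Suc i))"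
    by (subst distr_sample) (auto intro!: distr_cong sets_PiM_F[symmetric])
  also have "\<dots> = Pi\<^sub>M UNIV (\<lambda>_. F)"
    by (rule distr_PiM_reindex) (auto intro: prob_space_F)
  also have "\<dots> = Pi\<^sub>M UNIV (\<lambda>i. distr M S (X (Suc i)))"
    by (simp add: ident)
  finally show ?thesis
    by (subst indep_vars_iff_distr_eq_PiM') (auto intro: X_measurable)
qed

end

locale bounded_kernel = iid_sample M S F X m
  for M :: "'w measure" and S F :: "'x measure" and X :: "nat \<Rightarrow> 'w \<Rightarrow> 'x" and m :: nat +
  fixes k :: "(nat \<Rightarrow> 'x) \<Rightarrow> real" and B :: real
  assumes k_measurable[measurable]: "k \<in> borel_measurable (Pi\<^sub>M {1..m} (\<lambda>_. S))"
    and k_bound: "\<And>z. \<bar>k z\<bar> \<le> B"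
    and k_sym: "symmetric_kernel S m k"
begin

abbreviation "\<theta> \<equiv> kernel_mean M X m k"
abbreviation "k1 \<equiv> hajek_term M X m k"
abbreviation "linear_part n w \<equiv> \<Sum>j\<in>{1..n}. k1 (X j w)"
abbreviation "projection_error n w \<equiv> u_stat X m k n w - \<theta> - real m / real n * linear_part n w"
abbreviation "scaled_error n w \<equiv> sqrt (real n) / real m * (u_stat X m k n w - \<theta>) - linear_part n w / sqrt (real n)"

lemma B_nonneg: "B \<ge> 0" using k_bound[of undefined] by linarith

lemma fun_upd_measurable:
  "(\<lambda>(s, z). z(1 := s)) \<in> measurable (S \<Otimes>\<^sub>M Pi\<^sub>M {1..m} (\<lambda>_. S)) (Pi\<^sub>M {1..m} (\<lambda>_. S))"
  unfolding case_prod_beta by (rule measurable_fun_upd[of _ "{1..m}"]) (use m_pos in auto)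

lemma k1_measurable[measurable]: "k1 \<in> borel_measurable S"
proof -
  have [measurable]: "(\<lambda>w. \<lambda>j\<in>{1..m}. X j w) \<in> measurable M (Pi\<^sub>M {1..m} (\<lambda>_. S))"
    by (rule sample_measurable) auto
  note [measurable] = fun_upd_measurable
  have "(\<lambda>(x, w). k ((\<lambda>(s, z). z(1 := s)) (x, \<lambda>j\<in>{1..m}. X j w))) \<in> borel_measurable (S \<Otimes>\<^sub>M M)"
    by measurable
  hence "(\<lambda>(x, w). k ((\<lambda>j\<in>{1..m}. X j w)(1 := x))) \<in> borel_measurable (S \<Otimes>\<^sub>M M)" by simp
  hence "(\<lambda>x. LINT w|M. k ((\<lambda>j\<in>{1..m}. X j w)(1 := x))) \<in> borel_measurable S"
    by (rule borel_measurable_lebesgue_integral)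
  thus ?thesis unfolding hajek_term_def by measurable
qed

lemma k1_bound: "\<bar>k1 x\<bar> \<le> 2 * B"
proof -
  have "\<bar>LINT w|M. k ((\<lambda>j\<in>{1..m}. X j w)(1 := x))\<bar> \<le> B" "\<bar>\<theta>\<bar> \<le> B"
    unfolding kernel_mean_def by (rule abs_expectation_bound[OF prob_space_axioms k_bound])+
  thus ?thesis unfolding hajek_term_def by linarith
qed

text \<open>
  Integrating over all arguments but the first gives the same value whichever
  distinct sample points \<open>q 2, \<dots>, q m\<close> are inserted, because the coordinates are independent and
  identically distributed.
\<close>

lemma conditional_mean_on_remaining_coordinates:
  fixes q :: "nat \<Rightarrow> nat"
  assumes s: "s \<in> space S" and q: "inj_on q {2..m}"
  shows "(LINT y|Pi\<^sub>M (q ` {2..m}) (\<lambda>_. F). k ((\<lambda>l\<in>{2..m}. y (q l))(1 := s))) = k1 s + \<theta>"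
proof -
  have m1: "{1..m} = {2..m} \<union> {1}" using m_pos by auto
  have [measurable]: "(\<lambda>v. v(1 := s)) \<in> measurable (Pi\<^sub>M {2..m} (\<lambda>_. S)) (Pi\<^sub>M {1..m} (\<lambda>_. S))"
    by (rule measurable_fun_upd[of _ "{2..m}"]) (use m1 s in auto)
  have kv: "(\<lambda>v. k (v(1 := s))) \<in> borel_measurable (Pi\<^sub>M {2..m} (\<lambda>_. F))"
    unfolding measurable_PiM_F by measurable
  have reindex: "distr (Pi\<^sub>M J (\<lambda>_. F)) (Pi\<^sub>M {2..m} (\<lambda>_. F)) (\<lambda>y. \<lambda>l\<in>{2..m}. y (r l)) = Pi\<^sub>M {2..m} (\<lambda>_. F)"
    if "inj_on r {2..m}" "r ` {2..m} \<subseteq> J" for r :: "nat \<Rightarrow> nat" and J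
    using distr_PiM_reindex[of J "\<lambda>_. F" r "{2..m}"] that prob_space_F by auto
  have ints: "(LINT y|Pi\<^sub>M J (\<lambda>_. F). k ((\<lambda>l\<in>{2..m}. y (r l))(1 := s))) = (LINT v|Pi\<^sub>M {2..m} (\<lambda>_. F). k (v(1 := s)))"
    if "inj_on r {2..m}" "r ` {2..m} \<subseteq> J" for r :: "nat \<Rightarrow> nat" and J
  proof -
    have "(\<lambda>y. \<lambda>l\<in>{2..m}. y (r l)) \<in> measurable (Pi\<^sub>M J (\<lambda>_. F)) (Pi\<^sub>M {2..m} (\<lambda>_. F))"
      using that(2) by (intro measurable_restrict measurable_component_singleton) auto
    from integral_distr[OF this kv] show ?thesis unfolding reindex[OF that] by simp
  qed
  have "k1 s + \<theta> = (LINT w|M. k ((\<lambda>j\<in>{1..m}. X j w)(1 := s)))"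
    by (simp add: hajek_term_def)
  also have "\<dots> = (LINT z|Pi\<^sub>M {1..m} (\<lambda>_. F). k (z(1 := s)))"
  proof (rule expectation_sample)
    have "(\<lambda>z. z(1 := s)) \<in> measurable (Pi\<^sub>M {1..m} (\<lambda>_. S)) (Pi\<^sub>M {1..m} (\<lambda>_. S))"
      by (rule measurable_fun_upd[of _ "{1..m}"]) (use m_pos s in auto)
    thus "(\<lambda>z. k (z(1 := s))) \<in> borel_measurable (Pi\<^sub>M {1..m} (\<lambda>_. S))" by measurable
  qed (use m_pos in auto)
  also have "\<dots> = (LINT z|Pi\<^sub>M {1..m} (\<lambda>_. F). k ((\<lambda>l\<in>{2..m}. z l)(1 := s)))"
  proof (intro Bochner_Integration.integral_cong refl arg_cong[where f=k] ext)
    fix z l assume "z \<in> space (Pi\<^sub>M {1..m} (\<lambda>_. F))"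
    hence "z \<in> extensional {1..m}" by (simp add: space_PiM PiE_def)
    thus "(z(1 := s)) l = ((\<lambda>l\<in>{2..m}. z l)(1 := s)) l"
      by (auto simp: extensional_def)
  qed
  also have "\<dots> = (LINT v|Pi\<^sub>M {2..m} (\<lambda>_. F). k (v(1 := s)))"
    by (rule ints[of "\<lambda>l. l"]) auto
  finally show ?thesis using ints[OF q] by simp
qed

lemma k1_mean_zero: "(LINT x|F. k1 x) = 0"
proof -
  have m1: "{1..m} = {1} \<union> {2..m}" using m_pos by auto
  have "\<theta> = (LINT z|Pi\<^sub>M {1..m} (\<lambda>_. F). k z)"
    unfolding kernel_mean_def by (rule expectation_sample) (use m_pos in auto)
  also have "\<dots> = (LINT x|Pi\<^sub>M {1::nat} (\<lambda>_. F). LINT y|Pi\<^sub>M {2..m} (\<lambda>_. F). k (merge {1} {2..m} (x, y)))"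
    unfolding m1
  proof (rule PF.product_integral_fold)
    show "integrable (Pi\<^sub>M ({1} \<union> {2..m}) (\<lambda>_. F)) k"
      unfolding m1[symmetric]
      by (rule integrable_bounded_comp[OF _ _ k_bound])
         (auto simp: measurable_PiM_F intro!: prob_space_PiM prob_space_F prob_space.finite_measure)
  qed auto
  also have "\<dots> = (LINT x|Pi\<^sub>M {1::nat} (\<lambda>_. F). k1 (x 1) + \<theta>)"
  proof (intro Bochner_Integration.integral_cong refl)
    fix x :: "nat \<Rightarrow> 'x" assume "x \<in> space (Pi\<^sub>M {1::nat} (\<lambda>_. F))"
    hence x: "x 1 \<in> space S" by (auto simp: space_PiM PiE_def space_F)
    have "k (merge {1} {2..m} (x, y)) = k ((\<lambda>l\<in>{2..m}. y l)(1 := x 1))" for y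
      by (intro arg_cong[where f=k] ext) (auto simp: merge_def)
    thus "(LINT y|Pi\<^sub>M {2..m} (\<lambda>_. F). k (merge {1} {2..m} (x, y))) = k1 (x 1) + \<theta>"
      using conditional_mean_on_remaining_coordinates[OF x, of "\<lambda>l. l"] by simp
  qed
  also have "\<dots> = (LINT x|F. k1 x + \<theta>)"
    by (rule PF.product_integral_singleton[where f="\<lambda>s. k1 s + \<theta>"]) measurable
  also have "\<dots> = (LINT x|F. k1 x) + \<theta>"
    using integrable_bounded_comp[OF F.finite_measure_axioms, of k1, OF _ k1_bound]
    by (simp add: F.prob_space)
  finally show ?thesis by simp
qed

text \<open>
  The sum of the terms of order two and higher in the Hoeffding decomposition of the kernel, taken
  at the tuple \<open>i\<close>.
\<close>

definition residual :: "(nat \<Rightarrow> nat) \<Rightarrow> (nat \<Rightarrow> 'x) \<Rightarrow> real" where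
  "residual i z = k (\<lambda>l\<in>{1..m}. z (i l)) - \<theta> - (\<Sum>l\<in>{1..m}. k1 (z (i l)))"

lemma residual_bound: "\<bar>residual i z\<bar> \<le> (2 + 2 * real m) * B"
proof -
  have "\<bar>\<Sum>l\<in>{1..m}. k1 (z (i l))\<bar> \<le> (\<Sum>l\<in>{1..m}. \<bar>k1 (z (i l))\<bar>)" by (rule sum_abs)
  also have "\<dots> \<le> real (card {1..m}) * (2 * B)" by (rule sum_bounded_above) (rule k1_bound)
  finally have "\<bar>\<Sum>l\<in>{1..m}. k1 (z (i l))\<bar> \<le> real m * (2 * B)" by simp
  moreover have "\<bar>\<theta>\<bar> \<le> B"
    unfolding kernel_mean_def by (rule abs_expectation_bound[OF prob_space_axioms k_bound])
  ultimately show ?thesis using k_bound[of "\<lambda>l\<in>{1..m}. z (i l)"]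
    unfolding residual_def by (simp add: algebra_simps)
qed

lemma residual_measurable:
  assumes "\<And>l. l \<in> {1..m} \<Longrightarrow> i l \<in> I"
  shows "residual i \<in> borel_measurable (Pi\<^sub>M I (\<lambda>_. S))"
proof -
  have [measurable]: "(\<lambda>z. \<lambda>l\<in>{1..m}. z (i l)) \<in> measurable (Pi\<^sub>M I (\<lambda>_. S)) (Pi\<^sub>M {1..m} (\<lambda>_. S))"
    using assms by (intro measurable_restrict measurable_component_singleton) auto
  have [measurable]: "(\<lambda>z. z (i l)) \<in> measurable (Pi\<^sub>M I (\<lambda>_. S)) S" if "l \<in> {1..m}" for l
    using assms[OF that] by (rule measurable_component_singleton)
  have "(\<lambda>z. \<Sum>l\<in>{1..m}. k1 (z (i l))) \<in> borel_measurable (Pi\<^sub>M I (\<lambda>_. S))"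
    by (intro borel_measurable_sum) measurable
  thus ?thesis unfolding residual_def[abs_def] by measurable
qed

text \<open>
  The conditional mean of a residual given any one of its coordinates vanishes. By symmetry of the
  kernel this coordinate may be taken to be the first argument; then the kernel
  contributes its projection at that coordinate, and the projections at the other coordinates integrate to zero.
\<close>

lemma residual_partial_mean_zero:
  assumes i: "inj_on i {1..m}" and l0: "l0 \<in> {1..m}"
    and I: "I \<inter> (i ` {1..m} - {i l0}) = {}" "i l0 \<in> I" and x: "x \<in> space (Pi\<^sub>M I (\<lambda>_. F))"
  shows "(LINT y|Pi\<^sub>M (i ` {1..m} - {i l0}) (\<lambda>_. F).
            residual i (merge I (i ` {1..m} - {i l0}) (x, y))) = 0"
proof -
  define J where "J = i ` {1..m} - {i l0}"
  define s where "s = x (i l0)"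
  have s: "s \<in> space S" using x I(2) by (auto simp: s_def space_PiM space_F)
  interpret J: prob_space "Pi\<^sub>M J (\<lambda>_. F)" by (intro prob_space_PiM prob_space_F)
  \<comment> \<open>by symmetry the distinguished coordinate may be moved to the first place\<close>
  define p where "p = Transposition.transpose 1 l0"
  have p: "p permutes {1..m}" unfolding p_def using l0 m_pos by (intro permutes_swap_id) auto
  have p1: "p 1 = l0" by (simp add: p_def)
  define q where "q = i \<circ> p"
  have qinj: "inj_on q {1..m}"
    unfolding q_def using i p by (intro comp_inj_on) (auto simp: permutes_image intro: permutes_inj_on)
  have q1: "q 1 = i l0" by (simp add: q_def p1)
  have qim: "q ` {2..m} = J"
  proof -
    have "q ` {1..m} = i ` {1..m}" unfolding q_def image_comp[symmetric] permutes_image[OF p] ..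
    moreover have "{2..m} = {1..m} - {1}" by auto
    moreover have "q ` ({1..m} - {1}) = q ` {1..m} - q ` {1}"
      by (rule inj_on_image_set_diff[OF qinj]) (use m_pos in auto)
    ultimately show ?thesis by (simp add: J_def q1)
  qed
  have main: "(LINT y|Pi\<^sub>M J (\<lambda>_. F). k (\<lambda>l\<in>{1..m}. merge I J (x, y) (i l))) = k1 s + \<theta>"
  proof -
    have "k (\<lambda>l\<in>{1..m}. merge I J (x, y) (i l)) = k ((\<lambda>l\<in>{2..m}. y (q l))(1 := s))"
      if y: "y \<in> space (Pi\<^sub>M J (\<lambda>_. F))" for y
    proof -
      let ?u = "\<lambda>l\<in>{1..m}. merge I J (x, y) (i l)"
      have mem: "merge I J (x, y) (i l) \<in> space S" if "l \<in> {1..m}" for l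
        using x y that I by (cases "i l = i l0") (auto simp: merge_def space_PiM space_F J_def PiE_def)
      hence "?u \<in> space (Pi\<^sub>M {1..m} (\<lambda>_. S))" by (auto simp: space_PiM)
      hence "k ?u = k (?u \<circ> p)" using k_sym p by (simp add: symmetric_kernel_def)
      also have "?u \<circ> p = (\<lambda>l\<in>{2..m}. y (q l))(1 := s)"
      proof
        fix l
        consider "l = 1" | "l \<in> {2..m}" | "l \<notin> {1..m}" by force
        thus "(?u \<circ> p) l = ((\<lambda>l\<in>{2..m}. y (q l))(1 := s)) l"
        proof cases
          case 1
          thus ?thesis using l0 I by (simp add: p1 merge_def s_def)
        next
          case 2
          hence "q l \<in> J" using qim by auto
          hence "q l \<notin> I" "q l \<in> J" using I by (auto simp: J_def)
          moreover have "p l \<in> {1..m}" using permutes_in_image[OF p, of l] 2 by auto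
          ultimately show ?thesis using 2 by (simp add: merge_def q_def)
        next
          case 3
          hence "p l = l" using p by (simp add: permutes_def)
          thus ?thesis using 3 m_pos by auto
        qed
      qed
      finally show ?thesis .
    qed
    hence "(LINT y|Pi\<^sub>M J (\<lambda>_. F). k (\<lambda>l\<in>{1..m}. merge I J (x, y) (i l)))
        = (LINT y|Pi\<^sub>M (q ` {2..m}) (\<lambda>_. F). k ((\<lambda>l\<in>{2..m}. y (q l))(1 := s)))"
      unfolding qim by (intro Bochner_Integration.integral_cong refl)
    also have "\<dots> = k1 s + \<theta>"
      by (rule conditional_mean_on_remaining_coordinates[OF s]) (rule inj_on_subset[OF qinj], auto)
    finally show ?thesis .
  qed
  have lin: "(LINT y|Pi\<^sub>M J (\<lambda>_. F). k1 (merge I J (x, y) (i l))) = (if l = l0 then k1 s else 0)"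
    and lin_int: "integrable (Pi\<^sub>M J (\<lambda>_. F)) (\<lambda>y. k1 (merge I J (x, y) (i l)))" if l: "l \<in> {1..m}" for l
  proof -
    have "(LINT y|Pi\<^sub>M J (\<lambda>_. F). k1 (merge I J (x, y) (i l))) = (if l = l0 then k1 s else 0)
      \<and> integrable (Pi\<^sub>M J (\<lambda>_. F)) (\<lambda>y. k1 (merge I J (x, y) (i l)))"
    proof (cases "l = l0")
      case True
      thus ?thesis using I by (simp add: merge_def s_def J.prob_space)
    next
      case False
      hence lJ: "i l \<in> J" using l inj_on_eq_iff[OF i l l0] by (simp add: J_def)
      hence mg: "merge I J (x, y) (i l) = y (i l)" for y using I by (auto simp: merge_def J_def)
      have [measurable]: "(\<lambda>y. y (i l)) \<in> measurable (Pi\<^sub>M J (\<lambda>_. F)) F"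
        using lJ by (rule measurable_component_singleton)
      have "distr (Pi\<^sub>M J (\<lambda>_. F)) F (\<lambda>y. y (i l)) = F"
        by (rule distr_PiM_component) (use lJ prob_space_F in auto)
      hence "(LINT y|Pi\<^sub>M J (\<lambda>_. F). k1 (y (i l))) = (LINT s|F. k1 s)"
        using integral_distr[of "\<lambda>y. y (i l)" "Pi\<^sub>M J (\<lambda>_. F)" F k1] by simp
      moreover have "integrable (Pi\<^sub>M J (\<lambda>_. F)) (\<lambda>y. k1 (y (i l)))"
      proof (rule integrable_bounded_comp[OF J.finite_measure_axioms _ k1_bound])
        have "k1 \<in> borel_measurable F" by measurable
        thus "(\<lambda>y. k1 (y (i l))) \<in> borel_measurable (Pi\<^sub>M J (\<lambda>_. F))"
          by (rule measurable_compose[rotated]) measurable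
      qed
      ultimately show ?thesis using False by (simp add: mg k1_mean_zero)
    qed
    thus "(LINT y|Pi\<^sub>M J (\<lambda>_. F). k1 (merge I J (x, y) (i l))) = (if l = l0 then k1 s else 0)"
      "integrable (Pi\<^sub>M J (\<lambda>_. F)) (\<lambda>y. k1 (merge I J (x, y) (i l)))" by auto
  qed
  have kint: "integrable (Pi\<^sub>M J (\<lambda>_. F)) (\<lambda>y. k (\<lambda>l\<in>{1..m}. merge I J (x, y) (i l)))"
  proof (rule integrable_bounded_comp[OF J.finite_measure_axioms _ k_bound])
    have "(\<lambda>y. merge I J (x, y) (i l)) \<in> measurable (Pi\<^sub>M J (\<lambda>_. F)) S" if "l \<in> {1..m}" for l
    proof (cases "l = l0")
      case True thus ?thesis using I s by (simp add: merge_def s_def)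
    next
      case False
      hence lJ: "i l \<in> J" using that inj_on_eq_iff[OF i that l0] by (simp add: J_def)
      hence "merge I J (x, y) (i l) = y (i l)" for y using I by (auto simp: merge_def J_def)
      thus ?thesis using measurable_component_singleton[OF lJ, of "\<lambda>_. S"] by (simp add: measurable_PiM_F)
    qed
    hence "(\<lambda>y. \<lambda>l\<in>{1..m}. merge I J (x, y) (i l)) \<in> measurable (Pi\<^sub>M J (\<lambda>_. F)) (Pi\<^sub>M {1..m} (\<lambda>_. S))"
      by (intro measurable_restrict)
    thus "(\<lambda>y. k (\<lambda>l\<in>{1..m}. merge I J (x, y) (i l))) \<in> borel_measurable (Pi\<^sub>M J (\<lambda>_. F))"
      by measurable
  qed
  have lin_sum: "integrable (Pi\<^sub>M J (\<lambda>_. F)) (\<lambda>y. \<Sum>l\<in>{1..m}. k1 (merge I J (x, y) (i l)))"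
    by (rule Bochner_Integration.integrable_sum) (rule lin_int)
  have "(LINT y|Pi\<^sub>M J (\<lambda>_. F). (\<Sum>l\<in>{1..m}. k1 (merge I J (x, y) (i l))))
      = (\<Sum>l\<in>{1..m}. LINT y|Pi\<^sub>M J (\<lambda>_. F). k1 (merge I J (x, y) (i l)))"
    by (rule Bochner_Integration.integral_sum) (rule lin_int)
  also have "\<dots> = (\<Sum>l\<in>{1..m}. if l = l0 then k1 s else 0)"
    by (intro sum.cong refl lin)
  finally have lin_mean: "(LINT y|Pi\<^sub>M J (\<lambda>_. F). (\<Sum>l\<in>{1..m}. k1 (merge I J (x, y) (i l))))
      = (\<Sum>l\<in>{1..m}. if l = l0 then k1 s else 0)" .
  have "(LINT y|Pi\<^sub>M J (\<lambda>_. F). residual i (merge I J (x, y)))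
      = (LINT y|Pi\<^sub>M J (\<lambda>_. F). k (\<lambda>l\<in>{1..m}. merge I J (x, y) (i l)) - \<theta>)
        - (LINT y|Pi\<^sub>M J (\<lambda>_. F). (\<Sum>l\<in>{1..m}. k1 (merge I J (x, y) (i l))))"
    unfolding residual_def
    by (rule Bochner_Integration.integral_diff) (use kint lin_sum in auto)
  also have "\<dots> = (k1 s + \<theta>) - \<theta> - (\<Sum>l\<in>{1..m}. if l = l0 then k1 s else 0)"
    unfolding lin_mean main[symmetric] using kint by (simp add: J.prob_space)
  also have "\<dots> = 0" using l0 by simp
  finally show ?thesis by (simp add: J_def)
qed

text \<open>
  If two tuples share at most one index, integrate first over the coordinates that only \<open>i\<close> uses, apart from
  the common one: the second residual does not depend on them, and the first one
  integrates to zero.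
\<close>

lemma residuals_uncorrelated:
  assumes i: "i \<in> index_tuples m n" and i': "i' \<in> index_tuples m n"
    and few: "\<And>p q. p \<in> i ` {1..m} \<inter> i' ` {1..m} \<Longrightarrow> q \<in> i ` {1..m} \<inter> i' ` {1..m} \<Longrightarrow> p = q"
    and n: "1 \<le> n"
  shows "(LINT z|Pi\<^sub>M {1..n} (\<lambda>_. F). residual i z * residual i' z) = 0"
proof -
  \<comment> \<open>if the tuples are disjoint, any index of \<open>i\<close> can play the role of the common one\<close>
  have "\<exists>l0\<in>{1..m}. i ` {1..m} \<inter> i' ` {1..m} \<subseteq> {i l0}"
  proof (cases "i ` {1..m} \<inter> i' ` {1..m} = {}")
    case True thus ?thesis using m_pos by (intro bexI[of _ 1]) auto
  next
    case False thus ?thesis using few by blast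
  qed
  then obtain l0 where l0: "l0 \<in> {1..m}" "i ` {1..m} \<inter> i' ` {1..m} \<subseteq> {i l0}" by blast
  define J where "J = i ` {1..m} - {i l0}"
  define I where "I = {1..n} - J"
  have IJ: "{1..n} = I \<union> J" "I \<inter> J = {}"
    using index_tuples_range[OF i] by (auto simp: I_def J_def)
  have il0: "i l0 \<in> I" using index_tuples_range[OF i l0(1)] by (auto simp: I_def J_def)
  have sub: "i' l \<in> I" if "l \<in> {1..m}" for l
  proof -
    have "i' l \<in> i ` {1..m} \<Longrightarrow> i' l = i l0" using l0(2) that by blast
    thus ?thesis using index_tuples_range[OF i' that] by (auto simp: I_def J_def)
  qed
  have i'_merge: "residual i' (merge I J (x, y)) = residual i' x" for x y
  proof -
    have "merge I J (x, y) (i' l) = x (i' l)" if "l \<in> {1..m}" for l using sub[OF that] by (simp add: merge_def)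
    hence "(\<Sum>l\<in>{1..m}. k1 (merge I J (x, y) (i' l))) = (\<Sum>l\<in>{1..m}. k1 (x (i' l)))"
      "(\<lambda>l\<in>{1..m}. merge I J (x, y) (i' l)) = (\<lambda>l\<in>{1..m}. x (i' l))"
      by (auto intro!: sum.cong restrict_ext)
    thus ?thesis unfolding residual_def by simp
  qed
  have "(LINT z|Pi\<^sub>M {1..n} (\<lambda>_. F). residual i z * residual i' z)
      = (LINT x|Pi\<^sub>M I (\<lambda>_. F). LINT y|Pi\<^sub>M J (\<lambda>_. F).
          residual i (merge I J (x, y)) * residual i' (merge I J (x, y)))"
    unfolding IJ(1)
  proof (rule PF.product_integral_fold[OF IJ(2)])
    show "finite I" "finite J" by (auto simp: I_def J_def)
    show "integrable (Pi\<^sub>M (I \<union> J) (\<lambda>_. F)) (\<lambda>z. residual i z * residual i' z)"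
      unfolding IJ(1)[symmetric]
    proof (rule integrable_bounded_comp)
      show "finite_measure (Pi\<^sub>M {1..n} (\<lambda>_. F))"
        by (intro prob_space_PiM prob_space_F prob_space.finite_measure)
      show "(\<lambda>z. residual i z * residual i' z) \<in> borel_measurable (Pi\<^sub>M {1..n} (\<lambda>_. F))"
        unfolding measurable_PiM_F
        by (rule borel_measurable_times; rule residual_measurable)
           (erule index_tuples_range[OF i], erule index_tuples_range[OF i'])
      show "\<bar>residual i z * residual i' z\<bar> \<le> (2 + 2 * real m) * B * ((2 + 2 * real m) * B)" for z
        unfolding abs_mult by (intro mult_mono residual_bound) (use B_nonneg in auto)
    qed
  qed
  also have "\<dots> = (LINT x|Pi\<^sub>M I (\<lambda>_. F). 0)"
  proof (intro Bochner_Integration.integral_cong refl)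
    fix x assume x: "x \<in> space (Pi\<^sub>M I (\<lambda>_. F))"
    show "(LINT y|Pi\<^sub>M J (\<lambda>_. F). residual i (merge I J (x, y)) * residual i' (merge I J (x, y))) = 0"
    proof -
      have "(LINT y|Pi\<^sub>M J (\<lambda>_. F). residual i (merge I J (x, y))) = 0"
        using residual_partial_mean_zero[OF index_tuples_inj[OF i] l0(1) _ il0 x] IJ(2) by (simp add: J_def)
      thus ?thesis unfolding i'_merge by simp
    qed
  qed
  finally show ?thesis by simp
qed

lemma residual_sample:
  assumes "i \<in> index_tuples m n"
  shows "residual i (\<lambda>j\<in>{1..n}. X j w)
    = k (\<lambda>l\<in>{1..m}. X (i l) w) - \<theta> - (\<Sum>l\<in>{1..m}. k1 (X (i l) w))"
proof -
  have eq: "(\<lambda>j\<in>{1..n}. X j w) (i l) = X (i l) w" if "l \<in> {1..m}" for l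
    using index_tuples_range[OF assms that] by simp
  hence "(\<lambda>l\<in>{1..m}. (\<lambda>j\<in>{1..n}. X j w) (i l)) = (\<lambda>l\<in>{1..m}. X (i l) w)"
    "(\<Sum>l\<in>{1..m}. k1 ((\<lambda>j\<in>{1..n}. X j w) (i l))) = (\<Sum>l\<in>{1..m}. k1 (X (i l) w))"
    by (intro restrict_ext sum.cong refl; simp)+
  thus ?thesis unfolding residual_def by simp
qed

lemma u_stat_residual:
  assumes n: "m \<le> n"
  shows "projection_error n w
    = (\<Sum>i\<in>index_tuples m n. residual i (\<lambda>j\<in>{1..n}. X j w)) / real (n choose m)"
proof -
  define I where "I = index_tuples m n"
  have fI: "finite I" by (simp add: I_def finite_index_tuples)
  have N: "real (n choose m) > 0" "real n > 0" using n m_pos by auto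
  have "(\<Sum>i\<in>I. \<Sum>l\<in>{1..m}. k1 (X (i l) w)) = (\<Sum>i\<in>I. \<Sum>p\<in>{1..n}. if p \<in> i ` {1..m} then k1 (X p w) else 0)"
  proof (rule sum.cong[OF refl])
    fix i assume i: "i \<in> I"
    have "(\<Sum>l\<in>{1..m}. k1 (X (i l) w)) = (\<Sum>p\<in>i ` {1..m}. k1 (X p w))"
      using index_tuples_inj[of i m n] i by (simp add: sum.reindex I_def)
    also have "\<dots> = (\<Sum>p\<in>{1..n} \<inter> i ` {1..m}. k1 (X p w))"
      using index_tuples_range[of i m n] i by (intro sum.cong) (auto simp: I_def)
    also have "\<dots> = (\<Sum>p\<in>{1..n}. if p \<in> i ` {1..m} then k1 (X p w) else 0)"
      by (rule sum.inter_restrict) simp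
    finally show "(\<Sum>l\<in>{1..m}. k1 (X (i l) w)) = (\<Sum>p\<in>{1..n}. if p \<in> i ` {1..m} then k1 (X p w) else 0)" .
  qed
  also have "\<dots> = (\<Sum>p\<in>{1..n}. \<Sum>i\<in>I. if p \<in> i ` {1..m} then k1 (X p w) else 0)"
    by (rule sum.swap)
  also have "\<dots> = (\<Sum>p\<in>{1..n}. real m / real n * real (n choose m) * k1 (X p w))"
  proof (rule sum.cong[OF refl])
    fix p assume p: "p \<in> {1..n}"
    have "(\<Sum>i\<in>I. if p \<in> i ` {1..m} then k1 (X p w) else 0) = real (card {i\<in>I. p \<in> i ` {1..m}}) * k1 (X p w)"
      using fI by (simp add: sum.If_cases Int_def conj_commute)
    moreover have "real (card {i\<in>I. p \<in> i ` {1..m}}) = real m / real n * real (n choose m)"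
      using card_index_tuples_containing_point[OF m_pos p] N by (simp add: I_def field_simps)
    ultimately show "(\<Sum>i\<in>I. if p \<in> i ` {1..m} then k1 (X p w) else 0)
      = real m / real n * real (n choose m) * k1 (X p w)" by simp
  qed
  finally have lin: "(\<Sum>i\<in>I. \<Sum>l\<in>{1..m}. k1 (X (i l) w))
      = real m / real n * real (n choose m) * (\<Sum>p\<in>{1..n}. k1 (X p w))"
    by (simp only: sum_distrib_left)
  have "(\<Sum>i\<in>I. residual i (\<lambda>j\<in>{1..n}. X j w))
      = (\<Sum>i\<in>I. k (\<lambda>l\<in>{1..m}. X (i l) w) - \<theta> - (\<Sum>l\<in>{1..m}. k1 (X (i l) w)))"
    by (intro sum.cong refl residual_sample) (simp add: I_def)
  also have "\<dots> = (\<Sum>i\<in>I. k (\<lambda>l\<in>{1..m}. X (i l) w)) - real (n choose m) * \<theta>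
      - real m / real n * real (n choose m) * (\<Sum>p\<in>{1..n}. k1 (X p w))"
    by (simp add: sum_subtractf lin) (simp add: I_def card_index_tuples)
  finally show ?thesis
    using N by (simp add: u_stat_def I_def diff_divide_distrib)
qed

lemma sample_point_measurable: "i \<in> index_tuples m n \<Longrightarrow>
  (\<lambda>w. k (\<lambda>l\<in>{1..m}. X (i l) w)) \<in> borel_measurable M"
  by (rule measurable_compose[OF _ k_measurable], intro measurable_restrict X_measurable)
     (use index_tuples_range in force)

lemma u_stat_measurable[measurable]: "u_stat X m k n \<in> borel_measurable M"
  unfolding u_stat_def[abs_def]
  by (intro borel_measurable_divide borel_measurable_sum sample_point_measurable) auto

lemma k1_X_measurable: "j \<in> {1..n} \<Longrightarrow> (\<lambda>w. k1 (X j w)) \<in> borel_measurable M"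
  by (rule measurable_compose[OF X_measurable k1_measurable]) simp

text \<open>
  A union bound over the at most \<open>m\<^sup>2\<close> pairs of indices in \<open>i\<close>.
\<close>

lemma count_pairs_sharing_two:
  assumes n: "2 \<le> n" and i: "i \<in> index_tuples m n"
  shows "real (card {i'\<in>index_tuples m n. share_two m i i'})
    \<le> real m ^ 4 * real (n choose m) / (real n * (real n - 1))"
proof -
  define A where "A = i ` {1..m}"
  have A: "finite A" "card A \<le> m" "A \<subseteq> {1..n}"
    using card_image_le[of "{1..m}" i] index_tuples_range[OF i] by (auto simp: A_def)
  define Q where "Q = {(p, q) \<in> A \<times> A. p \<noteq> q}"
  have Q: "finite Q" "card Q \<le> m * m"
  proof -
    have "Q \<subseteq> A \<times> A" by (auto simp: Q_def)
    with A(1) show "finite Q" by (meson finite_SigmaI finite_subset)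
    have "card Q \<le> card (A \<times> A)" using A(1) \<open>Q \<subseteq> A \<times> A\<close> by (intro card_mono) auto
    also have "\<dots> \<le> m * m" using A(2) by (simp add: card_cartesian_product mult_le_mono)
    finally show "card Q \<le> m * m" .
  qed
  define c where "c = (real m)\<^sup>2 * real (n choose m) / (real n * (real n - 1))"
  have pos: "real n * (real n - 1) > 0" using n by simp
  have c0: "c \<ge> 0" using pos by (simp add: c_def)
  let ?S = "\<lambda>(p, q). {i'\<in>index_tuples m n. p \<in> i' ` {1..m} \<and> q \<in> i' ` {1..m}}"
  have cS: "real (card (?S x)) \<le> c" if "x \<in> Q" for x
  proof -
    obtain p q where x: "x = (p, q)" by (cases x)
    have pq: "p \<in> {1..n}" "q \<in> {1..n}" "p \<noteq> q" using that A(3) by (auto simp: Q_def x)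
    show ?thesis using card_index_tuples_containing_pair[OF pq, of m] pos
      by (simp add: x c_def pos_le_divide_eq mult.commute)
  qed
  have "{i'\<in>index_tuples m n. share_two m i i'} \<subseteq> (\<Union>x\<in>Q. ?S x)"
    by (auto simp: Q_def A_def)
  hence "card {i'\<in>index_tuples m n. share_two m i i'} \<le> card (\<Union>x\<in>Q. ?S x)"
    by (rule card_mono[rotated]) (use Q(1) in \<open>auto intro: finite_subset[OF _ finite_index_tuples[of m n]]\<close>)
  also have "\<dots> \<le> (\<Sum>x\<in>Q. card (?S x))" by (rule card_UN_le[OF Q(1)])
  finally have "real (card {i'\<in>index_tuples m n. share_two m i i'})
      \<le> real (\<Sum>x\<in>Q. card (?S x))" by (rule of_nat_mono)
  also have "\<dots> = (\<Sum>x\<in>Q. real (card (?S x)))" by simp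
  also have "\<dots> \<le> real (card Q) * c" by (rule sum_bounded_above) (rule cS)
  also have "\<dots> \<le> real (m * m) * c" using Q(2) c0 by (intro mult_right_mono of_nat_mono)
  also have "\<dots> = real m ^ 4 * real (n choose m) / (real n * (real n - 1))"
    by (simp add: c_def power2_eq_square power4_eq_xxxx)
  finally show ?thesis .
qed

text \<open>
  In the expansion of the square only the pairs of tuples with two common indices
  survive. Their proportion among all pairs is of order \<open>1 / n\<^sup>2\<close>.
\<close>

lemma hajek_projection_error:
  assumes n: "2 \<le> n" "m \<le> n"
  shows "expectation (\<lambda>w. (projection_error n w)\<^sup>2)
     \<le> ((2 + 2 * real m) * B)\<^sup>2 * real m ^ 4 / (real n * (real n - 1))"
proof -
  define I where "I = index_tuples m n"
  define N where "N = real (n choose m)"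
  define D where "D = (2 + 2 * real m) * B"
  have D0: "D \<ge> 0" using B_nonneg by (simp add: D_def)
  have fI: "finite I" and cI: "real (card I) = N"
    by (simp_all add: I_def N_def finite_index_tuples card_index_tuples)
  have N: "N > 0" using n by (simp add: N_def)
  have pos: "real n * (real n - 1) > 0" using n by simp
  interpret P: prob_space "Pi\<^sub>M {1..n} (\<lambda>_. F)" by (intro prob_space_PiM prob_space_F)
  have rm: "residual i \<in> borel_measurable (Pi\<^sub>M {1..n} (\<lambda>_. F))" if "i \<in> I" for i
    unfolding measurable_PiM_F
    by (rule residual_measurable) (use that index_tuples_range[of i m n] in \<open>auto simp: I_def\<close>)
  have prodm: "(\<lambda>z. residual i z * residual i' z) \<in> borel_measurable (Pi\<^sub>M {1..n} (\<lambda>_. F))"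
    if "i \<in> I" "i' \<in> I" for i i' using rm[OF that(1)] rm[OF that(2)] by simp
  have prodb: "\<bar>residual i z * residual i' z\<bar> \<le> D\<^sup>2" for i i' z
    unfolding abs_mult power2_eq_square D_def
    by (intro mult_mono residual_bound) (use B_nonneg in auto)
  have pint: "integrable (Pi\<^sub>M {1..n} (\<lambda>_. F)) (\<lambda>z. residual i z * residual i' z)"
    if "i \<in> I" "i' \<in> I" for i i'
    by (rule integrable_bounded_comp[OF P.finite_measure_axioms prodm[OF that] prodb])
  have cov: "(LINT z|Pi\<^sub>M {1..n} (\<lambda>_. F). residual i z * residual i' z) \<le> (if share_two m i i' then D\<^sup>2 else 0)"
    if "i \<in> I" "i' \<in> I" for i i'
  proof (cases "share_two m i i'")
    case True
    have "\<bar>LINT z|Pi\<^sub>M {1..n} (\<lambda>_. F). residual i z * residual i' z\<bar> \<le> D\<^sup>2"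
      by (rule abs_expectation_bound[OF P.prob_space_axioms prodb])
    thus ?thesis using True by simp
  next
    case False
    have "(LINT z|Pi\<^sub>M {1..n} (\<lambda>_. F). residual i z * residual i' z) = 0"
      by (rule residuals_uncorrelated) (use that False n in \<open>auto simp: I_def\<close>)
    thus ?thesis using False by simp
  qed
  have "expectation (\<lambda>w. (projection_error n w)\<^sup>2)
      = expectation (\<lambda>w. ((\<Sum>i\<in>I. residual i (\<lambda>j\<in>{1..n}. X j w)) / N)\<^sup>2)"
    unfolding u_stat_residual[OF n(2)] I_def N_def ..
  also have "\<dots> = (LINT z|Pi\<^sub>M {1..n} (\<lambda>_. F). ((\<Sum>i\<in>I. residual i z) / N)\<^sup>2)"
  proof (rule expectation_sample)
    show "(\<lambda>z. ((\<Sum>i\<in>I. residual i z) / N)\<^sup>2) \<in> borel_measurable (Pi\<^sub>M {1..n} (\<lambda>_. S))"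
      using rm unfolding measurable_PiM_F by (intro borel_measurable_power borel_measurable_divide borel_measurable_sum) auto
  qed (use n in auto)
  also have "\<dots> = (LINT z|Pi\<^sub>M {1..n} (\<lambda>_. F). (\<Sum>i\<in>I. \<Sum>i'\<in>I. residual i z * residual i' z) / N\<^sup>2)"
    by (simp add: power_divide power2_eq_square sum_product)
  also have "\<dots> = (\<Sum>i\<in>I. \<Sum>i'\<in>I. LINT z|Pi\<^sub>M {1..n} (\<lambda>_. F). residual i z * residual i' z) / N\<^sup>2"
  proof -
    have "(LINT z|Pi\<^sub>M {1..n} (\<lambda>_. F). (\<Sum>i\<in>I. \<Sum>i'\<in>I. residual i z * residual i' z))
        = (\<Sum>i\<in>I. \<Sum>i'\<in>I. LINT z|Pi\<^sub>M {1..n} (\<lambda>_. F). residual i z * residual i' z)"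
      by (rule integral_double_sum) (rule pint)
    thus ?thesis by simp
  qed
  also have "\<dots> \<le> (\<Sum>i\<in>I. \<Sum>i'\<in>I. if share_two m i i' then D\<^sup>2 else 0) / N\<^sup>2"
    by (intro divide_right_mono sum_mono cov) auto
  also have "\<dots> \<le> (\<Sum>i\<in>I. D\<^sup>2 * (real m ^ 4 * N / (real n * (real n - 1)))) / N\<^sup>2"
  proof (intro divide_right_mono sum_mono)
    fix i assume i: "i \<in> I"
    have "(\<Sum>i'\<in>I. if share_two m i i' then D\<^sup>2 else 0) = D\<^sup>2 * real (card {i'\<in>I. share_two m i i'})"
      using fI by (simp add: sum.If_cases Int_def conj_commute)
    also have "\<dots> \<le> D\<^sup>2 * (real m ^ 4 * N / (real n * (real n - 1)))"
      using count_pairs_sharing_two[OF n(1), of i] i by (intro mult_left_mono) (auto simp: I_def N_def)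
    finally show "(\<Sum>i'\<in>I. if share_two m i i' then D\<^sup>2 else 0) \<le> D\<^sup>2 * (real m ^ 4 * N / (real n * (real n - 1)))" .
  qed simp
  also have "\<dots> = D\<^sup>2 * real m ^ 4 / (real n * (real n - 1))"
  proof -
    have "N * (D\<^sup>2 * (r * N / d)) / N\<^sup>2 = D\<^sup>2 * r / d" if "d > 0" for r d
      using N that by (simp add: power2_eq_square)
    from this[OF pos] show ?thesis by (simp add: cI)
  qed
  finally show ?thesis by (simp add: D_def)
qed

lemma second_moment_sum_k1:
  "expectation (\<lambda>w. (linear_part n w)\<^sup>2) \<le> real n * (2 * B)\<^sup>2"
proof -
  have m: "(\<lambda>w. k1 (X j w)) \<in> borel_measurable M" if "j \<in> {1..n}" for j by (rule k1_X_measurable[OF that])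
  have bd: "\<bar>k1 x * k1 y\<bar> \<le> (2 * B)\<^sup>2" for x y
    unfolding abs_mult power2_eq_square by (intro mult_mono k1_bound) (use B_nonneg in auto)
  have int: "integrable M (\<lambda>w. k1 (X i w) * k1 (X j w))" if "i \<in> {1..n}" "j \<in> {1..n}" for i j
    by (rule integrable_bounded_comp[OF finite_measure_axioms _ bd]) (use m that in simp)
  have cov: "expectation (\<lambda>w. k1 (X i w) * k1 (X j w)) \<le> (if i = j then (2 * B)\<^sup>2 else 0)"
    if ij: "i \<in> {1..n}" "j \<in> {1..n}" for i j
  proof (cases "i = j")
    case True
    have "\<bar>expectation (\<lambda>w. k1 (X i w) * k1 (X j w))\<bar> \<le> (2 * B)\<^sup>2"
      by (rule abs_expectation_bound[OF prob_space_axioms bd])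
    thus ?thesis using True by simp
  next
    case False
    have "indep_vars (\<lambda>_. borel) (\<lambda>l w. k1 (X l w)) {i, j}"
    proof -
      have iX: "indep_vars (\<lambda>_. S) X {i, j}" by (rule indep_vars_subset[OF indep]) (use ij in auto)
      show ?thesis by (rule indep_vars_compose2[OF iX]) (rule k1_measurable)
    qed
    moreover have "integrable M (\<lambda>w. k1 (X l w))" if "l \<in> {i, j}" for l
      by (rule integrable_bounded_comp[OF finite_measure_axioms _ k1_bound]) (use m that ij in auto)
    ultimately have "expectation (\<lambda>w. \<Prod>l\<in>{i, j}. k1 (X l w)) = (\<Prod>l\<in>{i, j}. expectation (\<lambda>w. k1 (X l w)))"
      by (intro indep_vars_lebesgue_integral) auto
    moreover have "expectation (\<lambda>w. k1 (X i w)) = 0"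
      using expectation_single[of i k1] ij k1_mean_zero by simp
    ultimately show ?thesis using False by simp
  qed
  have "expectation (\<lambda>w. (linear_part n w)\<^sup>2)
      = expectation (\<lambda>w. \<Sum>i\<in>{1..n}. \<Sum>j\<in>{1..n}. k1 (X i w) * k1 (X j w))"
    by (simp add: power2_eq_square sum_product)
  also have "\<dots> = (\<Sum>i\<in>{1..n}. \<Sum>j\<in>{1..n}. expectation (\<lambda>w. k1 (X i w) * k1 (X j w)))"
    by (rule integral_double_sum) (rule int)
  also have "\<dots> \<le> (\<Sum>i\<in>{1..n}. \<Sum>j\<in>{1..n}. if i = j then (2 * B)\<^sup>2 else 0)"
    by (intro sum_mono cov)
  also have "\<dots> = real n * (2 * B)\<^sup>2" by simp
  finally show ?thesis .
qed

lemma u_stat_bound: "\<bar>u_stat X m k n w\<bar> \<le> B"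
proof -
  have "\<bar>\<Sum>i\<in>index_tuples m n. k (\<lambda>j\<in>{1..m}. X (i j) w)\<bar>
      \<le> (\<Sum>i\<in>index_tuples m n. \<bar>k (\<lambda>j\<in>{1..m}. X (i j) w)\<bar>)" by (rule sum_abs)
  also have "\<dots> \<le> real (card (index_tuples m n)) * B" by (rule sum_bounded_above) (rule k_bound)
  finally have le: "\<bar>\<Sum>i\<in>index_tuples m n. k (\<lambda>j\<in>{1..m}. X (i j) w)\<bar> \<le> B * real (n choose m)"
    by (simp add: card_index_tuples mult.commute)
  show ?thesis
  proof (cases "n choose m = 0")
    case True
    hence "u_stat X m k n w = 0" by (simp only: u_stat_def of_nat_0 div_by_0)
    thus ?thesis using B_nonneg by simp
  next
    case False
    thus ?thesis using le by (simp add: u_stat_def pos_divide_le_eq)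
  qed
qed

lemma sum_k1_integrable: "integrable M (\<lambda>w. (linear_part n w)\<^sup>2)"
proof (rule integrable_bounded_comp[OF finite_measure_axioms])
  show "(\<lambda>w. (linear_part n w)\<^sup>2) \<in> borel_measurable M"
    by (intro borel_measurable_power borel_measurable_sum k1_X_measurable)
  fix w
  have "\<bar>\<Sum>j\<in>{1..n}. k1 (X j w)\<bar> \<le> (\<Sum>j\<in>{1..n}. \<bar>k1 (X j w)\<bar>)" by (rule sum_abs)
  also have "\<dots> \<le> real (card {1..n}) * (2 * B)" by (rule sum_bounded_above) (rule k1_bound)
  finally have "\<bar>\<Sum>j\<in>{1..n}. k1 (X j w)\<bar> \<le> real n * (2 * B)" by simp
  from power_mono[OF this, of 2] show "\<bar>(linear_part n w)\<^sup>2\<bar> \<le> (real n * (2 * B))\<^sup>2" by simp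
qed

lemma error_integrable:
  "integrable M (\<lambda>w. (projection_error n w)\<^sup>2)"
proof (rule Bochner_Integration.integrable_bound)
  show "integrable M (\<lambda>w. 2 * (B + \<bar>\<theta>\<bar>)\<^sup>2 + 2 * ((real m / real n)\<^sup>2 * (linear_part n w)\<^sup>2))"
    using sum_k1_integrable[of n] by simp
  have [measurable]: "(\<lambda>w. \<Sum>j\<in>{1..n}. k1 (X j w)) \<in> borel_measurable M"
    by (intro borel_measurable_sum k1_X_measurable)
  show "(\<lambda>w. (projection_error n w)\<^sup>2) \<in> borel_measurable M"
    by measurable
  show "AE w in M. norm ((projection_error n w)\<^sup>2)
      \<le> norm (2 * (B + \<bar>\<theta>\<bar>)\<^sup>2 + 2 * ((real m / real n)\<^sup>2 * (linear_part n w)\<^sup>2))"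
  proof (rule AE_I2)
    fix w
    let ?x = "u_stat X m k n w - \<theta>" and ?y = "real m / real n * linear_part n w"
    have "(?x - ?y)\<^sup>2 \<le> 2 * ?x\<^sup>2 + 2 * ?y\<^sup>2"
      by (rule power2_diff_le)
    moreover have "?x\<^sup>2 \<le> (B + \<bar>\<theta>\<bar>)\<^sup>2"
      by (rule power2_le_iff_abs_le[THEN iffD2]) (use B_nonneg u_stat_bound[of n w] in linarith)+
    ultimately have "(?x - ?y)\<^sup>2 \<le> 2 * (B + \<bar>\<theta>\<bar>)\<^sup>2 + 2 * ?y\<^sup>2" by linarith
    thus "norm ((?x - ?y)\<^sup>2)
      \<le> norm (2 * (B + \<bar>\<theta>\<bar>)\<^sup>2 + 2 * ((real m / real n)\<^sup>2 * (linear_part n w)\<^sup>2))"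
      unfolding power_mult_distrib by simp
  qed
qed

lemma hajek_projection:
  "vanishes_in_prob M scaled_error"
proof (rule vanishes_in_prob_of_second_moment)
  define E where "E n w = projection_error n w" for n w
  have eq: "scaled_error n w
      = sqrt (real n) / real m * E n w" for n w
  proof -
    have "1 / sqrt (real n) = sqrt (real n) / real n" by (simp add: real_div_sqrt divide_simps)
    thus ?thesis using m_pos by (simp add: E_def right_diff_distrib) (simp add: divide_simps)
  qed
  have sq: "(scaled_error n w)\<^sup>2
      = real n / (real m)\<^sup>2 * (E n w)\<^sup>2" for n w
    unfolding eq by (simp add: power_mult_distrib power_divide)
  define D where "D = ((2 + 2 * real m) * B)\<^sup>2"
  show "(\<lambda>w. scaled_error n w) \<in> borel_measurable M" for n
  proof -
    have [measurable]: "(\<lambda>w. \<Sum>j\<in>{1..n}. k1 (X j w)) \<in> borel_measurable M"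
      by (intro borel_measurable_sum k1_X_measurable)
    show ?thesis by measurable
  qed
  show "integrable M (\<lambda>w. (scaled_error n w)\<^sup>2)" for n
    unfolding sq E_def using error_integrable[of n] by simp
  show "(\<lambda>n. expectation (\<lambda>w. (scaled_error n w)\<^sup>2)) \<longlonglongrightarrow> 0"
    unfolding sq
  proof (rule tendsto_sandwich[OF _ _ tendsto_const])
    show "eventually (\<lambda>n. 0 \<le> expectation (\<lambda>w. real n / (real m)\<^sup>2 * (E n w)\<^sup>2)) sequentially"
      by (intro always_eventually allI integral_nonneg) simp
    show "(\<lambda>n. D * (real m)\<^sup>2 / (real n - 1)) \<longlonglongrightarrow> 0" by real_asymp
    show "eventually (\<lambda>n. expectation (\<lambda>w. real n / (real m)\<^sup>2 * (E n w)\<^sup>2) \<le> D * (real m)\<^sup>2 / (real n - 1)) sequentially"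
    proof (rule eventually_sequentiallyI[of "max 2 m"])
      fix n assume n: "max 2 m \<le> n"
      have n1: "real n > 0" "real n - 1 > 0" using n by auto
      have "expectation (\<lambda>w. real n / (real m)\<^sup>2 * (E n w)\<^sup>2) = real n / (real m)\<^sup>2 * expectation (\<lambda>w. (E n w)\<^sup>2)"
        by simp
      also have "\<dots> \<le> real n / (real m)\<^sup>2 * (D * real m ^ 4 / (real n * (real n - 1)))"
        using hajek_projection_error[of n] n by (intro mult_left_mono) (auto simp: E_def D_def)
      also have "\<dots> = D * (real m)\<^sup>2 / (real n - 1)"
        using n1 m_pos by (simp add: power2_eq_square power4_eq_xxxx)
      finally show "expectation (\<lambda>w. real n / (real m)\<^sup>2 * (E n w)\<^sup>2) \<le> D * (real m)\<^sup>2 / (real n - 1)" .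
    qed
  qed
qed

lemma u_stat_second_moment:
  obtains C where "\<And>n. max 2 m \<le> n \<Longrightarrow> expectation (\<lambda>w. (sqrt (real n) * (u_stat X m k n w - \<theta>))\<^sup>2) \<le> C"
proof
  fix n assume n: "max 2 m \<le> n"
  define D where "D = ((2 + 2 * real m) * B)\<^sup>2"
  have D0: "D \<ge> 0" by (simp add: D_def)
  define E where "E w = projection_error n w" for w
  define Y where "Y w = linear_part n w" for w
  have n1: "real n > 0" "real n - 1 \<ge> 1" using n by auto
  have intE: "integrable M (\<lambda>w. (E w)\<^sup>2)" unfolding E_def by (rule error_integrable)
  have intY: "integrable M (\<lambda>w. (Y w)\<^sup>2)" unfolding Y_def by (rule sum_k1_integrable)
  have pointwise: "(sqrt (real n) * (u_stat X m k n w - \<theta>))\<^sup>2 \<le> 2 * real n * (E w)\<^sup>2 + 2 * (real m)\<^sup>2 / real n * (Y w)\<^sup>2" for w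
  proof -
    let ?y = "real m / real n * Y w"
    have "u_stat X m k n w - \<theta> = E w + ?y" by (simp add: E_def Y_def)
    moreover have "(E w + ?y)\<^sup>2 \<le> 2 * (E w)\<^sup>2 + 2 * ?y\<^sup>2"
      using zero_le_power2[of "E w - ?y"] by (simp add: power2_sum power2_diff)
    ultimately have "(sqrt (real n) * (u_stat X m k n w - \<theta>))\<^sup>2 \<le> real n * (2 * (E w)\<^sup>2 + 2 * ?y\<^sup>2)"
      by (simp add: power_mult_distrib mult_left_mono)
    also have "\<dots> = 2 * real n * (E w)\<^sup>2 + 2 * (real m)\<^sup>2 / real n * (Y w)\<^sup>2"
      using n1 by (simp add: power_mult_distrib power_divide power2_eq_square field_simps)
    finally show ?thesis .
  qed
  have "expectation (\<lambda>w. (sqrt (real n) * (u_stat X m k n w - \<theta>))\<^sup>2)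
      \<le> expectation (\<lambda>w. 2 * real n * (E w)\<^sup>2 + 2 * (real m)\<^sup>2 / real n * (Y w)\<^sup>2)"
  proof (rule integral_mono)
    show int: "integrable M (\<lambda>w. 2 * real n * (E w)\<^sup>2 + 2 * (real m)\<^sup>2 / real n * (Y w)\<^sup>2)"
      using intE intY by simp
    show "integrable M (\<lambda>w. (sqrt (real n) * (u_stat X m k n w - \<theta>))\<^sup>2)"
      by (rule Bochner_Integration.integrable_bound[OF int])
         (use pointwise in \<open>auto intro!: AE_I2 order_trans[OF _ abs_ge_self]\<close>)
  qed (rule pointwise)
  also have "\<dots> = 2 * real n * expectation (\<lambda>w. (E w)\<^sup>2) + 2 * (real m)\<^sup>2 / real n * expectation (\<lambda>w. (Y w)\<^sup>2)"
    using intE intY by simp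
  also have "\<dots> \<le> 2 * real n * (D * real m ^ 4 / (real n * (real n - 1))) + 2 * (real m)\<^sup>2 / real n * (real n * (2 * B)\<^sup>2)"
    using hajek_projection_error[of n] second_moment_sum_k1[of n] n
    by (intro add_mono mult_left_mono) (auto simp: E_def Y_def D_def)
  also have "\<dots> = 2 * (D * real m ^ 4 / (real n - 1)) + 2 * (real m)\<^sup>2 * (2 * B)\<^sup>2"
    using n1 by simp
  also have "\<dots> \<le> 2 * (D * real m ^ 4) + 2 * (real m)\<^sup>2 * (2 * B)\<^sup>2"
    using divide_left_mono[of 1 "real n - 1" "D * real m ^ 4"] n1 D0 by simp
  finally show "expectation (\<lambda>w. (sqrt (real n) * (u_stat X m k n w - \<theta>))\<^sup>2)
      \<le> 2 * (((2 + 2 * real m) * B)\<^sup>2 * real m ^ 4) + 2 * (real m)\<^sup>2 * (2 * B)\<^sup>2" by (simp only: D_def)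
qed

lemma u_stat_square_integrable: "integrable M (\<lambda>w. (sqrt (real n) * (u_stat X m k n w - \<theta>))\<^sup>2)"
proof (rule integrable_bounded_comp[OF finite_measure_axioms])
  fix w
  have "(u_stat X m k n w - \<theta>)\<^sup>2 \<le> (B + \<bar>\<theta>\<bar>)\<^sup>2"
    by (rule power2_le_iff_abs_le[THEN iffD2]) (use B_nonneg u_stat_bound[of n w] in linarith)+
  thus "\<bar>(sqrt (real n) * (u_stat X m k n w - \<theta>))\<^sup>2\<bar> \<le> real n * (B + \<bar>\<theta>\<bar>)\<^sup>2"
    by (simp add: power_mult_distrib mult_left_mono)
qed measurable

lemma u_stat_law_of_large_numbers: "vanishes_in_prob M (\<lambda>n w. u_stat X m k n w - \<theta>)"
proof (rule vanishes_in_prob_of_second_moment)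
  obtain C where C: "\<And>n. max 2 m \<le> n \<Longrightarrow> expectation (\<lambda>w. (sqrt (real n) * (u_stat X m k n w - \<theta>))\<^sup>2) \<le> C"
    using u_stat_second_moment by blast
  have eq: "(u_stat X m k n w - \<theta>)\<^sup>2 = (sqrt (real n) * (u_stat X m k n w - \<theta>))\<^sup>2 / real n" if "n \<ge> 1" for n w
    using that by (simp add: power_mult_distrib)
  show "(\<lambda>w. u_stat X m k n w - \<theta>) \<in> borel_measurable M" for n by measurable
  show "integrable M (\<lambda>w. (u_stat X m k n w - \<theta>)\<^sup>2)" for n
  proof (rule integrable_bounded_comp[OF finite_measure_axioms])
    fix w
    show "\<bar>(u_stat X m k n w - \<theta>)\<^sup>2\<bar> \<le> (B + \<bar>\<theta>\<bar>)\<^sup>2"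
      unfolding abs_power2
      by (rule power2_le_iff_abs_le[THEN iffD2]) (use B_nonneg u_stat_bound[of n w] in linarith)+
  qed measurable
  show "(\<lambda>n. expectation (\<lambda>w. (u_stat X m k n w - \<theta>)\<^sup>2)) \<longlonglongrightarrow> 0"
  proof (rule tendsto_sandwich[OF _ _ tendsto_const])
    show "eventually (\<lambda>n. 0 \<le> expectation (\<lambda>w. (u_stat X m k n w - \<theta>)\<^sup>2)) sequentially" by simp
    show "(\<lambda>n. C / real n) \<longlonglongrightarrow> 0" by real_asymp
    show "eventually (\<lambda>n. expectation (\<lambda>w. (u_stat X m k n w - \<theta>)\<^sup>2) \<le> C / real n) sequentially"
    proof (rule eventually_sequentiallyI[of "max 2 m"])
      fix n assume n: "max 2 m \<le> n"
      hence n1: "n \<ge> 1" by simp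
      show "expectation (\<lambda>w. (u_stat X m k n w - \<theta>)\<^sup>2) \<le> C / real n"
        unfolding eq[OF n1] using C[OF n] by (simp add: divide_right_mono)
    qed
  qed
qed

lemma expectation_tuple:
  assumes i: "i \<in> index_tuples m n" and n: "n \<ge> 1"
  shows "expectation (\<lambda>w. k (\<lambda>l\<in>{1..m}. X (i l) w)) = \<theta>"
proof -
  have im: "i \<in> {1..m} \<rightarrow> {1..n}" using index_tuples_range[OF i] by blast
  have meas: "(\<lambda>z. \<lambda>l\<in>{1..m}. z (i l)) \<in> measurable (Pi\<^sub>M {1..n} (\<lambda>_. F)) (Pi\<^sub>M {1..m} (\<lambda>_. F))"
    using im by (intro measurable_restrict measurable_component_singleton) auto
  have kF: "k \<in> borel_measurable (Pi\<^sub>M {1..m} (\<lambda>_. F))" using k_measurable by (simp only: measurable_PiM_F)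
  have "expectation (\<lambda>w. k (\<lambda>l\<in>{1..m}. X (i l) w))
      = expectation (\<lambda>w. k (\<lambda>l\<in>{1..m}. (\<lambda>j\<in>{1..n}. X j w) (i l)))"
    using im by (intro Bochner_Integration.integral_cong refl arg_cong[where f=k] restrict_ext) auto
  also have "\<dots> = (LINT z|Pi\<^sub>M {1..n} (\<lambda>_. F). k (\<lambda>l\<in>{1..m}. z (i l)))"
    by (rule expectation_sample)
       (use n measurable_compose[OF meas kF] in \<open>auto simp: measurable_PiM_F\<close>)
  also have "\<dots> = (LINT z|distr (Pi\<^sub>M {1..n} (\<lambda>_. F)) (Pi\<^sub>M {1..m} (\<lambda>_. F)) (\<lambda>z. \<lambda>l\<in>{1..m}. z (i l)). k z)"
    by (rule integral_distr[symmetric, OF meas kF])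
  also have "\<dots> = (LINT z|Pi\<^sub>M {1..m} (\<lambda>_. F). k z)"
    using distr_PiM_reindex[of "{1..n}" "\<lambda>_. F" i "{1..m}"] prob_space_F index_tuples_inj[OF i] im by simp
  also have "\<dots> = \<theta>"
    unfolding kernel_mean_def by (rule expectation_sample[symmetric]) (use m_pos in auto)
  finally show ?thesis .
qed

end

declare One_nat_def [simp]

section \<open>Trimming a sorted list\<close>

lemma initial_segment_eq_lessThan_card:
  fixes A :: "nat set"
  assumes fin: "finite A" and down: "\<And>x y. x \<in> A \<Longrightarrow> y < x \<Longrightarrow> y \<in> A"
  shows "A = {..<card A}"
proof -
  have "A \<subseteq> {..<card A}"
  proof
    fix x assume x: "x \<in> A"
    have "{..x} \<subseteq> A"
    proof
      fix y assume "y \<in> {..x}"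
      thus "y \<in> A" using down[OF x, of y] x by (cases "y = x") auto
    qed
    from card_mono[OF fin this] show "x \<in> {..<card A}" by simp
  qed
  thus ?thesis using card_subset_eq[of "{..<card A}" A] by simp
qed

lemma sorted_le_iff_less_card:
  assumes v: "sorted v" and k: "k < length v"
  shows "v ! k \<le> c \<longleftrightarrow> k < card {k. k < length v \<and> v ! k \<le> c}"
    and "v ! k < c \<longleftrightarrow> k < card {k. k < length v \<and> v ! k < c}"
proof -
  have mono: "v ! k \<le> v ! l" if "k \<le> l" "l < length v" for k l
    using sorted_nth_mono[OF v that] .
  have "{k. k < length v \<and> v ! k \<le> c} = {..<card {k. k < length v \<and> v ! k \<le> c}}"
    using mono by (intro initial_segment_eq_lessThan_card) (auto intro: order_trans less_imp_le)
  thus "v ! k \<le> c \<longleftrightarrow> k < card {k. k < length v \<and> v ! k \<le> c}" using k by blast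
  have "{k. k < length v \<and> v ! k < c} = {..<card {k. k < length v \<and> v ! k < c}}"
    using mono by (intro initial_segment_eq_lessThan_card) (auto intro: le_less_trans less_imp_le)
  thus "v ! k < c \<longleftrightarrow> k < card {k. k < length v \<and> v ! k < c}" using k by blast
qed

text \<open>
  The two sums run over the values on the wrong side of \<open>c\<close>: those above \<open>c\<close> among the \<open>r\<close> smallest ones, and
  those below \<open>c\<close> among the others. For a sorted list at most one of the sums is nonzero.
\<close>

definition trim_excess :: "real list \<Rightarrow> nat \<Rightarrow> real \<Rightarrow> real" where
  "trim_excess v r c = (\<Sum>k<r. max (v ! k - c) 0) + (\<Sum>k\<in>{r..<length v}. max (c - v ! k) 0)"

lemma sum_below_rank:
  assumes "r \<le> length v"
  shows "(\<Sum>k<r. v ! k) = real r * c + (\<Sum>k<length v. min (v ! k - c) 0) + trim_excess v r c"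
proof -
  have split: "{..<length v} = {..<r} \<union> {r..<length v}" using assms by auto
  have "(\<Sum>k<length v. min (v ! k - c) 0) = (\<Sum>k<r. min (v ! k - c) 0) + (\<Sum>k\<in>{r..<length v}. min (v ! k - c) 0)"
    unfolding split by (rule sum.union_disjoint) auto
  moreover have "(\<Sum>k<r. min (v ! k - c) 0) + (\<Sum>k<r. max (v ! k - c) 0) = (\<Sum>k<r. v ! k - c)"
    unfolding sum.distrib[symmetric] by (intro sum.cong) (auto simp: min_def max_def)
  moreover have "(\<Sum>k\<in>{r..<length v}. min (v ! k - c) 0) + (\<Sum>k\<in>{r..<length v}. max (c - v ! k) 0) = 0"
    unfolding sum.distrib[symmetric] by (intro sum.neutral) (auto simp: min_def max_def)
  moreover have "(\<Sum>k<r. v ! k - c) = (\<Sum>k<r. v ! k) - real r * c"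
    by (simp add: sum_subtractf)
  ultimately show ?thesis unfolding trim_excess_def by linarith
qed

text \<open>
  The numbers \<open>q1\<close> and \<open>q2\<close> count the values on the wrong side of \<open>c\<close>. They lie between \<open>c\<close> and the value at
  the cut, which is in an \<open>\<epsilon>\<close>-neighbourhood of \<open>{lo..hi}\<close>; since the gap contains no value,
  the distance of each of them to \<open>c\<close> is known up to \<open>\<epsilon>\<close>.
\<close>

lemma trim_excess_bounds:
  assumes v: "sorted v" and r: "r < length v" and c: "lo \<le> c" "c \<le> hi"
    and gap: "\<And>k. k < length v \<Longrightarrow> v ! k \<notin> {lo<..<hi}"
    and near: "lo - \<epsilon> \<le> v ! r" "v ! r \<le> hi + \<epsilon>"
  defines "q1 \<equiv> real (r - card {k. k < length v \<and> v ! k \<le> c})"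
    and "q2 \<equiv> real (card {k. k < length v \<and> v ! k < c} - r)"
  shows "(hi - c) * q1 + (c - lo) * q2 \<le> trim_excess v r c"
    and "trim_excess v r c \<le> (hi - c + \<epsilon>) * q1 + (c - lo + \<epsilon>) * q2"
proof -
  define L where "L = card {k. k < length v \<and> v ! k \<le> c}"
  define L' where "L' = card {k. k < length v \<and> v ! k < c}"
  have mono: "v ! k \<le> v ! l" if "k \<le> l" "l < length v" for k l
    using sorted_nth_mono[OF v that] .
  have leL: "v ! k \<le> c \<longleftrightarrow> k < L" and lessL': "v ! k < c \<longleftrightarrow> k < L'" if "k < length v" for k
    using sorted_le_iff_less_card[OF v that, of c] by (simp_all add: L_def L'_def)
  have L'_le: "L' \<le> length v"
    using card_mono[of "{..<length v}" "{k. k < length v \<and> v ! k < c}"] by (auto simp: L'_def)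
  have s1: "(\<Sum>k<r. max (v ! k - c) 0) = (\<Sum>k\<in>{L..<r}. v ! k - c)"
    by (rule sum.mono_neutral_cong_right) (use r leL in \<open>force simp: max_def\<close>)+
  have s2: "(\<Sum>k\<in>{r..<length v}. max (c - v ! k) 0) = (\<Sum>k\<in>{r..<L'}. c - v ! k)"
  proof (rule sum.mono_neutral_cong_right)
    show "{r..<L'} \<subseteq> {r..<length v}" using L'_le by auto
    show "\<forall>k\<in>{r..<length v} - {r..<L'}. max (c - v ! k) 0 = 0"
    proof
      fix k assume "k \<in> {r..<length v} - {r..<L'}"
      hence "\<not> v ! k < c" using lessL'[of k] by auto
      thus "max (c - v ! k) 0 = 0" by simp
    qed
    show "max (c - v ! k) 0 = c - v ! k" if "k \<in> {r..<L'}" for k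
      using that lessL'[of k] L'_le by (auto simp: max_def)
  qed simp
  have q: "q1 = real (card {L..<r})" "q2 = real (card {r..<L'})"
    by (simp_all add: q1_def q2_def L_def L'_def)
  have t1: "hi - c \<le> v ! k - c \<and> v ! k - c \<le> hi - c + \<epsilon>" if "k \<in> {L..<r}" for k
    using that r leL[of k] gap[of k] mono[of k r] near c by auto
  have t2: "c - lo \<le> c - v ! k \<and> c - v ! k \<le> c - lo + \<epsilon>" if "k \<in> {r..<L'}" for k
    using that L'_le lessL'[of k] gap[of k] mono[of r k] near c by auto
  have "(hi - c) * q1 \<le> (\<Sum>k\<in>{L..<r}. v ! k - c)" "(\<Sum>k\<in>{L..<r}. v ! k - c) \<le> (hi - c + \<epsilon>) * q1"
    using sum_bounded_below[of "{L..<r}" "hi - c" "\<lambda>k. v ! k - c"]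
      sum_bounded_above[of "{L..<r}" "\<lambda>k. v ! k - c" "hi - c + \<epsilon>"] t1
    by (simp_all add: q mult.commute)
  moreover have "(c - lo) * q2 \<le> (\<Sum>k\<in>{r..<L'}. c - v ! k)" "(\<Sum>k\<in>{r..<L'}. c - v ! k) \<le> (c - lo + \<epsilon>) * q2"
    using sum_bounded_below[of "{r..<L'}" "c - lo" "\<lambda>k. c - v ! k"]
      sum_bounded_above[of "{r..<L'}" "\<lambda>k. c - v ! k" "c - lo + \<epsilon>"] t2
    by (simp_all add: q mult.commute)
  ultimately show "(hi - c) * q1 + (c - lo) * q2 \<le> trim_excess v r c"
    "trim_excess v r c \<le> (hi - c + \<epsilon>) * q1 + (c - lo + \<epsilon>) * q2"
    unfolding trim_excess_def s1 s2 by linarith+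
qed

text \<open>
  The counts of the preceding lemma, expressed by deviations of the empirical distribution function \<open>p\<close> and
  its left limit \<open>p'\<close> at \<open>c\<close> from their theoretical counterparts \<open>P\<close> and \<open>P'\<close>. If \<open>c < hi\<close>, then
  \<open>P = \<gamma>\<close>, and otherwise the factor \<open>hi - c\<close> is zero; in the latter case the count
  only has to be small, for which \<open>\<gamma> \<le> P\<close> suffices. The other side is analogous.
\<close>

lemma trim_excess_approx:
  fixes v :: "real list" and N :: real
  assumes v: "sorted v" and r: "r < length v" and c: "lo \<le> c" "c \<le> hi" and \<epsilon>: "\<epsilon> \<ge> 0"
    and gap: "\<And>k. k < length v \<Longrightarrow> v ! k \<notin> {lo<..<hi}"
    and near: "lo - \<epsilon> \<le> v ! r" "v ! r \<le> hi + \<epsilon>"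
  defines "N \<equiv> real (length v)"
  defines "p \<equiv> real (card {k. k < length v \<and> v ! k \<le> c}) / N"
    and "p' \<equiv> real (card {k. k < length v \<and> v ! k < c}) / N"
  assumes rank: "\<gamma> * N - 1 \<le> real r" "real r \<le> \<gamma> * N"
    and P: "\<gamma> \<le> P" "P' \<le> \<gamma>" "c < hi \<Longrightarrow> P = \<gamma>" "lo < c \<Longrightarrow> P' = \<gamma>"
  shows "\<bar>trim_excess v r c / N - (hi - c) * max 0 (P - p) - (c - lo) * max 0 (p' - P')\<bar>
     \<le> \<epsilon> * (\<bar>p - P\<bar> + \<bar>p' - P'\<bar>) + (\<epsilon> + (hi - lo)) / N"
proof -
  have N: "N > 0" using r by (cases v) (simp_all add: N_def)
  define q1 where "q1 = real (r - card {k. k < length v \<and> v ! k \<le> c}) / N"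
  define q2 where "q2 = real (card {k. k < length v \<and> v ! k < c} - r) / N"
  note b = trim_excess_bounds[OF v r c gap near]
  have lower: "(hi - c) * q1 + (c - lo) * q2 \<le> trim_excess v r c / N"
    using divide_right_mono[OF b(1), of N] N by (simp add: q1_def q2_def add_divide_distrib)
  have upper: "trim_excess v r c / N \<le> (hi - c + \<epsilon>) * q1 + (c - lo + \<epsilon>) * q2"
    using divide_right_mono[OF b(2), of N] N by (simp add: q1_def q2_def add_divide_distrib)
  have nat_diff: "real (x - y) / N = max 0 (real x / N - real y / N)" for x y :: nat
  proof (cases "y \<le> x")
    case True
    have "real y / N \<le> real x / N" using True N by (intro divide_right_mono) auto
    thus ?thesis using True by (simp add: of_nat_diff diff_divide_distrib)
  next
    case False
    have "real x / N \<le> real y / N" using False N by (intro divide_right_mono) auto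
    thus ?thesis using False by simp
  qed
  have rN: "\<gamma> - 1 / N \<le> real r / N" "real r / N \<le> \<gamma>"
    using divide_right_mono[OF rank(1), of N] divide_right_mono[OF rank(2), of N] N
    by (simp_all add: diff_divide_distrib)
  have q1: "max 0 (\<gamma> - p) - 1 / N \<le> q1" "q1 \<le> max 0 (\<gamma> - p)"
    using rN N unfolding q1_def nat_diff p_def[symmetric] by (auto simp: max_def)
  have q2: "max 0 (p' - \<gamma>) \<le> q2" "q2 \<le> max 0 (p' - \<gamma>) + 1 / N"
    using rN N unfolding q2_def nat_diff p'_def[symmetric] by (auto simp: max_def)
  have e1: "\<epsilon> * q1 \<le> \<epsilon> * \<bar>p - P\<bar>" using q1 P \<epsilon> by (intro mult_left_mono) auto
  have e2: "\<epsilon> * q2 \<le> \<epsilon> * (\<bar>p' - P'\<bar> + 1 / N)" using q2 P \<epsilon> by (intro mult_left_mono) auto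
  have m1: "(hi - c) * max 0 (P - p) = (hi - c) * max 0 (\<gamma> - p)" using P c by (cases "c = hi") auto
  have m2: "(c - lo) * max 0 (p' - P') = (c - lo) * max 0 (p' - \<gamma>)" using P c by (cases "c = lo") auto
  have g1: "(hi - c) * (max 0 (\<gamma> - p) - 1 / N) \<le> (hi - c) * q1" "(hi - c) * q1 \<le> (hi - c) * max 0 (\<gamma> - p)"
    using q1 c by (intro mult_left_mono; simp)+
  have g2: "(c - lo) * max 0 (p' - \<gamma>) \<le> (c - lo) * q2" "(c - lo) * q2 \<le> (c - lo) * (max 0 (p' - \<gamma>) + 1 / N)"
    using q2 c by (intro mult_left_mono; simp)+
  have d: "(hi - c) * (1 / N) \<ge> 0" "(c - lo) * (1 / N) \<ge> 0" "\<epsilon> * \<bar>p - P\<bar> \<ge> 0" "\<epsilon> * \<bar>p' - P'\<bar> \<ge> 0" "\<epsilon> * (1/N) \<ge> 0"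
    using c N \<epsilon> by auto
  have "trim_excess v r c / N - (hi - c) * max 0 (P - p) - (c - lo) * max 0 (p' - P')
      \<le> \<epsilon> * (\<bar>p - P\<bar> + \<bar>p' - P'\<bar>) + \<epsilon> * (1 / N) + (hi - c) * (1 / N) + (c - lo) * (1 / N)"
    using upper e1 e2 g1 g2 d unfolding m1 m2 by (simp add: algebra_simps)
  moreover have "- (\<epsilon> * (\<bar>p - P\<bar> + \<bar>p' - P'\<bar>) + \<epsilon> * (1 / N) + (hi - c) * (1 / N) + (c - lo) * (1 / N))
      \<le> trim_excess v r c / N - (hi - c) * max 0 (P - p) - (c - lo) * max 0 (p' - P')"
    using lower g1 g2 d unfolding m1 m2 by (simp add: algebra_simps)
  moreover have "\<epsilon> * (1 / N) + (hi - c) * (1 / N) + (c - lo) * (1 / N) = (\<epsilon> + (hi - lo)) / N"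
    by (simp add: add_divide_distrib diff_divide_distrib)
  ultimately show ?thesis by (simp only: abs_le_iff) linarith
qed

lemma cut_rank_bounds:
  assumes "0 < \<gamma>" "\<gamma> < 1" "m \<le> n"
  shows "1 \<le> cut_rank m n \<gamma>" "cut_rank m n \<gamma> \<le> n choose m"
    "\<gamma> * real (n choose m) \<le> real (cut_rank m n \<gamma>)" "real (cut_rank m n \<gamma>) < \<gamma> * real (n choose m) + 1"
proof -
  have N: "real (n choose m) > 0" using assms by simp
  define z where "z = - \<lfloor>- \<gamma> * real (n choose m)\<rfloor>"
  have z: "\<gamma> * real (n choose m) \<le> real_of_int z" "real_of_int z < \<gamma> * real (n choose m) + 1"
    unfolding z_def by linarith+
  have "0 < \<gamma> * real (n choose m)" "\<gamma> * real (n choose m) < real (n choose m)" using assms N by simp_all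
  hence "0 < z" "z \<le> int (n choose m)" using z by linarith+
  moreover have "cut_rank m n \<gamma> = nat z" by (simp add: cut_rank_def z_def)
  ultimately show "1 \<le> cut_rank m n \<gamma>" "cut_rank m n \<gamma> \<le> n choose m"
    "\<gamma> * real (n choose m) \<le> real (cut_rank m n \<gamma>)" "real (cut_rank m n \<gamma>) < \<gamma> * real (n choose m) + 1"
    using z by auto
qed

lemma cut_rank_pred_le: "0 < \<gamma> \<Longrightarrow> \<gamma> < 1 \<Longrightarrow> cut_rank m n \<gamma> - 1 \<le> n choose m"
proof (cases "m \<le> n")
  case True
  assume "0 < \<gamma>" "\<gamma> < 1"
  from cut_rank_bounds(2)[OF this True] show ?thesis by simp
qed (simp add: cut_rank_def binomial_eq_0)

lemma cut_rank_mono: "\<alpha> \<le> \<beta> \<Longrightarrow> cut_rank m n \<alpha> \<le> cut_rank m n \<beta>"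
  unfolding cut_rank_def
  by (intro nat_mono) (simp add: floor_mono mult_right_mono)

text \<open>
  Ranks count from one and list positions from zero, hence the shift by one in the numbers of
  values below the cuts.
\<close>

lemma trimmed_stat_eq:
  fixes X :: "nat \<Rightarrow> 'w \<Rightarrow> 'x" and h :: "(nat \<Rightarrow> 'x) \<Rightarrow> real" and m n :: nat and w :: 'w
    and \<alpha> \<beta> c d :: real
  assumes mn: "m \<le> n" and ab: "0 < \<alpha>" "\<alpha> < \<beta>" "\<beta> < 1"
  defines "v \<equiv> kernel_values X m h n w" and "N \<equiv> real (n choose m)"
  defines "r\<^sub>\<alpha> \<equiv> cut_rank m n \<alpha> - 1" and "r\<^sub>\<beta> \<equiv> cut_rank m n \<beta> - 1"
  shows "trimmed_stat X m h \<alpha> \<beta> n w =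
      (real r\<^sub>\<beta> * d + (\<Sum>k<n choose m. min (v ! k - d) 0) + trim_excess v r\<^sub>\<beta> d) / N
    - (real r\<^sub>\<alpha> * c + (\<Sum>k<n choose m. min (v ! k - c) 0) + trim_excess v r\<^sub>\<alpha> c) / N"
proof -
  have len: "length v = n choose m" by (simp add: v_def length_kernel_values)
  note ra = cut_rank_bounds[of \<alpha> m n] and rb = cut_rank_bounds[of \<beta> m n]
  have "(\<Sum>k\<in>{cut_rank m n \<alpha>..<cut_rank m n \<beta>}. order_stat X m h n w k) = (\<Sum>k\<in>{r\<^sub>\<alpha>..<r\<^sub>\<beta>}. v ! k)"
    by (rule sum.reindex_bij_witness[of _ Suc "\<lambda>k. k - 1"])
       (use ra rb ab mn in \<open>auto simp: order_stat_def v_def r\<^sub>\<alpha>_def r\<^sub>\<beta>_def\<close>)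
  moreover have "(\<Sum>k<r\<^sub>\<beta>. v ! k) = (\<Sum>k<r\<^sub>\<alpha>. v ! k) + (\<Sum>k\<in>{r\<^sub>\<alpha>..<r\<^sub>\<beta>}. v ! k)"
  proof -
    have "r\<^sub>\<alpha> \<le> r\<^sub>\<beta>" using cut_rank_mono[of \<alpha> \<beta> m n] ab by (simp add: r\<^sub>\<alpha>_def r\<^sub>\<beta>_def)
    hence "{..<r\<^sub>\<beta>} = {..<r\<^sub>\<alpha>} \<union> {r\<^sub>\<alpha>..<r\<^sub>\<beta>}" by auto
    moreover have "(\<Sum>k\<in>{..<r\<^sub>\<alpha>} \<union> {r\<^sub>\<alpha>..<r\<^sub>\<beta>}. v ! k) = (\<Sum>k<r\<^sub>\<alpha>. v ! k) + (\<Sum>k\<in>{r\<^sub>\<alpha>..<r\<^sub>\<beta>}. v ! k)"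
      by (rule sum.union_disjoint) auto
    ultimately show ?thesis by (simp only:)
  qed
  moreover have "(\<Sum>k<r\<^sub>\<beta>. v ! k) = real r\<^sub>\<beta> * d + (\<Sum>k<n choose m. min (v ! k - d) 0) + trim_excess v r\<^sub>\<beta> d"
    using sum_below_rank[of r\<^sub>\<beta> v d] rb ab mn by (simp add: len r\<^sub>\<beta>_def)
  moreover have "(\<Sum>k<r\<^sub>\<alpha>. v ! k) = real r\<^sub>\<alpha> * c + (\<Sum>k<n choose m. min (v ! k - c) 0) + trim_excess v r\<^sub>\<alpha> c"
    using sum_below_rank[of r\<^sub>\<alpha> v c] ra ab mn by (simp add: len r\<^sub>\<alpha>_def)
  ultimately have "(\<Sum>k\<in>{cut_rank m n \<alpha>..<cut_rank m n \<beta>}. order_stat X m h n w k) =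
      (real r\<^sub>\<beta> * d + (\<Sum>k<n choose m. min (v ! k - d) 0) + trim_excess v r\<^sub>\<beta> d)
    - (real r\<^sub>\<alpha> * c + (\<Sum>k<n choose m. min (v ! k - c) 0) + trim_excess v r\<^sub>\<alpha> c)"
    by linarith
  thus ?thesis unfolding trimmed_stat_def N_def by (simp add: diff_divide_distrib)
qed

section \<open>Quantiles\<close>

text \<open>
  The interval \<open>{lo<..<hi}\<close> is the flat part of the distribution function at level \<open>\<gamma>\<close>; it is empty if
  the quantile is unique.
\<close>

locale quantile = real_distribution D for D :: "real measure" +
  fixes \<gamma> :: real
  assumes \<gamma>: "0 < \<gamma>" "\<gamma> < 1"
begin

abbreviation "lo \<equiv> lower_quantile (cdf D) \<gamma>"
abbreviation "hi \<equiv> upper_quantile (cdf D) \<gamma>"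

lemma cdf_ge_ex: "\<exists>x. cdf D x > \<gamma>"
  using order_tendstoD(1)[OF cdf_lim_at_top_prob, of \<gamma>] \<gamma> by (auto simp: eventually_at_top_linorder)

lemma cdf_less_ex: "\<exists>x. cdf D x < \<gamma>"
  using order_tendstoD(2)[OF cdf_lim_at_bot, of \<gamma>] \<gamma> by (auto simp: eventually_at_bot_linorder)

lemma bdd: "bdd_below {x. cdf D x \<ge> \<gamma>}" "bdd_above {x. cdf D x \<le> \<gamma>}"
proof -
  obtain x where x: "cdf D x < \<gamma>" using cdf_less_ex by blast
  have "x \<le> y" if "cdf D y \<ge> \<gamma>" for y
    using cdf_nondecreasing[of y x] x that by (meson not_le order_trans less_imp_le)
  thus "bdd_below {x. cdf D x \<ge> \<gamma>}" by (intro bdd_belowI[of _ x]) auto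
  obtain z where z: "cdf D z > \<gamma>" using cdf_ge_ex by blast
  have "y \<le> z" if "cdf D y \<le> \<gamma>" for y
    using cdf_nondecreasing[of z y] z that by (meson not_le order_trans less_imp_le)
  thus "bdd_above {x. cdf D x \<le> \<gamma>}" by (intro bdd_aboveI[of _ z]) auto
qed

lemma cdf_below_lo: "y < lo \<Longrightarrow> cdf D y < \<gamma>"
  using cInf_lower[of y "{x. cdf D x \<ge> \<gamma>}"] bdd by (force simp: lower_quantile_def)

lemma cdf_above_hi: "y > hi \<Longrightarrow> cdf D y > \<gamma>"
  using cSup_upper[of y "{x. cdf D x \<le> \<gamma>}"] bdd by (force simp: upper_quantile_def)

lemma cdf_above_lo: "y > lo \<Longrightarrow> cdf D y \<ge> \<gamma>"
proof -
  assume "y > lo"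
  hence "\<exists>x\<in>{x. cdf D x \<ge> \<gamma>}. x < y"
    using cdf_ge_ex bdd by (subst cInf_less_iff[symmetric]) (auto simp: lower_quantile_def intro: less_imp_le)
  thus ?thesis using cdf_nondecreasing by (auto intro: order_trans less_imp_le)
qed

lemma cdf_below_hi: "y < hi \<Longrightarrow> cdf D y \<le> \<gamma>"
proof -
  assume "y < hi"
  hence "\<exists>x\<in>{x. cdf D x \<le> \<gamma>}. y < x"
    using cdf_less_ex bdd by (subst less_cSup_iff[symmetric]) (auto simp: upper_quantile_def intro: less_imp_le)
  thus ?thesis using cdf_nondecreasing by (auto intro: order_trans less_imp_le)
qed

lemma cdf_lo: "cdf D lo \<ge> \<gamma>"
proof (rule tendsto_lowerbound)
  show "(cdf D \<longlongrightarrow> cdf D lo) (at_right lo)"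
    using cdf_is_right_cont[of lo] by (simp add: continuous_within)
  show "\<forall>\<^sub>F x in at_right lo. \<gamma> \<le> cdf D x"
    unfolding eventually_at_right_field by (intro exI[of _ "lo + 1"]) (auto intro: cdf_above_lo)
qed simp

lemma left_limit_hi: "measure D {..<hi} \<le> \<gamma>"
proof (rule tendsto_upperbound[OF cdf_at_left])
  show "\<forall>\<^sub>F x in at_left hi. cdf D x \<le> \<gamma>"
    unfolding eventually_at_left_field by (intro exI[of _ "hi - 1"]) (auto intro: cdf_below_hi)
qed simp

lemma lo_le_hi: "lo \<le> hi"
proof (rule ccontr)
  assume "\<not> lo \<le> hi"
  then obtain y where "hi < y" "y < lo" using dense by (meson not_le)
  thus False using cdf_below_lo cdf_above_hi by fastforce
qed

lemma cdf_le_left_limit: "x < y \<Longrightarrow> cdf D x \<le> measure D {..<y}"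
  unfolding cdf_def by (intro finite_measure_mono) auto

lemma left_limit_mono: "x \<le> y \<Longrightarrow> measure D {..<x} \<le> measure D {..<y}"
  by (intro finite_measure_mono) auto

lemma between:
  assumes "lo \<le> c" "c \<le> hi"
  shows "\<gamma> \<le> cdf D c" "measure D {..<c} \<le> \<gamma>" "c < hi \<Longrightarrow> cdf D c = \<gamma>" "lo < c \<Longrightarrow> measure D {..<c} = \<gamma>"
  using cdf_lo cdf_nondecreasing[OF assms(1)] left_limit_mono[OF assms(2)] left_limit_hi
    cdf_below_hi[of c] cdf_le_left_limit[of lo c] by linarith+

lemma gap_null: "measure D {lo<..<hi} = 0"
proof (cases "lo < hi")
  case True
  have "measure D {..<hi} = measure D {..lo} + measure D {lo<..<hi}"
    using True by (subst finite_measure_Union[symmetric]) (auto intro!: arg_cong[where f="measure D"])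
  thus ?thesis using left_limit_hi cdf_lo measure_nonneg[of D "{lo<..<hi}"] unfolding cdf_def by linarith
qed simp

end

section \<open>Trimming at the empirical quantiles\<close>

lemma u_stat_comp:
  "u_stat X m (\<lambda>z. \<phi> (h z)) n w = (\<Sum>k<n choose m. \<phi> (kernel_values X m h n w ! k)) / real (n choose m)"
  unfolding u_stat_def by (simp only: sum_index_tuples_eq_sum_nth[where f=\<phi>])

lemma u_stat_indicator:
  "u_stat X m (\<lambda>z. indicator A (h z)) n w
    = real (card {k. k < n choose m \<and> kernel_values X m h n w ! k \<in> A}) / real (n choose m)"
  unfolding u_stat_comp by (simp add: indicator_def sum.If_cases Int_def)

lemma choose_ge_quotient:
  assumes "1 \<le> m" "m \<le> n"
  shows "real n / real m \<le> real (n choose m)"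
proof -
  have "m * (n choose m) = n * ((n - 1) choose (m - 1))"
    using binomial_absorption[of "m - 1" n] assms by simp
  moreover have "1 \<le> (n - 1) choose (m - 1)" using assms zero_less_binomial[of "m - 1" "n - 1"] by linarith
  hence "n * 1 \<le> n * ((n - 1) choose (m - 1))" by (rule mult_le_mono2)
  ultimately have "n \<le> m * (n choose m)" by simp
  hence "real n \<le> real m * real (n choose m)" by (simp flip: of_nat_mult)
  thus ?thesis using assms by (simp add: pos_divide_le_eq mult.commute)
qed

lemma sqrt_over_choose_tendsto_0:
  assumes "1 \<le> m"
  shows "(\<lambda>n. sqrt (real n) * (c / real (n choose m))) \<longlonglongrightarrow> 0"
proof -
  have "(\<lambda>n. sqrt (real n) / real (n choose m)) \<longlonglongrightarrow> 0"
  proof (rule tendsto_sandwich[OF _ _ tendsto_const])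
    show "(\<lambda>n. real m / sqrt (real n)) \<longlonglongrightarrow> 0" by real_asymp
    show "\<forall>\<^sub>F n in sequentially. sqrt (real n) / real (n choose m) \<le> real m / sqrt (real n)"
    proof (rule eventually_sequentiallyI[of m])
      fix n assume n: "m \<le> n"
      have pos: "real n > 0" "real (n choose m) > 0" "real m > 0" using n assms by auto
      have "real n \<le> real m * real (n choose m)"
        using choose_ge_quotient[OF assms n] pos by (simp add: pos_divide_le_eq mult.commute)
      hence "sqrt (real n) * sqrt (real n) \<le> real m * real (n choose m)" by simp
      thus "sqrt (real n) / real (n choose m) \<le> real m / sqrt (real n)"
        using pos by (simp add: pos_divide_le_eq pos_le_divide_eq mult.commute)
    qed
  qed (auto intro!: always_eventually)
  from tendsto_mult_left[OF this, of c] show ?thesis by (simp add: mult.commute mult.left_commute)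
qed

locale trimmed_kernel = iid_sample M S F X m
  for M :: "'w measure" and S F :: "'x measure" and X :: "nat \<Rightarrow> 'w \<Rightarrow> 'x" and m :: nat +
  fixes h :: "(nat \<Rightarrow> 'x) \<Rightarrow> real"
  assumes h_measurable: "h \<in> borel_measurable (Pi\<^sub>M {1..m} (\<lambda>_. S))"
    and h_symmetric: "symmetric_kernel S m h"
begin

definition kernel_law :: "real measure" where
  "kernel_law = distr M borel (\<lambda>w. h (\<lambda>j\<in>{1..m}. X j w))"

lemma h_sample_measurable: "(\<lambda>w. h (\<lambda>j\<in>{1..m}. X j w)) \<in> borel_measurable M"
  by (rule measurable_compose[OF sample_measurable h_measurable]) auto

sublocale D: real_distribution kernel_law
  unfolding kernel_law_def by (rule real_distribution_distr[OF h_sample_measurable])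

lemma kernel_df_eq: "kernel_df M X m h = cdf kernel_law"
  by (simp add: kernel_df_def kernel_law_def)

lemma bounded_kernel_comp:
  assumes [measurable]: "\<phi> \<in> borel_measurable borel" and "\<And>x. \<bar>\<phi> x\<bar> \<le> B"
  shows "bounded_kernel M S F X m (\<lambda>z. \<phi> (h z)) B"
proof unfold_locales
  show "(\<lambda>z. \<phi> (h z)) \<in> borel_measurable (Pi\<^sub>M {1..m} (\<lambda>_. S))"
    using h_measurable by measurable
  show "symmetric_kernel S m (\<lambda>z. \<phi> (h z))"
    using h_symmetric by (simp add: symmetric_kernel_def)
qed (use assms(2) in auto)

lemma kernel_mean_comp:
  assumes "\<phi> \<in> borel_measurable borel"
  shows "kernel_mean M X m (\<lambda>z. \<phi> (h z)) = (LINT x|kernel_law. \<phi> x)"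
  unfolding kernel_mean_def kernel_law_def
  by (rule integral_distr[symmetric, OF h_sample_measurable assms])

lemma bounded_kernel_indicator:
  "A \<in> sets borel \<Longrightarrow> bounded_kernel M S F X m (\<lambda>z. indicator A (h z)) 1"
  by (rule bounded_kernel_comp) (auto simp: indicator_def)

lemma kernel_mean_indicator:
  "A \<in> sets borel \<Longrightarrow> kernel_mean M X m (\<lambda>z. indicator A (h z)) = measure kernel_law A"
  by (subst kernel_mean_comp) auto

lemma empirical_measure_measurable:
  "A \<in> sets borel \<Longrightarrow> u_stat X m (\<lambda>z. indicator A (h z)) n \<in> borel_measurable M"
  by (rule bounded_kernel.u_stat_measurable[OF bounded_kernel_indicator])

lemma empirical_measure_lln:
  assumes "A \<in> sets borel"
  shows "vanishes_in_prob M (\<lambda>n w. u_stat X m (\<lambda>z. indicator A (h z)) n w - measure kernel_law A)"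
  using bounded_kernel.u_stat_law_of_large_numbers[OF bounded_kernel_indicator[OF assms]]
  by (simp only: kernel_mean_indicator[OF assms])

text \<open>
  An order statistic is at most \<open>y\<close> if and only if enough kernel values are; this expresses it by the
  empirical distribution function, which is a finite sum of measurable functions.
\<close>

lemma kernel_values_measurable:
  assumes k: "k < n choose m"
  shows "(\<lambda>w. kernel_values X m h n w ! k) \<in> borel_measurable M"
  unfolding borel_measurable_iff_le
proof
  fix y
  have [measurable]: "u_stat X m (\<lambda>z. indicator {..y} (h z)) n \<in> borel_measurable M"
    by (rule empirical_measure_measurable) simp
  have N: "real (n choose m) > 0" using k by linarith
  have "{w\<in>space M. kernel_values X m h n w ! k \<le> y}
      = {w\<in>space M. real k / real (n choose m) < u_stat X m (\<lambda>z. indicator {..y} (h z)) n w}"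
  proof (intro Collect_cong conj_cong refl)
    fix w
    have "kernel_values X m h n w ! k \<le> y \<longleftrightarrow> k < card {k. k < n choose m \<and> kernel_values X m h n w ! k \<le> y}"
      using sorted_le_iff_less_card(1)[of "kernel_values X m h n w" k y] k
      by (simp add: length_kernel_values) (simp add: kernel_values_def)
    thus "kernel_values X m h n w ! k \<le> y \<longleftrightarrow> real k / real (n choose m) < u_stat X m (\<lambda>z. indicator {..y} (h z)) n w"
      using N by (simp add: u_stat_indicator divide_less_cancel)
  qed
  thus "{w\<in>space M. kernel_values X m h n w ! k \<le> y} \<in> sets M" by simp
qed

lemma trim_excess_measurable:
  assumes "r \<le> n choose m"
  shows "(\<lambda>w. trim_excess (kernel_values X m h n w) r c) \<in> borel_measurable M"
  unfolding trim_excess_def length_kernel_values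
  by (intro borel_measurable_add borel_measurable_sum borel_measurable_max borel_measurable_diff
        borel_measurable_const kernel_values_measurable) (use assms in auto)

lemma order_stat_measurable:
  "1 \<le> k \<Longrightarrow> k \<le> n choose m \<Longrightarrow> (\<lambda>w. order_stat X m h n w k) \<in> borel_measurable M"
  unfolding order_stat_def by (rule kernel_values_measurable) simp

lemma trimmed_stat_measurable:
  assumes "0 < \<alpha>" "\<alpha> < \<beta>" "\<beta> < 1"
  shows "trimmed_stat X m h \<alpha> \<beta> n \<in> borel_measurable M"
proof (cases "m \<le> n")
  case True
  have "(\<lambda>w. order_stat X m h n w k) \<in> borel_measurable M" if "k \<in> {cut_rank m n \<alpha>..<cut_rank m n \<beta>}" for k
  proof (rule order_stat_measurable)
    show "1 \<le> k" using that cut_rank_bounds(1)[of \<alpha>, OF _ _ True] assms by auto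
    have "cut_rank m n \<beta> \<le> n choose m" using cut_rank_bounds(2)[of \<beta>, OF _ _ True] assms by auto
    thus "k \<le> n choose m" using that by auto
  qed
  thus ?thesis unfolding trimmed_stat_def[abs_def]
    by (intro borel_measurable_divide borel_measurable_sum) auto
next
  case False
  thus ?thesis unfolding trimmed_stat_def[abs_def] by (simp add: binomial_eq_0)
qed

lemma gap_values_null:
  assumes A: "A \<in> sets borel" "measure kernel_law A = 0" and n: "n \<ge> 1"
  shows "prob {w\<in>space M. u_stat X m (\<lambda>z. indicator A (h z)) n w \<noteq> 0} = 0"
proof -
  interpret K: bounded_kernel M S F X m "\<lambda>z. indicator A (h z)" 1
    by (rule bounded_kernel_indicator[OF A(1)])
  have "AE w in M. indicator A (h (\<lambda>l\<in>{1..m}. X (i l) w)) = (0 :: real)" if i: "i \<in> index_tuples m n" for i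
  proof -
    have "expectation (\<lambda>w. indicator A (h (\<lambda>l\<in>{1..m}. X (i l) w)) :: real) = 0"
      using K.expectation_tuple[OF i n] A by (simp add: kernel_mean_indicator)
    moreover have "integrable M (\<lambda>w. indicator A (h (\<lambda>l\<in>{1..m}. X (i l) w)) :: real)"
      by (rule integrable_bounded_comp[OF finite_measure_axioms K.sample_point_measurable[OF i] K.k_bound])
    ultimately show ?thesis by (subst (asm) integral_nonneg_eq_0_iff_AE) auto
  qed
  hence "AE w in M. \<forall>i\<in>index_tuples m n. indicator A (h (\<lambda>l\<in>{1..m}. X (i l) w)) = (0 :: real)"
    by (simp add: AE_finite_all[OF finite_index_tuples])
  hence "AE w in M. u_stat X m (\<lambda>z. indicator A (h z)) n w = 0"
    by eventually_elim (simp add: u_stat_def)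
  hence "AE w in M. w \<notin> {w\<in>space M. u_stat X m (\<lambda>z. indicator A (h z)) n w \<noteq> 0}"
    by eventually_elim simp
  thus ?thesis by (subst prob_eq_0) (use empirical_measure_measurable[OF A(1), of n] in auto)
qed

lemma near_quantile_of_empirical:
  fixes w :: 'w
  assumes \<gamma>: "0 < \<gamma>" "\<gamma> < 1" and n: "m \<le> n"
  defines "v \<equiv> kernel_values X m h n w" and "r \<equiv> cut_rank m n \<gamma> - 1"
  shows "\<gamma> \<le> u_stat X m (\<lambda>z. indicator {..y} (h z)) n w \<Longrightarrow> v ! r \<le> y"
    and "u_stat X m (\<lambda>z. indicator {..y} (h z)) n w < \<gamma> \<Longrightarrow> y < v ! r"
proof -
  note cr = cut_rank_bounds[OF \<gamma> n]
  have N: "real (n choose m) > 0" using n by simp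
  have r: "r < length v" using cr by (simp add: r_def v_def length_kernel_values)
  have sv: "sorted v" by (simp add: v_def kernel_values_def)
  define L where "L = card {k. k < n choose m \<and> v ! k \<le> y}"
  have iff: "v ! r \<le> y \<longleftrightarrow> r < L"
    using sorted_le_iff_less_card(1)[OF sv r] by (simp add: v_def length_kernel_values L_def)
  have u: "u_stat X m (\<lambda>z. indicator {..y} (h z)) n w = real L / real (n choose m)"
    by (simp add: u_stat_indicator L_def v_def)
  show "v ! r \<le> y" if "\<gamma> \<le> u_stat X m (\<lambda>z. indicator {..y} (h z)) n w"
  proof -
    have "\<gamma> * real (n choose m) \<le> real L" using that N by (simp add: u pos_le_divide_eq)
    hence "real (cut_rank m n \<gamma>) < real L + 1" using cr by linarith
    hence "cut_rank m n \<gamma> \<le> L" by linarith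
    hence "r < L" using cr(1) unfolding r_def by linarith
    thus ?thesis by (simp only: iff)
  qed
  show "y < v ! r" if "u_stat X m (\<lambda>z. indicator {..y} (h z)) n w < \<gamma>"
  proof -
    have "real L < \<gamma> * real (n choose m)" using that N by (simp add: u pos_divide_less_eq)
    hence "L < cut_rank m n \<gamma>" using cr by linarith
    thus ?thesis using iff by (auto simp: r_def)
  qed
qed

text \<open>
  By the law of large numbers at the points \<open>hi + \<epsilon>\<close> and \<open>lo - \<epsilon>\<close>, where the distribution function
  differs from \<open>\<gamma>\<close>, the empirical quantile is eventually within \<open>\<epsilon>\<close> of \<open>{lo..hi}\<close>. The deterministic
  estimate then bounds the error by \<open>\<epsilon>\<close> times the deviations of the empirical distribution
  function, which are of order \<open>1 / \<surd>n\<close>.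
\<close>

lemma trim_excess_limit:
  fixes c :: real
  assumes \<gamma>: "0 < \<gamma>" "\<gamma> < 1"
  defines "lo \<equiv> lower_quantile (cdf kernel_law) \<gamma>" and "hi \<equiv> upper_quantile (cdf kernel_law) \<gamma>"
  assumes c: "lo \<le> c" "c \<le> hi"
  shows "vanishes_in_prob M (\<lambda>n w. sqrt (real n) *
      (trim_excess (kernel_values X m h n w) (cut_rank m n \<gamma> - 1) c / real (n choose m)
       - (hi - c) * max 0 (measure kernel_law {..c} - u_stat X m (\<lambda>z. indicator {..c} (h z)) n w)
       - (c - lo) * max 0 (u_stat X m (\<lambda>z. indicator {..<c} (h z)) n w - measure kernel_law {..<c})))"
    (is "vanishes_in_prob M ?R")
proof -
  interpret Q: quantile kernel_law \<gamma> by unfold_locales (use \<gamma> in auto)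
  define emp where "emp A n w = u_stat X m (\<lambda>z. indicator A (h z)) n w" for A n w
  define dev where "dev A n w = emp A n w - measure kernel_law A" for A n w
  have dev_meas: "dev A n \<in> borel_measurable M" if "A \<in> sets borel" for A n
    using empirical_measure_measurable[OF that, of n] unfolding dev_def[abs_def] emp_def by measurable
  have dev_int: "integrable M (\<lambda>w. (sqrt (real n) * dev A n w)\<^sup>2)" if A: "A \<in> sets borel" for A n
    using bounded_kernel.u_stat_square_integrable[OF bounded_kernel_indicator[OF A], of n]
    unfolding dev_def emp_def kernel_mean_indicator[OF A] .
  have dev_ex: "\<exists>C. \<forall>n\<ge>max 2 m. expectation (\<lambda>w. (sqrt (real n) * dev A n w)\<^sup>2) \<le> C" if A: "A \<in> sets borel" for A
    using bounded_kernel.u_stat_second_moment[OF bounded_kernel_indicator[OF A]]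
    unfolding dev_def emp_def kernel_mean_indicator[OF A] by blast
  obtain C1 where C1: "\<And>n. n \<ge> max 2 m \<Longrightarrow> expectation (\<lambda>w. (sqrt (real n) * dev {..c} n w)\<^sup>2) \<le> C1"
    using dev_ex[of "{..c}"] by auto
  obtain C2 where C2: "\<And>n. n \<ge> max 2 m \<Longrightarrow> expectation (\<lambda>w. (sqrt (real n) * dev {..<c} n w)\<^sup>2) \<le> C2"
    using dev_ex[of "{..<c}"] by auto
  define W where "W n w = sqrt (real n) * (\<bar>dev {..c} n w\<bar> + \<bar>dev {..<c} n w\<bar>)" for n w
  have W_meas[measurable]: "W n \<in> borel_measurable M" for n
    using dev_meas[of "{..c}" n] dev_meas[of "{..<c}" n] unfolding W_def[abs_def] by simp
  have W_le: "(W n w)\<^sup>2 \<le> 2 * (sqrt (real n) * dev {..c} n w)\<^sup>2 + 2 * (sqrt (real n) * dev {..<c} n w)\<^sup>2" for n w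
    using power2_diff_le[of "sqrt (real n) * \<bar>dev {..c} n w\<bar>" "- (sqrt (real n) * \<bar>dev {..<c} n w\<bar>)"]
    by (simp add: W_def distrib_left power_mult_distrib)
  have W_bound_int: "integrable M (\<lambda>w. 2 * (sqrt (real n) * dev {..c} n w)\<^sup>2 + 2 * (sqrt (real n) * dev {..<c} n w)\<^sup>2)" for n
    using dev_int[of "{..c}" n] dev_int[of "{..<c}" n] by simp
  have W_int: "integrable M (\<lambda>w. (W n w)\<^sup>2)" for n
    by (rule Bochner_Integration.integrable_bound[OF W_bound_int])
       (use W_le in \<open>auto intro!: AE_I2 order_trans[OF _ abs_ge_self]\<close>)
  have W_C: "expectation (\<lambda>w. (W n w)\<^sup>2) \<le> 2 * C1 + 2 * C2" if n: "n \<ge> max 2 m" for n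
  proof -
    have "expectation (\<lambda>w. (W n w)\<^sup>2)
        \<le> expectation (\<lambda>w. 2 * (sqrt (real n) * dev {..c} n w)\<^sup>2 + 2 * (sqrt (real n) * dev {..<c} n w)\<^sup>2)"
      by (rule integral_mono[OF W_int W_bound_int W_le])
    also have "\<dots> = 2 * expectation (\<lambda>w. (sqrt (real n) * dev {..c} n w)\<^sup>2)
        + 2 * expectation (\<lambda>w. (sqrt (real n) * dev {..<c} n w)\<^sup>2)"
      using dev_int[of "{..c}" n] dev_int[of "{..<c}" n] by simp
    finally show ?thesis using C1[OF n] C2[OF n] by linarith
  qed
  define far where "far \<delta> y n = {w\<in>space M. \<delta> < \<bar>dev {..y} n w\<bar>}" for \<delta> y n
  \<comment> \<open>off this event the empirical quantile is near the gap and no value lies inside the gap\<close>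
  define bad where "bad \<epsilon> n = far ((cdf kernel_law (hi + \<epsilon>) - \<gamma>) / 2) (hi + \<epsilon>) n
      \<union> far ((\<gamma> - cdf kernel_law (lo - \<epsilon>)) / 2) (lo - \<epsilon>) n
      \<union> {w\<in>space M. emp {lo<..<hi} n w \<noteq> 0}" for \<epsilon> n
  have gapH: "cdf kernel_law (hi + \<epsilon>) - \<gamma> > 0" "\<gamma> - cdf kernel_law (lo - \<epsilon>) > 0" if "\<epsilon> > 0" for \<epsilon>
    using Q.cdf_above_hi[of "hi + \<epsilon>"] Q.cdf_below_lo[of "lo - \<epsilon>"] that by (simp_all add: lo_def hi_def)
  have far_sets: "far \<delta> y n \<in> events" for \<delta> y n
    using dev_meas[of "{..y}" n] unfolding far_def by measurable
  have null_sets: "{w\<in>space M. emp {lo<..<hi} n w \<noteq> 0} \<in> events" for n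
    using empirical_measure_measurable[of "{lo<..<hi}" n] unfolding emp_def by measurable
  have far_lim: "(\<lambda>n. prob (far \<delta> y n)) \<longlonglongrightarrow> 0" if "\<delta> > 0" for \<delta> y
    using empirical_measure_lln[of "{..y}"] that unfolding vanishes_in_prob_def far_def dev_def emp_def by simp
  show ?thesis
  proof (rule vanishes_in_prob_dominated[where W=W and bad=bad and C="2 * C1 + 2 * C2"
        and d="\<lambda>\<epsilon> n. sqrt (real n) * ((\<epsilon> + (hi - lo)) / real (n choose m))"])
    show "?R n \<in> borel_measurable M" for n
    proof -
      from trim_excess_measurable[OF cut_rank_pred_le[OF \<gamma>, of m n]]
        empirical_measure_measurable[of "{..c}" n] empirical_measure_measurable[of "{..<c}" n]
      show ?thesis by simp
    qed
    show "\<forall>\<^sub>F n in sequentially. expectation (\<lambda>w. (W n w)\<^sup>2) \<le> 2 * C1 + 2 * C2"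
      by (rule eventually_sequentiallyI[of "max 2 m"]) (rule W_C)
    show "bad \<epsilon> n \<in> events" for \<epsilon> n
      unfolding bad_def using far_sets null_sets by auto
    show "(\<lambda>n. sqrt (real n) * ((\<epsilon> + (hi - lo)) / real (n choose m))) \<longlonglongrightarrow> 0" for \<epsilon>
      by (rule sqrt_over_choose_tendsto_0[OF m_pos])
    fix \<epsilon> :: real assume \<epsilon>: "\<epsilon> > 0"
    define \<delta>1 \<delta>2 where "\<delta>1 = (cdf kernel_law (hi + \<epsilon>) - \<gamma>) / 2" and "\<delta>2 = (\<gamma> - cdf kernel_law (lo - \<epsilon>)) / 2"
    have \<delta>: "\<delta>1 > 0" "\<delta>2 > 0" using gapH[OF \<epsilon>] by (simp_all add: \<delta>1_def \<delta>2_def)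
    have bad_eq: "bad \<epsilon> n = far \<delta>1 (hi + \<epsilon>) n \<union> far \<delta>2 (lo - \<epsilon>) n \<union> {w\<in>space M. emp {lo<..<hi} n w \<noteq> 0}" for n
      by (simp add: bad_def \<delta>1_def \<delta>2_def)
    show "(\<lambda>n. prob (bad \<epsilon> n)) \<longlonglongrightarrow> 0"
    proof (rule tendsto_sandwich[OF _ _ tendsto_const])
      show "(\<lambda>n. prob (far \<delta>1 (hi + \<epsilon>) n) + prob (far \<delta>2 (lo - \<epsilon>) n)) \<longlonglongrightarrow> 0"
        using tendsto_add[OF far_lim[OF \<delta>(1), of "hi + \<epsilon>"] far_lim[OF \<delta>(2), of "lo - \<epsilon>"]] by simp
      show "\<forall>\<^sub>F n in sequentially. prob (bad \<epsilon> n) \<le> prob (far \<delta>1 (hi + \<epsilon>) n) + prob (far \<delta>2 (lo - \<epsilon>) n)"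
      proof (rule eventually_sequentiallyI[of 1])
        fix n :: nat assume n: "1 \<le> n"
        have "prob {w\<in>space M. emp {lo<..<hi} n w \<noteq> 0} = 0"
          unfolding emp_def by (rule gap_values_null) (use n Q.gap_null in \<open>auto simp: lo_def hi_def\<close>)
        moreover have "prob (bad \<epsilon> n) \<le> prob (far \<delta>1 (hi + \<epsilon>) n \<union> far \<delta>2 (lo - \<epsilon>) n) + prob {w\<in>space M. emp {lo<..<hi} n w \<noteq> 0}"
          unfolding bad_eq by (rule measure_Un_le) (use far_sets null_sets in auto)
        moreover have "prob (far \<delta>1 (hi + \<epsilon>) n \<union> far \<delta>2 (lo - \<epsilon>) n) \<le> prob (far \<delta>1 (hi + \<epsilon>) n) + prob (far \<delta>2 (lo - \<epsilon>) n)"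
          by (rule measure_Un_le) (use far_sets in auto)
        ultimately show "prob (bad \<epsilon> n) \<le> prob (far \<delta>1 (hi + \<epsilon>) n) + prob (far \<delta>2 (lo - \<epsilon>) n)" by linarith
      qed
    qed simp
    show "\<forall>\<^sub>F n in sequentially. \<forall>w\<in>space M - bad \<epsilon> n.
        \<bar>?R n w\<bar> \<le> \<epsilon> * \<bar>W n w\<bar> + sqrt (real n) * ((\<epsilon> + (hi - lo)) / real (n choose m))"
    proof (rule eventually_sequentiallyI[of "max 1 m"], rule ballI)
      fix n w assume n: "max 1 m \<le> n" and w: "w \<in> space M - bad \<epsilon> n"
      have mn: "m \<le> n" using n by simp
      define v where "v = kernel_values X m h n w"
      define N where "N = real (n choose m)"
      have len: "length v = n choose m" by (simp add: v_def length_kernel_values)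
      have N: "N > 0" using mn by (simp add: N_def)
      note cr = cut_rank_bounds[OF \<gamma> mn]
      have near_hi: "v ! (cut_rank m n \<gamma> - 1) \<le> hi + \<epsilon>"
      proof -
        have "\<bar>dev {..hi + \<epsilon>} n w\<bar> \<le> \<delta>1" using w by (auto simp: bad_eq far_def)
        moreover have "\<gamma> \<le> e" if "\<bar>e - p\<bar> \<le> (p - \<gamma>) / 2" "(p - \<gamma>) / 2 > 0" for e p :: real
          using abs_le_D2[OF that(1)] that(2) by (simp add: field_simps)
        ultimately have "\<gamma> \<le> emp {..hi + \<epsilon>} n w" using \<delta>(1) unfolding dev_def \<delta>1_def cdf_def by blast
        thus ?thesis using near_quantile_of_empirical(1)[OF \<gamma> mn] by (simp add: emp_def v_def)
      qed
      have near_lo: "lo - \<epsilon> \<le> v ! (cut_rank m n \<gamma> - 1)"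
      proof -
        have "\<bar>dev {..lo - \<epsilon>} n w\<bar> \<le> \<delta>2" using w by (auto simp: bad_eq far_def)
        moreover have "e < \<gamma>" if "\<bar>e - p\<bar> \<le> (\<gamma> - p) / 2" "(\<gamma> - p) / 2 > 0" for e p :: real
          using abs_le_D1[OF that(1)] that(2) by (simp add: field_simps)
        ultimately have "emp {..lo - \<epsilon>} n w < \<gamma>" using \<delta>(2) unfolding dev_def \<delta>2_def cdf_def by blast
        thus ?thesis using near_quantile_of_empirical(2)[OF \<gamma> mn, of _ w]
          by (auto simp: emp_def v_def intro: less_imp_le)
      qed
      have gap: "v ! k \<notin> {lo<..<hi}" if k: "k < length v" for k
      proof -
        have "real (card {k. k < n choose m \<and> v ! k \<in> {lo<..<hi}}) / real (n choose m) = 0"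
          using w by (auto simp: bad_eq emp_def u_stat_indicator v_def)
        hence "card {k. k < n choose m \<and> v ! k \<in> {lo<..<hi}} = 0" using N by (simp add: N_def)
        thus ?thesis using k by (auto simp: len)
      qed
      have sv: "sorted v" by (simp add: v_def kernel_values_def)
      have r: "cut_rank m n \<gamma> - 1 < length v" using cr by (simp add: len)
      have rank: "\<gamma> * real (length v) - 1 \<le> real (cut_rank m n \<gamma> - 1)" "real (cut_rank m n \<gamma> - 1) \<le> \<gamma> * real (length v)"
        using cr by (simp_all add: len of_nat_diff)
      have b: "\<gamma> \<le> measure kernel_law {..c}" "measure kernel_law {..<c} \<le> \<gamma>"
        "c < hi \<Longrightarrow> measure kernel_law {..c} = \<gamma>" "lo < c \<Longrightarrow> measure kernel_law {..<c} = \<gamma>"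
        using Q.between[of c] c by (simp_all add: lo_def hi_def cdf_def)
      have e_le: "real (card {k. k < length v \<and> v ! k \<le> c}) / real (length v) = emp {..c} n w"
        "real (card {k. k < length v \<and> v ! k < c}) / real (length v) = emp {..<c} n w"
        by (simp_all add: emp_def u_stat_indicator v_def length_kernel_values)
      have main: "\<bar>trim_excess v (cut_rank m n \<gamma> - 1) c / N
           - (hi - c) * max 0 (measure kernel_law {..c} - emp {..c} n w)
           - (c - lo) * max 0 (emp {..<c} n w - measure kernel_law {..<c})\<bar>
         \<le> \<epsilon> * (\<bar>dev {..c} n w\<bar> + \<bar>dev {..<c} n w\<bar>) + (\<epsilon> + (hi - lo)) / N"
        using trim_excess_approx[OF sv r c less_imp_le[OF \<epsilon>] gap near_lo near_hi rank b]
        unfolding e_le dev_def by (simp only: len N_def)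
      have "\<bar>?R n w\<bar> = sqrt (real n) * \<bar>trim_excess v (cut_rank m n \<gamma> - 1) c / N
           - (hi - c) * max 0 (measure kernel_law {..c} - emp {..c} n w)
           - (c - lo) * max 0 (emp {..<c} n w - measure kernel_law {..<c})\<bar>"
        by (simp add: abs_mult v_def N_def emp_def)
      also have "\<dots> \<le> sqrt (real n) * (\<epsilon> * (\<bar>dev {..c} n w\<bar> + \<bar>dev {..<c} n w\<bar>) + (\<epsilon> + (hi - lo)) / N)"
        by (rule mult_left_mono[OF main]) simp
      also have "\<dots> = \<epsilon> * \<bar>W n w\<bar> + sqrt (real n) * ((\<epsilon> + (hi - lo)) / real (n choose m))"
        by (simp add: W_def N_def abs_mult distrib_left)
      finally show "\<bar>?R n w\<bar> \<le> \<epsilon> * \<bar>W n w\<bar> + sqrt (real n) * ((\<epsilon> + (hi - lo)) / real (n choose m))" .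
    qed
  qed (use W_meas W_int in auto)
qed

end

section \<open>The trimmed statistic\<close>

lemma max_zero_scale: "0 \<le> c \<Longrightarrow> max 0 (c * x) = c * max 0 (x :: real)"
  by (simp add: max_mult_distrib_left)

lemma max_zero_lipschitz: "\<bar>max 0 x - max 0 y\<bar> \<le> \<bar>x - y :: real\<bar>"
  by (auto simp: max_def)

text \<open>
  The indicators of \<open>{..c}\<close> and \<open>{..<c}\<close> have the same effect on \<open>x - c\<close>, so that both brackets are of the
  form that occurs in \<open>sum_below_rank\<close>.
\<close>

lemma trim_fun_eq_min:
  "trim_fun H \<alpha> \<beta> x = (min (x - lower_quantile H \<beta>) 0 + \<beta> * lower_quantile H \<beta>)
     - (min (x - upper_quantile H \<alpha>) 0 + \<alpha> * upper_quantile H \<alpha>)"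
  by (auto simp: trim_fun_def indicator_def min_def)

text \<open>
  Written with positive parts instead of indicators, the limit is visibly a continuous function of the
  Gaussian vector.
\<close>

definition limit_map :: "real \<Rightarrow> real \<Rightarrow> real ^ 3 \<Rightarrow> real" where
  "limit_map d\<^sub>\<alpha> d\<^sub>\<beta> t = t $ 2 - d\<^sub>\<alpha> * max 0 (t $ 1) + d\<^sub>\<beta> * max 0 (- (t $ 3))"

lemma continuous_limit_map: "continuous_on UNIV (limit_map d\<^sub>\<alpha> d\<^sub>\<beta>)"
  unfolding limit_map_def[abs_def] by (intro continuous_intros)

lemma limit_map_eq_indicator:
  "limit_map d\<^sub>\<alpha> d\<^sub>\<beta> t = t $ 2 - d\<^sub>\<alpha> * indicator {0<..} (t $ 1) * t $ 1 - d\<^sub>\<beta> * indicator {..<0} (t $ 3) * t $ 3"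
  by (auto simp: limit_map_def indicator_def max_def)

locale trimmed_problem = trimmed_kernel M S F X m h
  for M :: "'w measure" and S F :: "'x measure" and X :: "nat \<Rightarrow> 'w \<Rightarrow> 'x" and m :: nat
    and h :: "(nat \<Rightarrow> 'x) \<Rightarrow> real" +
  fixes \<alpha> \<beta> :: real
  assumes \<alpha>\<beta>: "0 < \<alpha>" "\<alpha> < \<beta>" "\<beta> < 1"
begin

abbreviation "H \<equiv> cdf kernel_law"
abbreviation "a \<equiv> upper_quantile H \<alpha>"
abbreviation "b \<equiv> lower_quantile H \<beta>"

sublocale Q\<alpha>: quantile kernel_law \<alpha> by unfold_locales (use \<alpha>\<beta> in auto)
sublocale Q\<beta>: quantile kernel_law \<beta> by unfold_locales (use \<alpha>\<beta> in auto)

lemma trim_fun_measurable: "trim_fun H \<alpha> \<beta> \<in> borel_measurable borel"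
  unfolding trim_fun_eq_min[abs_def] by measurable

lemma trim_fun_bounded: "\<bar>trim_fun H \<alpha> \<beta> x\<bar> \<le> \<bar>b - a\<bar> + \<bar>\<beta> * b\<bar> + \<bar>\<alpha> * a\<bar>"
proof -
  have "\<bar>min (x - b) 0 - min (x - a) 0\<bar> \<le> \<bar>b - a\<bar>" by (auto simp: min_def)
  thus ?thesis unfolding trim_fun_eq_min by linarith
qed

lemma trim_center_eq: "trim_center H \<alpha> \<beta> = (LINT x|kernel_law. trim_fun H \<alpha> \<beta> x)"
proof -
  have "interval_measure H = kernel_law"
  proof (rule cdf_unique)
    show "real_distribution (interval_measure H)"
      by (intro real_distribution_interval_measure D.cdf_nondecreasing D.cdf_is_right_cont
          D.cdf_lim_at_bot D.cdf_lim_at_top_prob)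
    show "real_distribution kernel_law" by (fact D.real_distribution_axioms)
    show "cdf (interval_measure H) = H"
      by (intro cdf_interval_measure D.cdf_nondecreasing D.cdf_is_right_cont
          D.cdf_lim_at_bot D.cdf_lim_at_top_prob)
  qed
  thus ?thesis by (simp add: trim_center_def)
qed

sublocale G: bounded_kernel M S F X m "\<lambda>z. trim_fun H \<alpha> \<beta> (h z)" "\<bar>b - a\<bar> + \<bar>\<beta> * b\<bar> + \<bar>\<alpha> * a\<bar>"
  by (rule bounded_kernel_comp[OF trim_fun_measurable trim_fun_bounded])
sublocale L: bounded_kernel M S F X m "\<lambda>z. indicator {..<a} (h z)" 1
  by (rule bounded_kernel_indicator) simp
sublocale U: bounded_kernel M S F X m "\<lambda>z. indicator {..b} (h z)" 1
  by (rule bounded_kernel_indicator) simp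

lemma means:
  "kernel_mean M X m (\<lambda>z. trim_fun H \<alpha> \<beta> (h z)) = trim_center H \<alpha> \<beta>"
  "kernel_mean M X m (\<lambda>z. indicator {..<a} (h z)) = measure kernel_law {..<a}"
  "kernel_mean M X m (\<lambda>z. indicator {..b} (h z)) = measure kernel_law {..b}"
  by (simp_all add: kernel_mean_comp[OF trim_fun_measurable] trim_center_eq kernel_mean_indicator)

lemma proj_eq_hajek_term:
  "proj_g M X m h \<alpha> \<beta> = hajek_term M X m (\<lambda>z. trim_fun H \<alpha> \<beta> (h z))"
  "proj_lower M X m h \<alpha> = hajek_term M X m (\<lambda>z. indicator {..<a} (h z))"
  "proj_upper M X m h \<beta> = hajek_term M X m (\<lambda>z. indicator {..b} (h z))"
proof -
  have "Lim (at_left a) H = measure kernel_law {..<a}"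
    by (rule tendsto_Lim[OF _ D.cdf_at_left]) simp
  thus "proj_lower M X m h \<alpha> = hajek_term M X m (\<lambda>z. indicator {..<a} (h z))"
    by (simp add: fun_eq_iff proj_lower_def hajek_term_def means kernel_at_def kernel_df_eq)
  have "H b = measure kernel_law {..b}" by (simp add: cdf_def)
  thus "proj_upper M X m h \<beta> = hajek_term M X m (\<lambda>z. indicator {..b} (h z))"
    by (simp add: fun_eq_iff proj_upper_def hajek_term_def means kernel_at_def kernel_df_eq)
qed (simp add: fun_eq_iff proj_g_def hajek_term_def means kernel_at_def kernel_df_eq)

definition score :: "'x \<Rightarrow> real ^ 3" where
  "score x = vector [proj_lower M X m h \<alpha> x, proj_g M X m h \<alpha> \<beta> x, proj_upper M X m h \<beta> x]"

lemma score_component: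
  "score x $ 1 = proj_lower M X m h \<alpha> x" "score x $ 2 = proj_g M X m h \<alpha> \<beta> x"
  "score x $ 3 = proj_upper M X m h \<beta> x"
  by (simp_all add: score_def)

lemma score_component_measurable: "(\<lambda>x. score x $ j) \<in> borel_measurable S"
  using exhaust_3[of j] L.k1_measurable G.k1_measurable U.k1_measurable
  by (auto simp: score_component proj_eq_hajek_term)

lemma score_measurable: "score \<in> measurable S borel"
proof -
  have "(\<lambda>x. score x \<bullet> i) \<in> borel_measurable S" if i: "i \<in> Basis" for i :: "real ^ 3"
  proof -
    obtain j where "i = axis j 1" using i by (auto simp: Basis_vec_def)
    hence "score x \<bullet> i = score x $ j" for x by (simp add: inner_axis)
    thus ?thesis using score_component_measurable[of j] by simp
  qed
  thus ?thesis by (simp add: borel_measurable_euclidean_space[of score])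
qed

lemma score_component_bounded: "\<exists>C. \<forall>x j. \<bar>score x $ j\<bar> \<le> C"
proof -
  define K where "K = \<bar>b - a\<bar> + \<bar>\<beta> * b\<bar> + \<bar>\<alpha> * a\<bar>"
  have K: "K \<ge> 0" by (simp add: K_def)
  have "\<bar>score x $ j\<bar> \<le> 2 * K + 2" for x j
  proof -
    consider "j = 1" | "j = 2" | "j = 3" using exhaust_3[of j] by blast
    thus ?thesis
    proof cases
      case 1
      have "\<bar>score x $ j\<bar> \<le> 2" using L.k1_bound[of x] by (simp add: 1 score_component proj_eq_hajek_term)
      thus ?thesis using K by linarith
    next
      case 2
      have "\<bar>score x $ j\<bar> \<le> 2 * K" using G.k1_bound[of x] by (simp add: 2 score_component proj_eq_hajek_term K_def)
      thus ?thesis by linarith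
    next
      case 3
      have "\<bar>score x $ j\<bar> \<le> 2" using U.k1_bound[of x] by (simp add: 3 score_component proj_eq_hajek_term)
      thus ?thesis using K by linarith
    qed
  qed
  thus ?thesis by blast
qed

lemma score_component_mean: "(LINT x|F. score x $ j) = 0"
  using exhaust_3[of j] L.k1_mean_zero G.k1_mean_zero U.k1_mean_zero
  by (auto simp: score_component proj_eq_hajek_term)

abbreviation "d\<^sub>\<alpha> \<equiv> quantile_gap H \<alpha>"
abbreviation "d\<^sub>\<beta> \<equiv> quantile_gap H \<beta>"

lemma trimmed_stat_centered:
  assumes n: "m \<le> n"
  defines "N \<equiv> real (n choose m)"
  shows "trimmed_stat X m h \<alpha> \<beta> n w - trim_center H \<alpha> \<beta>
    = (u_stat X m (\<lambda>z. trim_fun H \<alpha> \<beta> (h z)) n w - trim_center H \<alpha> \<beta>)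
      + (real (cut_rank m n \<beta> - 1) / N - \<beta>) * b - (real (cut_rank m n \<alpha> - 1) / N - \<alpha>) * a
      + trim_excess (kernel_values X m h n w) (cut_rank m n \<beta> - 1) b / N
      - trim_excess (kernel_values X m h n w) (cut_rank m n \<alpha> - 1) a / N"
proof -
  define v where "v = kernel_values X m h n w"
  have N: "N > 0" using n by (simp add: N_def)
  have "(\<Sum>k<n choose m. trim_fun H \<alpha> \<beta> (v ! k))
      = (\<Sum>k<n choose m. min (v ! k - b) 0) + N * (\<beta> * b)
        - ((\<Sum>k<n choose m. min (v ! k - a) 0) + N * (\<alpha> * a))"
    unfolding trim_fun_eq_min by (simp add: sum.distrib sum_subtractf N_def)
  hence "u_stat X m (\<lambda>z. trim_fun H \<alpha> \<beta> (h z)) n w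
      = (\<Sum>k<n choose m. min (v ! k - b) 0) / N + \<beta> * b - ((\<Sum>k<n choose m. min (v ! k - a) 0) / N + \<alpha> * a)"
    using N unfolding u_stat_comp v_def[symmetric] N_def[symmetric]
    by (simp add: add_divide_distrib diff_divide_distrib)
  moreover have "trimmed_stat X m h \<alpha> \<beta> n w =
      real (cut_rank m n \<beta> - 1) / N * b + (\<Sum>k<n choose m. min (v ! k - b) 0) / N
        + trim_excess v (cut_rank m n \<beta> - 1) b / N
    - (real (cut_rank m n \<alpha> - 1) / N * a + (\<Sum>k<n choose m. min (v ! k - a) 0) / N
        + trim_excess v (cut_rank m n \<alpha> - 1) a / N)"
    unfolding trimmed_stat_eq[OF n \<alpha>\<beta>, of X h w b a] v_def N_def
    by (simp add: add_divide_distrib)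
  ultimately show ?thesis unfolding v_def[symmetric] by (simp add: algebra_simps)
qed

text \<open>
  The excess at \<open>\<alpha>\<close> is taken at the upper end of the gap and the excess at \<open>\<beta>\<close> at its lower end, so one of
  the two positive parts in \<open>trim_excess_limit\<close> has the factor zero and the other one the length of
  the gap. The map \<open>limit_map\<close> is Lipschitz, so the U-statistics may be replaced by their
  projections inside it.
\<close>

lemma trimmed_stat_expansion:
  "vanishes_in_prob M (\<lambda>n w. sqrt (real n) / real m * (trimmed_stat X m h \<alpha> \<beta> n w - trim_center H \<alpha> \<beta>)
      - limit_map d\<^sub>\<alpha> d\<^sub>\<beta> ((1 / sqrt (real n)) *\<^sub>R (\<Sum>i<n. score (X (Suc i) w))))"
    (is "vanishes_in_prob M ?R")
proof -
  define err where "err k n w = sqrt (real n) / real m * (u_stat X m k n w - kernel_mean M X m k)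
      - (\<Sum>j\<in>{1..n}. hajek_term M X m k (X j w)) / sqrt (real n)" for k n w
  define exc where "exc \<gamma> c n w = sqrt (real n) *
      (trim_excess (kernel_values X m h n w) (cut_rank m n \<gamma> - 1) c / real (n choose m)
       - (upper_quantile H \<gamma> - c) * max 0 (measure kernel_law {..c} - u_stat X m (\<lambda>z. indicator {..c} (h z)) n w)
       - (c - lower_quantile H \<gamma>) * max 0 (u_stat X m (\<lambda>z. indicator {..<c} (h z)) n w - measure kernel_law {..<c}))"
    for \<gamma> c n w
  let ?kG = "\<lambda>z. trim_fun H \<alpha> \<beta> (h z)" and ?kL = "\<lambda>z. indicator {..<a} (h z)" and ?kU = "\<lambda>z. indicator {..b} (h z)"
  define bound where "bound n w = \<bar>err ?kG n w\<bar> + (\<bar>d\<^sub>\<alpha> * err ?kL n w\<bar> + (\<bar>d\<^sub>\<beta> * err ?kU n w\<bar>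
      + (\<bar>exc \<beta> b n w\<bar> + (\<bar>exc \<alpha> a n w\<bar> + sqrt (real n) * ((\<bar>a\<bar> + \<bar>b\<bar>) / real (n choose m))))))" for n w
  have err_van: "vanishes_in_prob M (err ?kG)" "vanishes_in_prob M (err ?kL)" "vanishes_in_prob M (err ?kU)"
    unfolding err_def[abs_def] by (rule G.hajek_projection L.hajek_projection U.hajek_projection)+
  have err_meas: "err ?kG n \<in> borel_measurable M" "err ?kL n \<in> borel_measurable M" "err ?kU n \<in> borel_measurable M" for n
    unfolding err_def[abs_def]
    by (intro borel_measurable_diff borel_measurable_times borel_measurable_divide borel_measurable_sum
          borel_measurable_const G.u_stat_measurable L.u_stat_measurable U.u_stat_measurable
          G.k1_X_measurable[of _ n] L.k1_X_measurable[of _ n] U.k1_X_measurable[of _ n]; assumption)+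
  have exc_van: "vanishes_in_prob M (exc \<beta> b)" "vanishes_in_prob M (exc \<alpha> a)"
    unfolding exc_def[abs_def]
    by (rule trim_excess_limit; use \<alpha>\<beta> Q\<alpha>.lo_le_hi Q\<beta>.lo_le_hi in simp)+
  have exc_meas: "exc \<gamma> c n \<in> borel_measurable M" if "0 < \<gamma>" "\<gamma> < 1" for \<gamma> c n
    using trim_excess_measurable[OF cut_rank_pred_le[OF that, of m n]]
      empirical_measure_measurable[of "{..c}" n] empirical_measure_measurable[of "{..<c}" n]
    unfolding exc_def[abs_def] by simp
  have meas: "err ?kG n \<in> borel_measurable M" "err ?kL n \<in> borel_measurable M" "err ?kU n \<in> borel_measurable M"
    "exc \<beta> b n \<in> borel_measurable M" "exc \<alpha> a n \<in> borel_measurable M" for n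
    using err_meas exc_meas[of \<beta> b n] exc_meas[of \<alpha> a n] \<alpha>\<beta> by auto
  have bound_meas: "bound n \<in> borel_measurable M" for n
    unfolding bound_def[abs_def] using meas[of n] by simp
  have "vanishes_in_prob M bound"
    unfolding bound_def[abs_def]
    by (intro vanishes_in_prob_add vanishes_in_prob_abs vanishes_in_prob_scale err_van exc_van
          vanishes_in_prob_deterministic sqrt_over_choose_tendsto_0 m_pos)
       (use meas in simp_all)
  thus ?thesis
  proof (rule vanishes_in_prob_mono[OF bound_meas])
    show "\<forall>\<^sub>F n in sequentially. \<forall>w\<in>space M. \<bar>?R n w\<bar> \<le> \<bar>bound n w\<bar>"
    proof (rule eventually_sequentiallyI[of m], rule ballI)
      fix n w assume n: "m \<le> n"
      define s where "s = sqrt (real n)"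
      define N where "N = real (n choose m)"
      have m0: "real m \<ge> 1" and s0: "s \<ge> 0" and sm: "s / real m \<ge> 0" and N: "N > 0"
        using m_pos n by (simp_all add: s_def N_def)
      define V where "V = (1 / sqrt (real n)) *\<^sub>R (\<Sum>i<n. score (X (Suc i) w))"
      have V: "V $ j = (\<Sum>i\<in>{1..n}. score (X i w) $ j) / s" for j
      proof -
        have "(\<Sum>i<n. score (X (Suc i) w) $ j) = (\<Sum>i\<in>{1..n}. score (X i w) $ j)"
          by (rule sum.reindex_bij_witness[of _ "\<lambda>i. i - 1" Suc]) auto
        thus ?thesis by (simp add: V_def s_def sum_component)
      qed
      define x where "x = s / real m * (u_stat X m ?kL n w - measure kernel_law {..<a})"
      define y where "y = s / real m * (u_stat X m ?kU n w - measure kernel_law {..b})"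
      define u where "u = s / real m * (u_stat X m ?kG n w - trim_center H \<alpha> \<beta>)"
      have eG: "err ?kG n w = u - V $ 2" and eL: "err ?kL n w = x - V $ 1" and eU: "err ?kU n w = y - V $ 3"
        by (simp_all add: err_def u_def x_def y_def V s_def means score_component proj_eq_hajek_term)
      define t\<alpha> where "t\<alpha> = trim_excess (kernel_values X m h n w) (cut_rank m n \<alpha> - 1) a / N"
      define t\<beta> where "t\<beta> = trim_excess (kernel_values X m h n w) (cut_rank m n \<beta> - 1) b / N"
      define q where "q = (real (cut_rank m n \<beta> - 1) / N - \<beta>) * b - (real (cut_rank m n \<alpha> - 1) / N - \<alpha>) * a"
      have x\<alpha>: "s / real m * t\<alpha> = exc \<alpha> a n w / real m + d\<^sub>\<alpha> * max 0 x"
        unfolding x_def max_zero_scale[OF sm] t\<alpha>_def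
        by (simp add: exc_def s_def N_def quantile_gap_def algebra_simps add_divide_distrib diff_divide_distrib)
      have "- y = s / real m * (measure kernel_law {..b} - u_stat X m ?kU n w)"
        by (simp add: y_def algebra_simps)
      hence max_y: "max 0 (- y) = s / real m * max 0 (measure kernel_law {..b} - u_stat X m ?kU n w)"
        by (simp only: max_zero_scale[OF sm])
      have x\<beta>: "s / real m * t\<beta> = exc \<beta> b n w / real m + d\<^sub>\<beta> * max 0 (- y)"
        unfolding max_y t\<beta>_def
        by (simp add: exc_def s_def N_def quantile_gap_def algebra_simps add_divide_distrib diff_divide_distrib)
      have "s / real m * (trimmed_stat X m h \<alpha> \<beta> n w - trim_center H \<alpha> \<beta>)
          = u + s / real m * q + s / real m * t\<beta> - s / real m * t\<alpha>"
        unfolding trimmed_stat_centered[OF n] u_def q_def t\<alpha>_def t\<beta>_def N_def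
        by (simp only: right_diff_distrib distrib_left add_diff_eq)
      hence R: "?R n w = err ?kG n w + s / real m * q + exc \<beta> b n w / real m - exc \<alpha> a n w / real m
          + d\<^sub>\<beta> * (max 0 (- y) - max 0 (- (V $ 3))) - d\<^sub>\<alpha> * (max 0 x - max 0 (V $ 1))"
        unfolding V_def[symmetric] unfolding limit_map_def s_def[symmetric] x\<alpha> x\<beta> eG
        by (simp add: right_diff_distrib)
      have b1: "\<bar>d\<^sub>\<beta> * (max 0 (- y) - max 0 (- (V $ 3)))\<bar> \<le> \<bar>d\<^sub>\<beta> * err ?kU n w\<bar>"
        using max_zero_lipschitz[of "- y" "- (V $ 3)"] unfolding abs_mult eU by (intro mult_left_mono) auto
      have b2: "\<bar>d\<^sub>\<alpha> * (max 0 x - max 0 (V $ 1))\<bar> \<le> \<bar>d\<^sub>\<alpha> * err ?kL n w\<bar>"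
        using max_zero_lipschitz[of x "V $ 1"] unfolding abs_mult eL by (intro mult_left_mono) auto
      have div_m: "\<bar>z / real m\<bar> \<le> \<bar>z\<bar>" for z
        using m0 divide_left_mono[of 1 "real m" "\<bar>z\<bar>"] by (simp add: abs_divide)
      have rank: "\<bar>real (cut_rank m n \<gamma> - 1) / N - \<gamma>\<bar> \<le> 1 / N" if "0 < \<gamma>" "\<gamma> < 1" for \<gamma>
      proof -
        note cr = cut_rank_bounds[OF that n]
        have "real (cut_rank m n \<gamma> - 1) = real (cut_rank m n \<gamma>) - 1" using cr by (simp add: of_nat_diff)
        hence "\<bar>real (cut_rank m n \<gamma> - 1) - \<gamma> * N\<bar> \<le> 1" using cr by (simp add: N_def)
        hence "\<bar>real (cut_rank m n \<gamma> - 1) - \<gamma> * N\<bar> / N \<le> 1 / N" using N by (intro divide_right_mono) auto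
        moreover have "real (cut_rank m n \<gamma> - 1) / N - \<gamma> = (real (cut_rank m n \<gamma> - 1) - \<gamma> * N) / N"
          using N by (simp add: diff_divide_distrib)
        ultimately show ?thesis using N by (simp add: abs_divide)
      qed
      have "\<bar>q\<bar> \<le> \<bar>(real (cut_rank m n \<beta> - 1) / N - \<beta>) * b\<bar> + \<bar>(real (cut_rank m n \<alpha> - 1) / N - \<alpha>) * a\<bar>"
        unfolding q_def by (rule abs_triangle_ineq4)
      also have "\<dots> \<le> 1 / N * \<bar>b\<bar> + 1 / N * \<bar>a\<bar>"
        unfolding abs_mult using rank[of \<alpha>] rank[of \<beta>] \<alpha>\<beta> by (intro add_mono mult_right_mono) auto
      finally have "\<bar>q\<bar> \<le> (\<bar>a\<bar> + \<bar>b\<bar>) / N" by (simp add: add_divide_distrib)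
      hence "s * \<bar>q\<bar> \<le> s * ((\<bar>a\<bar> + \<bar>b\<bar>) / N)" using s0 by (rule mult_left_mono)
      moreover have "\<bar>s / real m * q\<bar> \<le> s * \<bar>q\<bar>" using div_m[of "s * q"] s0 by (simp add: abs_mult)
      ultimately have b3: "\<bar>s / real m * q\<bar> \<le> s * ((\<bar>a\<bar> + \<bar>b\<bar>) / N)" by linarith
      have collect: "\<bar>A + B + C - D + E - G\<bar> \<le> \<bar>A\<bar> + (x2 + (x1 + (y1 + (y2 + z))))"
        if "\<bar>B\<bar> \<le> z" "\<bar>C\<bar> \<le> y1" "\<bar>D\<bar> \<le> y2" "\<bar>E\<bar> \<le> x1" "\<bar>G\<bar> \<le> x2"
        for A B C D E G x1 x2 y1 y2 z :: real
        using that[THEN abs_le_D1] that[THEN abs_le_D2] abs_ge_self[of A] abs_ge_minus_self[of A]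
        by (intro abs_leI) linarith+
      have bound_eq: "bound n w = \<bar>err ?kG n w\<bar> + (\<bar>d\<^sub>\<alpha> * err ?kL n w\<bar> + (\<bar>d\<^sub>\<beta> * err ?kU n w\<bar>
          + (\<bar>exc \<beta> b n w\<bar> + (\<bar>exc \<alpha> a n w\<bar> + s * ((\<bar>a\<bar> + \<bar>b\<bar>) / N)))))"
        by (simp only: bound_def s_def N_def)
      have "\<bar>?R n w\<bar> \<le> bound n w"
        unfolding R bound_eq by (rule collect[OF b3 div_m div_m b1 b2])
      thus "\<bar>?R n w\<bar> \<le> \<bar>bound n w\<bar>" by linarith
    qed
  qed
qed

end

theorem corollary1p2:
  fixes M :: "'w measure" and S F :: "'x measure" and X :: "nat \<Rightarrow> 'w \<Rightarrow> 'x"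
    and m :: nat and h :: "(nat \<Rightarrow> 'x) \<Rightarrow> real" and \<alpha> \<beta> :: real
    and H :: "real \<Rightarrow> real" and \<theta> :: real and g g\<^sub>\<alpha> g\<^sub>\<beta> :: "'x \<Rightarrow> real"
    and P :: "'b measure" and T :: "'b \<Rightarrow> real ^ 3"
  assumes "prob_space M"
    and "prob_space.indep_vars M (\<lambda>_. S) X {1..}"
    and "\<And>i. i \<ge> 1 \<Longrightarrow> distr M S (X i) = F"
    and "m \<ge> 1"
    and "h \<in> borel_measurable (Pi\<^sub>M {1..m} (\<lambda>_. S))"
    and "symmetric_kernel S m h"
    and "0 < \<alpha>" and "\<alpha> < \<beta>" and "\<beta> < 1"
  defines "H \<equiv> kernel_df M X m h"
    and "\<theta> \<equiv> trim_center H \<alpha> \<beta>"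
    and "g \<equiv> proj_g M X m h \<alpha> \<beta>"
    and "g\<^sub>\<alpha> \<equiv> proj_lower M X m h \<alpha>"
    and "g\<^sub>\<beta> \<equiv> proj_upper M X m h \<beta>"
  assumes "(LINT x|F. (g x)\<^sup>2) > 0"
    and "prob_space P"
    and "gaussian_vector P T"
    and "mean_vector P T = 0"
    and "covariance_matrix P T = vector
      [vector [LINT x|F. (g\<^sub>\<alpha> x)\<^sup>2,    LINT x|F. g x * g\<^sub>\<alpha> x,  LINT x|F. g\<^sub>\<alpha> x * g\<^sub>\<beta> x],
       vector [LINT x|F. g x * g\<^sub>\<alpha> x,  LINT x|F. (g x)\<^sup>2,     LINT x|F. g x * g\<^sub>\<beta> x],
       vector [LINT x|F. g\<^sub>\<alpha> x * g\<^sub>\<beta> x, LINT x|F. g x * g\<^sub>\<beta> x,  LINT x|F. (g\<^sub>\<beta> x)\<^sup>2]]"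
  shows "weak_conv_m
    (\<lambda>n. distr M borel (\<lambda>\<omega>. sqrt (real n) / real m * (trimmed_stat X m h \<alpha> \<beta> n \<omega> - \<theta>)))
    (distr P borel (\<lambda>w. T w $ 2
       - quantile_gap H \<alpha> * indicator {0<..} (T w $ 1) * T w $ 1
       - quantile_gap H \<beta> * indicator {..<0} (T w $ 3) * T w $ 3))"
proof -
  interpret prob_space M by fact
  interpret Tr: trimmed_problem M S F X m h \<alpha> \<beta>
    by unfold_locales (use assms(2-9) in auto)
  have H: "H = cdf Tr.kernel_law" unfolding H_def by (rule Tr.kernel_df_eq)
  define Z where "Z i \<omega> = Tr.score (X (Suc i) \<omega>)" for i \<omega>
  have Z_meas: "Z i \<in> borel_measurable M" for i
    unfolding Z_def[abs_def] by (rule measurable_compose[OF Tr.X_measurable Tr.score_measurable]) simp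
  have Z_expect: "expectation (\<lambda>\<omega>. f (Z i \<omega>)) = (LINT x|F. f (Tr.score x))"
    if "f \<in> borel_measurable borel" for f :: "real ^ 3 \<Rightarrow> real" and i
    unfolding Z_def by (rule Tr.expectation_single) (use that Tr.score_measurable in auto)
  define \<Phi> where "\<Phi> = limit_map (quantile_gap H \<alpha>) (quantile_gap H \<beta>)"
  have \<Phi>_cont: "continuous_on UNIV \<Phi>" unfolding \<Phi>_def by (rule continuous_limit_map)
  have \<Phi>_meas: "\<Phi> \<in> borel_measurable borel" by (rule borel_measurable_continuous_onI[OF \<Phi>_cont])
  have T_meas: "T \<in> borel_measurable P" using assms(17) by (simp add: gaussian_vector_def)
  have clt: "(\<lambda>n. expectation (\<lambda>\<omega>. f ((1 / sqrt (real n)) *\<^sub>R (\<Sum>i<n. Z i \<omega>)))) \<longlonglongrightarrow> (LINT w|P. f (T w))"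
    if f: "continuous_on UNIV f" and B: "\<And>x. \<bar>f x\<bar> \<le> B" for f :: "real ^ 3 \<Rightarrow> real" and B
  proof (rule iid_vector_clt[OF _ _ _ _ assms(16-18) _ f B])
    from indep_vars_compose2[OF Tr.indep_shifted, of "\<lambda>_. Tr.score" "\<lambda>_. borel"] Tr.score_measurable
    show "indep_vars (\<lambda>_. borel) Z UNIV" unfolding Z_def by simp
    show "distr M borel (Z i) = distr M borel (Z 0)" for i
    proof -
      have "distr M borel (Z i) = distr (distr M S (X (Suc i))) borel Tr.score" for i
        unfolding Z_def[abs_def]
        using distr_distr[OF Tr.score_measurable Tr.X_measurable[of "Suc i"]] by (simp add: comp_def)
      thus ?thesis by (simp add: assms(3))
    qed
    obtain C where C: "\<And>x j. \<bar>Tr.score x $ j\<bar> \<le> C" using Tr.score_component_bounded by blast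
    show "integrable M (\<lambda>\<omega>. (Z 0 \<omega> $ j)\<^sup>2)" for j
    proof (rule integrable_const_bound[of _ "C\<^sup>2"])
      show "AE \<omega> in M. norm ((Z 0 \<omega> $ j)\<^sup>2) \<le> C\<^sup>2"
        unfolding Z_def by (intro AE_I2) (simp add: abs_le_square_iff[symmetric] order_trans[OF C abs_ge_self])
    qed (use Z_meas in simp)
    show "expectation (\<lambda>\<omega>. Z 0 \<omega> $ j) = 0" for j
      using Z_expect[of "\<lambda>t. t $ j" 0] Tr.score_component_mean by simp
    show "covariance_matrix P T $ j $ k = expectation (\<lambda>\<omega>. Z 0 \<omega> $ j * Z 0 \<omega> $ k)" for j k
    proof -
      have "expectation (\<lambda>\<omega>. Z 0 \<omega> $ j * Z 0 \<omega> $ k) = (LINT x|F. Tr.score x $ j * Tr.score x $ k)"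
        by (rule Z_expect[of "\<lambda>t. t $ j * t $ k"]) simp
      thus ?thesis
        using exhaust_3[of j] exhaust_3[of k]
        by (auto simp: assms(19) Tr.score_component g_def g\<^sub>\<alpha>_def g\<^sub>\<beta>_def power2_eq_square mult.commute)
    qed
  qed
  have "weak_conv_m (\<lambda>n. distr M borel (\<lambda>\<omega>. sqrt (real n) / real m * (trimmed_stat X m h \<alpha> \<beta> n \<omega> - \<theta>)))
      (distr P borel (\<lambda>w. \<Phi> (T w)))"
  proof (rule weak_conv_m_if_close_to_convergent[where Y="\<lambda>n \<omega>. \<Phi> ((1 / sqrt (real n)) *\<^sub>R (\<Sum>i<n. Z i \<omega>))"])
    show "(\<lambda>\<omega>. \<Phi> ((1 / sqrt (real n)) *\<^sub>R (\<Sum>i<n. Z i \<omega>))) \<in> borel_measurable M" for n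
      by (rule measurable_compose[OF _ \<Phi>_meas]) (use Z_meas in simp)
    show "(\<lambda>\<omega>. sqrt (real n) / real m * (trimmed_stat X m h \<alpha> \<beta> n \<omega> - \<theta>)) \<in> borel_measurable M" for n
      using Tr.trimmed_stat_measurable[OF assms(7-9), of n] by simp
    show "vanishes_in_prob M (\<lambda>n \<omega>. sqrt (real n) / real m * (trimmed_stat X m h \<alpha> \<beta> n \<omega> - \<theta>)
        - \<Phi> ((1 / sqrt (real n)) *\<^sub>R (\<Sum>i<n. Z i \<omega>)))"
      using Tr.trimmed_stat_expansion unfolding \<Phi>_def Z_def \<theta>_def H .
    show "prob_space P" by fact
    show "(\<lambda>w. \<Phi> (T w)) \<in> borel_measurable P" by (rule measurable_compose[OF T_meas \<Phi>_meas])
    fix f :: "real \<Rightarrow> real" and B assume f: "continuous_on UNIV f" and B: "\<And>x. \<bar>f x\<bar> \<le> B"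
    have "continuous_on UNIV (\<lambda>t. f (\<Phi> t))"
      by (rule continuous_on_compose2[OF f \<Phi>_cont]) auto
    from clt[OF this B]
    show "(\<lambda>n. expectation (\<lambda>\<omega>. f (\<Phi> ((1 / sqrt (real n)) *\<^sub>R (\<Sum>i<n. Z i \<omega>))))) \<longlonglongrightarrow> (LINT w|P. f (\<Phi> (T w)))" .
  qed
  thus ?thesis unfolding \<Phi>_def limit_map_eq_indicator .
qed

end
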